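(* Let $A$ be a unitarizable Hopf $*$-algebra and $Z$ an $A$-$*$-Galois extension with a positive Haar measure. Let $\widehat A$ be the set of isomorphism classes of irreducible finite-dimensional $A$-comodules and $n_\lambda$ the dimension of a representative of $\lambda\in\widehat A$. Then $Z=\bigoplus_{\lambda\in\widehat A}Z(\lambda)$ where each $Z(\lambda)$ is a sub-$A$-comodule of dimension $n_\lambda p_\lambda$ for some positive integer $p_\lambda$; for each $\lambda$ there is a basis $(z^\lambda_{ij})_{1\le i\le n_\lambda,1\le j\le p_\lambda}$ of $Z(\lambda)$ with $\sum_{i=1}^{n_\lambda}(z^\lambda_{ij})^*z^\lambda_{ik}=\delta_{jk}$ and $\sum_{j=1}^{p_\lambda}z^\lambda_{ij}(z^\lambda_{kj})^*=\delta_{ik}$; and there is a basis $(a^\lambda_{ij})_{\lambda\in\widehat A,1\le i,j\le n_\lambda}$ of $A$ such that each matrix $(a^\lambda_{ij})_{i,j}$ is unitary and $\alpha_Z(z^\lambda_{ij})=\sum_{k=1}^{n_\lambda}a^\lambda_{ik}\otimes z^\lambda_{kj}$.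
   Context: Base field $\mathbb C$. A Hopf $*$-algebra is a Hopf algebra that is a $*$-algebra with $\Delta$ a $*$-homomorphism; unitarizable means every finite-dimensional right comodule $V$ admits a scalar product $\phi_V:\overline V\otimes V\to\mathbb C$ that is a comodule map ($\overline V$ the conjugate comodule, $\overline v\mapsto\sum\overline{v_i}\otimes a_i^*$ if $\alpha_V(v)=\sum v_i\otimes a_i$). An $A$-$*$-Galois extension is a nonzero $*$-algebra $Z$ with a left coaction $\alpha_Z:Z\to A\otimes Z$ that is a $*$-homomorphism and with $(1_A\otimes m_Z)(\alpha_Z\otimes 1_Z):Z\otimes Z\to A\otimes Z$ bijective. A Haar measure on $Z$: linear $\mu$ with $(1_A\otimes\mu)\alpha_Z=\mu(\cdot)1_A$, $\mu(1)=1$; positive if $\mu(z^*z)\ge0$. A matrix $(a_{ij})$ over a $*$-algebra is unitary if $a^*a=aa^*=1$ with $(a^* )_{ij}=a_{ji}^*$. *)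

theory Defs
  imports Complex_Main
begin

text \<open>A unital complex algebra is modelled as a type of class ring_1 together with
  a central unital ring homomorphism from the complex numbers (scalar multiplication
  c x := iota c * x).\<close>

definition sc :: "(complex \<Rightarrow> 'a::ring_1) \<Rightarrow> complex \<Rightarrow> 'a \<Rightarrow> 'a" where
  "sc \<iota> c x = \<iota> c * x"

definition calg :: "(complex \<Rightarrow> 'a::ring_1) \<Rightarrow> bool" where
  "calg \<iota> \<longleftrightarrow> (\<forall>c d. \<iota> (c + d) = \<iota> c + \<iota> d) \<and> (\<forall>c d. \<iota> (c * d) = \<iota> c * \<iota> d)
     \<and> \<iota> 1 = 1 \<and> (\<forall>c x. \<iota> c * x = x * \<iota> c)"

definition star_alg :: "(complex \<Rightarrow> 'a::ring_1) \<Rightarrow> ('a \<Rightarrow> 'a) \<Rightarrow> bool" where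
  "star_alg \<iota> st \<longleftrightarrow> calg \<iota> \<and> (\<forall>x. st (st x) = x) \<and> (\<forall>x y. st (x + y) = st x + st y)
     \<and> (\<forall>x y. st (x * y) = st y * st x) \<and> (\<forall>c x. st (\<iota> c * x) = \<iota> (cnj c) * st x)"

definition clin :: "(complex \<Rightarrow> 'a::ring_1) \<Rightarrow> ('a \<Rightarrow> complex) \<Rightarrow> bool" where
  "clin \<iota> \<phi> \<longleftrightarrow> (\<forall>x y. \<phi> (x + y) = \<phi> x + \<phi> y) \<and> (\<forall>c x. \<phi> (\<iota> c * x) = c * \<phi> x)"

text \<open>Tensors in V (x) W are represented by finite lists of pairs (formal sums of
  elementary tensors). Two such lists represent the same tensor iff they agree under
  all functionals phi (x) psi with phi, psi linear (this detects equality in the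
  algebraic tensor product over a field).\<close>
definition tev :: "('a \<Rightarrow> complex) \<Rightarrow> ('b \<Rightarrow> complex) \<Rightarrow> ('a \<times> 'b) list \<Rightarrow> complex" where
  "tev \<phi> \<psi> xs = sum_list (map (\<lambda>(a, b). \<phi> a * \<psi> b) xs)"

definition teq :: "(complex \<Rightarrow> 'a::ring_1) \<Rightarrow> (complex \<Rightarrow> 'b::ring_1)
    \<Rightarrow> ('a \<times> 'b) list \<Rightarrow> ('a \<times> 'b) list \<Rightarrow> bool" where
  "teq \<iota>A \<iota>B xs ys \<longleftrightarrow> (\<forall>\<phi> \<psi>. clin \<iota>A \<phi> \<longrightarrow> clin \<iota>B \<psi> \<longrightarrow> tev \<phi> \<psi> xs = tev \<phi> \<psi> ys)"

definition hopf_star_alg :: "(complex \<Rightarrow> 'a::ring_1) \<Rightarrow> ('a \<Rightarrow> 'a) \<Rightarrow> ('a \<Rightarrow> ('a \<times> 'a) list)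
    \<Rightarrow> ('a \<Rightarrow> complex) \<Rightarrow> bool" where
  "hopf_star_alg \<iota> st \<Delta> \<epsilon> \<longleftrightarrow> star_alg \<iota> st \<and>
    (\<forall>x y. teq \<iota> \<iota> (\<Delta> (x + y)) (\<Delta> x @ \<Delta> y)) \<and>
    (\<forall>c x. teq \<iota> \<iota> (\<Delta> (\<iota> c * x)) (map (\<lambda>(a, b). (\<iota> c * a, b)) (\<Delta> x))) \<and>
    (\<forall>x y. teq \<iota> \<iota> (\<Delta> (x * y))
        (concat (map (\<lambda>(a, b). map (\<lambda>(a', b'). (a * a', b * b')) (\<Delta> y)) (\<Delta> x)))) \<and>
    teq \<iota> \<iota> (\<Delta> 1) [(1, 1)] \<and>
    (\<forall>x \<phi> \<psi> \<chi>. clin \<iota> \<phi> \<and> clin \<iota> \<psi> \<and> clin \<iota> \<chi> \<longrightarrow>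
        sum_list (map (\<lambda>(a, b). tev \<phi> \<psi> (\<Delta> a) * \<chi> b) (\<Delta> x))
      = sum_list (map (\<lambda>(a, b). \<phi> a * tev \<psi> \<chi> (\<Delta> b)) (\<Delta> x))) \<and>
    clin \<iota> \<epsilon> \<and> (\<forall>x y. \<epsilon> (x * y) = \<epsilon> x * \<epsilon> y) \<and> \<epsilon> 1 = 1 \<and>
    (\<forall>x. sum_list (map (\<lambda>(a, b). \<iota> (\<epsilon> a) * b) (\<Delta> x)) = x) \<and>
    (\<forall>x. sum_list (map (\<lambda>(a, b). a * \<iota> (\<epsilon> b)) (\<Delta> x)) = x) \<and>
    (\<forall>x. teq \<iota> \<iota> (\<Delta> (st x)) (map (\<lambda>(a, b). (st a, st b)) (\<Delta> x))) \<and>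
    (\<exists>S. (\<forall>x y. S (x + y) = S x + S y) \<and> (\<forall>c x. S (\<iota> c * x) = \<iota> c * S x) \<and>
         (\<forall>x. sum_list (map (\<lambda>(a, b). S a * b) (\<Delta> x)) = \<iota> (\<epsilon> x)) \<and>
         (\<forall>x. sum_list (map (\<lambda>(a, b). a * S b) (\<Delta> x)) = \<iota> (\<epsilon> x)))"

text \<open>Finite-dimensional right comodules, up to isomorphism, are comodule structures
  on C^n, i.e. matrix corepresentations: alpha(e_j) = sum_i e_i (x) u i j.
  Vectors of C^n are functions nat => complex vanishing from n on.\<close>
definition vecs :: "nat \<Rightarrow> (nat \<Rightarrow> complex) set" where
  "vecs n = {v. \<forall>i\<ge>n. v i = 0}"

definition corep :: "(complex \<Rightarrow> 'a::ring_1) \<Rightarrow> ('a \<Rightarrow> ('a \<times> 'a) list) \<Rightarrow> ('a \<Rightarrow> complex)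
    \<Rightarrow> nat \<Rightarrow> (nat \<Rightarrow> nat \<Rightarrow> 'a) \<Rightarrow> bool" where
  "corep \<iota> \<Delta> \<epsilon> n u \<longleftrightarrow> (\<forall>i<n. \<forall>j<n.
     teq \<iota> \<iota> (\<Delta> (u i j)) (map (\<lambda>k. (u i k, u k j)) [0..<n]) \<and> \<epsilon> (u i j) = (if i = j then 1 else 0))"

text \<open>Irreducible: nonzero and no subcomodules other than 0 and the whole space.
  W is a subcomodule iff (id (x) phi)(alpha v) lies in W for all v in W and linear phi.\<close>
definition corep_irred :: "(complex \<Rightarrow> 'a::ring_1) \<Rightarrow> nat \<Rightarrow> (nat \<Rightarrow> nat \<Rightarrow> 'a) \<Rightarrow> bool" where
  "corep_irred \<iota> n u \<longleftrightarrow> n > 0 \<and>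
    (\<forall>W. W \<subseteq> vecs n \<and> (\<lambda>_. 0) \<in> W \<and> (\<forall>v\<in>W. \<forall>w\<in>W. (\<lambda>i. v i + w i) \<in> W) \<and> (\<forall>c. \<forall>v\<in>W. (\<lambda>i. c * v i) \<in> W)
       \<and> (\<forall>v\<in>W. \<forall>\<phi>. clin \<iota> \<phi> \<longrightarrow> (\<lambda>i. if i < n then (\<Sum>j<n. v j * \<phi> (u i j)) else 0) \<in> W)
       \<longrightarrow> W = {\<lambda>_. 0} \<or> W = vecs n)"

definition corep_iso :: "(complex \<Rightarrow> 'a::ring_1) \<Rightarrow> nat \<Rightarrow> (nat \<Rightarrow> nat \<Rightarrow> 'a)
    \<Rightarrow> nat \<Rightarrow> (nat \<Rightarrow> nat \<Rightarrow> 'a) \<Rightarrow> bool" where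
  "corep_iso \<iota> n u m w \<longleftrightarrow> n = m \<and>
    (\<exists>T S :: nat \<Rightarrow> nat \<Rightarrow> complex.
       (\<forall>i<n. \<forall>j<n. (\<Sum>l<n. S i l * T l j) = (if i = j then 1 else 0)
                  \<and> (\<Sum>l<n. T i l * S l j) = (if i = j then 1 else 0)) \<and>
       (\<forall>i<n. \<forall>j<n. (\<Sum>l<n. w i l * \<iota> (T l j)) = (\<Sum>l<n. \<iota> (T i l) * u l j)))"

definition irr_classes :: "(complex \<Rightarrow> 'a::ring_1) \<Rightarrow> ('a \<Rightarrow> ('a \<times> 'a) list) \<Rightarrow> ('a \<Rightarrow> complex)
    \<Rightarrow> (nat \<times> (nat \<Rightarrow> nat \<Rightarrow> 'a)) set set" where
  "irr_classes \<iota> \<Delta> \<epsilon> = {L. \<exists>n u. corep \<iota> \<Delta> \<epsilon> n u \<and> corep_irred \<iota> n u \<and>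
      L = {(m, w). corep \<iota> \<Delta> \<epsilon> m w \<and> corep_iso \<iota> n u m w}}"

definition cdim :: "(nat \<times> (nat \<Rightarrow> nat \<Rightarrow> 'a)) set \<Rightarrow> nat" where
  "cdim L = fst (SOME p. p \<in> L)"

text \<open>Unitarizable: every finite-dimensional comodule admits a scalar product (positive
  definite hermitian form, matrix G) phi: conj(V) (x) V -> C which is a comodule map,
  i.e. sum_{k,l} G k l (u k i)^* u l j = G i j 1.\<close>
definition unitarizable :: "(complex \<Rightarrow> 'a::ring_1) \<Rightarrow> ('a \<Rightarrow> 'a) \<Rightarrow> ('a \<Rightarrow> ('a \<times> 'a) list)
    \<Rightarrow> ('a \<Rightarrow> complex) \<Rightarrow> bool" where
  "unitarizable \<iota> st \<Delta> \<epsilon> \<longleftrightarrow> (\<forall>n u. corep \<iota> \<Delta> \<epsilon> n u \<longrightarrow>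
     (\<exists>G :: nat \<Rightarrow> nat \<Rightarrow> complex.
        (\<forall>i<n. \<forall>j<n. G i j = cnj (G j i)) \<and>
        (\<forall>v\<in>vecs n. v \<noteq> (\<lambda>_. 0) \<longrightarrow> Im (\<Sum>i<n. \<Sum>j<n. cnj (v i) * G i j * v j) = 0
                                 \<and> Re (\<Sum>i<n. \<Sum>j<n. cnj (v i) * G i j * v j) > 0) \<and>
        (\<forall>i<n. \<forall>j<n. (\<Sum>k<n. \<Sum>l<n. \<iota> (G k l) * st (u k i) * u l j) = \<iota> (G i j))))"

definition galois_map :: "('z::ring_1 \<Rightarrow> ('a \<times> 'z) list) \<Rightarrow> ('z \<times> 'z) list \<Rightarrow> ('a \<times> 'z) list" where
  "galois_map \<alpha> xs = concat (map (\<lambda>(x, y). map (\<lambda>(a, z). (a, z * y)) (\<alpha> x)) xs)"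

definition star_galois :: "(complex \<Rightarrow> 'a::ring_1) \<Rightarrow> ('a \<Rightarrow> 'a) \<Rightarrow> ('a \<Rightarrow> ('a \<times> 'a) list)
    \<Rightarrow> ('a \<Rightarrow> complex) \<Rightarrow> (complex \<Rightarrow> 'z::ring_1) \<Rightarrow> ('z \<Rightarrow> 'z) \<Rightarrow> ('z \<Rightarrow> ('a \<times> 'z) list) \<Rightarrow> bool" where
  "star_galois \<iota> st \<Delta> \<epsilon> \<iota>Z stZ \<alpha> \<longleftrightarrow> star_alg \<iota>Z stZ \<and>
    (\<forall>x y. teq \<iota> \<iota>Z (\<alpha> (x + y)) (\<alpha> x @ \<alpha> y)) \<and>
    (\<forall>c x. teq \<iota> \<iota>Z (\<alpha> (\<iota>Z c * x)) (map (\<lambda>(a, z). (\<iota> c * a, z)) (\<alpha> x))) \<and>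
    (\<forall>x y. teq \<iota> \<iota>Z (\<alpha> (x * y))
        (concat (map (\<lambda>(a, z). map (\<lambda>(b, w). (a * b, z * w)) (\<alpha> y)) (\<alpha> x)))) \<and>
    teq \<iota> \<iota>Z (\<alpha> 1) [(1, 1)] \<and>
    (\<forall>x. teq \<iota> \<iota>Z (\<alpha> (stZ x)) (map (\<lambda>(a, z). (st a, stZ z)) (\<alpha> x))) \<and>
    (\<forall>x \<phi> \<psi> \<chi>. clin \<iota> \<phi> \<and> clin \<iota> \<psi> \<and> clin \<iota>Z \<chi> \<longrightarrow>
        sum_list (map (\<lambda>(a, z). tev \<phi> \<psi> (\<Delta> a) * \<chi> z) (\<alpha> x))
      = sum_list (map (\<lambda>(a, z). \<phi> a * tev \<psi> \<chi> (\<alpha> z)) (\<alpha> x))) \<and>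
    (\<forall>x. sum_list (map (\<lambda>(a, z). \<iota>Z (\<epsilon> a) * z) (\<alpha> x)) = x) \<and>
    (\<forall>xs ys. teq \<iota> \<iota>Z (galois_map \<alpha> xs) (galois_map \<alpha> ys) \<longrightarrow> teq \<iota>Z \<iota>Z xs ys) \<and>
    (\<forall>ts. \<exists>xs. teq \<iota> \<iota>Z (galois_map \<alpha> xs) ts)"

definition pos_haar :: "(complex \<Rightarrow> 'a::ring_1) \<Rightarrow> (complex \<Rightarrow> 'z::ring_1) \<Rightarrow> ('z \<Rightarrow> 'z)
    \<Rightarrow> ('z \<Rightarrow> ('a \<times> 'z) list) \<Rightarrow> ('z \<Rightarrow> complex) \<Rightarrow> bool" where
  "pos_haar \<iota> \<iota>Z stZ \<alpha> \<mu> \<longleftrightarrow> clin \<iota>Z \<mu> \<and> \<mu> 1 = 1 \<and>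
    (\<forall>x. sum_list (map (\<lambda>(a, z). \<iota> (\<mu> z) * a) (\<alpha> x)) = \<iota> (\<mu> x)) \<and>
    (\<forall>z. Im (\<mu> (stZ z * z)) = 0 \<and> Re (\<mu> (stZ z * z)) \<ge> 0)"

end

theory Submission
  imports Defs "Jordan_Normal_Form.Char_Poly" "HOL-Library.Function_Algebras"
begin

text \<open>The proof is a Peter-Weyl theorem for A followed by an orthonormal frame argument for
  the multiplicity spaces of Z. Write a^L for a unitary matrix corepresentation in the irreducible
  class L.

  For A: an invariant scalar product makes every matrix corepresentation conjugate to a unitary one
  (\<open>unitarise\<close>). For a unitary one the orthogonal complement of a subcomodule is again
  a subcomodule, so induction on the dimension reduces everything to irreducibles
  (\<open>matrix_coefficients_in_span\<close>). Each element of A lies in a finite-dimensional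
  subcomodule, hence the entries of the a^L span A (\<open>coefs_span\<close>). Schur's lemma
  (\<open>schur_scalar\<close>, \<open>schur_iso\<close>) together with the counit makes them
  independent (\<open>rows_independent\<close>). The dual functionals are called
  \<open>coord L i j\<close>.

  For Z: let X L be the space of tuples x with coaction x_i -> sum_k a^L_ik (x) x_k. Slicing the
  coaction of any z by the functionals \<open>coord L i j\<close> gives such tuples
  (\<open>slices_in_X\<close>). The counit is the sum of the diagonal ones, so the entries of these
  tuples span Z; slicing by the partial sums \<open>chi L\<close> gives projections, so the
  decomposition is direct.

  Injectivity of the Galois map forces coinvariant elements to be scalars
  (\<open>coinvariant_scalar\<close>). As a^L is unitary, sum_i x_i^* y_i is coinvariant for x, y in
  X L, and so defines a complex-valued hermitian form (\<open>ip_scalar\<close>). Surjectivity gives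
  tuples x^{k,r} in X L and elements y^{k,r} with sum_r x^{k,r}_j y^{k,r} = delta_jk
  (\<open>partition_of_unity\<close>). Injectivity turns this into a reproducing formula
  (\<open>X_reproducing\<close>): X L is finite-dimensional and, by the Cauchy-Schwarz argument for
  the Haar measure, the form is positive definite. An orthonormal basis of X L, written as the
  columns of a matrix z, satisfies the first unitarity relation. The matrix z z^H fixes every
  element of X L, and the partition of unity turns this into the second relation, which also shows
  that X L is nonzero.

  Tensors are lists modulo \<open>teq\<close>, so identities are proved by slicing with functionals
  and comparing values.\<close>

section \<open>Linear algebra\<close>

text \<open>Bases are indexed by pairs or triples in the theorem, so a repeated vector must count as
  a relation. Killing all finite indexed relations gives injectivity and independence of the image
  together.\<close>

lemma (in vector_space) independent_familyI:
  assumes rel: "\<And>F c. finite F \<Longrightarrow> F \<subseteq> I \<Longrightarrow> (\<Sum>i\<in>F. scale (c i) (v i)) = 0 \<Longrightarrow> \<forall>i\<in>F. c i = 0"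
  shows "inj_on v I" and "independent (v ` I)"
proof -
  show inj: "inj_on v I"
  proof (rule inj_onI, rule ccontr)
    fix i j assume ij: "i \<in> I" "j \<in> I" "v i = v j" "i \<noteq> j"
    define c :: "_ \<Rightarrow> 'a" where "c = (\<lambda>k. if k = i then 1 else - 1)"
    have "(\<Sum>k\<in>{i, j}. scale (c k) (v k)) = 0"
      using ij by (simp add: c_def)
    from rel[OF _ _ this] ij have "c i = 0" by simp
    then show False by (simp add: c_def)
  qed
  show "independent (v ` I)"
    unfolding dependent_explicit
  proof clarify
    fix t u b assume t: "finite t" "t \<subseteq> v ` I" "(\<Sum>x\<in>t. scale (u x) x) = 0" and b: "b \<in> t" "u b \<noteq> 0"
    define F where "F = I \<inter> v -` t"
    have vF: "v ` F = t" using t(2) by (auto simp: F_def)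
    have injF: "inj_on v F" using inj by (rule inj_on_subset) (simp add: F_def)
    have "finite F" using t(1) vF injF finite_imageD by blast
    moreover have "(\<Sum>i\<in>F. scale (u (v i)) (v i)) = 0"
      using t(3) sum.reindex[OF injF, of "\<lambda>x. scale (u x) x"] vF by simp
    ultimately have "\<forall>i\<in>F. u (v i) = 0" by (intro rel) (auto simp: F_def)
    then show False using b vF by auto
  qed
qed

text \<open>An orthonormal family is independent, so its length is at most \<open>card B\<close> and
  a longest one exists. If some x in W differed from its expansion, the normalised difference would
  lengthen the family. The scalar multiplication is abstract because the lemma serves both subspaces
  of C^n and spaces of tuples in Z.\<close>

lemma orthonormal_basis_exists:
  fixes scale :: "complex \<Rightarrow> 'v::ab_group_add \<Rightarrow> 'v" and h :: "'v \<Rightarrow> 'v \<Rightarrow> complex"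
  assumes vs: "vector_space scale"
    and W0: "0 \<in> W" and Wadd: "\<And>x y. x \<in> W \<Longrightarrow> y \<in> W \<Longrightarrow> x + y \<in> W"
    and Wscale: "\<And>c x. x \<in> W \<Longrightarrow> scale c x \<in> W"
    and fin: "finite B" "W \<subseteq> module.span scale B"
    and hadd: "\<And>x y z. x \<in> W \<Longrightarrow> y \<in> W \<Longrightarrow> z \<in> W \<Longrightarrow> h x (y + z) = h x y + h x z"
    and hscale: "\<And>c x y. x \<in> W \<Longrightarrow> y \<in> W \<Longrightarrow> h x (scale c y) = c * h x y"
    and herm: "\<And>x y. x \<in> W \<Longrightarrow> y \<in> W \<Longrightarrow> h y x = cnj (h x y)"
    and pos: "\<And>x. x \<in> W \<Longrightarrow> x \<noteq> 0 \<Longrightarrow> 0 < Re (h x x)"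
  obtains m :: nat and e where "\<And>k. k < m \<Longrightarrow> e k \<in> W"
    and "\<And>k l. k < m \<Longrightarrow> l < m \<Longrightarrow> h (e k) (e l) = (if k = l then 1 else 0)"
    and "\<And>x. x \<in> W \<Longrightarrow> (\<Sum>k<m. scale (h (e k) x) (e k)) = x"
proof -
  interpret vector_space scale by (rule vs)
  have h0: "h x 0 = 0" if "x \<in> W" for x
    using hscale[OF that W0, of 0] by simp
  have Wsum: "(\<Sum>k\<in>F. scale (c k) (y k)) \<in> W" if "finite F" "\<And>k. k \<in> F \<Longrightarrow> y k \<in> W" for F c and y :: "nat \<Rightarrow> 'v"
    using that by (induction rule: finite_induct) (auto intro: W0 Wadd Wscale)
  have hsum: "h x (\<Sum>k\<in>F. scale (c k) (y k)) = (\<Sum>k\<in>F. c k * h x (y k))"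
    if "finite F" "x \<in> W" "\<And>k. k \<in> F \<Longrightarrow> y k \<in> W" for x F c and y :: "nat \<Rightarrow> 'v"
    using that by (induction rule: finite_induct) (auto simp: h0 hadd hscale Wscale Wsum)
  define P where "P m e \<longleftrightarrow> (\<forall>k<m. e k \<in> W) \<and>
     (\<forall>k<m. \<forall>l<m. h (e k) (e l) = (if k = l then 1 else 0))" for m and e :: "nat \<Rightarrow> 'v"
  have bound: "m \<le> card B" if "P m e" for m e
  proof -
    have rel: "\<forall>i\<in>F. c i = 0" if "finite F" "F \<subseteq> {..<m}" "(\<Sum>i\<in>F. scale (c i) (e i)) = 0" for F c
    proof
      fix i assume i: "i \<in> F"
      have "0 = h (e i) (\<Sum>k\<in>F. scale (c k) (e k))"
        using that i \<open>P m e\<close> h0 by (auto simp: P_def)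
      also have "\<dots> = (\<Sum>k\<in>F. c k * h (e i) (e k))"
        using that i \<open>P m e\<close> by (intro hsum) (auto simp: P_def)
      also have "\<dots> = (\<Sum>k\<in>F. if k = i then c k else 0)"
        using that i \<open>P m e\<close> by (intro sum.cong) (auto simp: P_def subset_iff)
      also have "\<dots> = c i" using that i by simp
      finally show "c i = 0" by simp
    qed
    have "e ` {..<m} \<subseteq> span B" using that fin(2) by (auto simp: P_def)
    then have "card (e ` {..<m}) \<le> card B"
      using independent_span_bound[OF fin(1) independent_familyI(2)[of "{..<m}" e, OF rel]] by blast
    moreover have "inj_on e {..<m}" by (rule independent_familyI(1)) (use rel in auto)
    ultimately show ?thesis by (simp add: card_image)
  qed
  define m where "m = (GREATEST m. \<exists>e. P m e)"
  have "\<exists>e. P 0 e" by (simp add: P_def)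
  then have "\<exists>e. P m e" unfolding m_def by (rule GreatestI_nat[where b = "card B"]) (use bound in blast)
  then obtain e where e: "P m e" by blast
  have max: "\<not> P (Suc m) e'" for e'
  proof
    assume "P (Suc m) e'"
    then have "\<exists>e. P (Suc m) e" by blast
    then have "Suc m \<le> (GREATEST m. \<exists>e. P m e)"
      by (rule Greatest_le_nat[where b = "card B"]) (use bound in blast)
    then show False by (simp add: m_def)
  qed
  have eW: "e k \<in> W" if "k < m" for k using e that by (auto simp: P_def)
  have ee: "h (e k) (e l) = (if k = l then 1 else 0)" if "k < m" "l < m" for k l using e that by (auto simp: P_def)
  have "(\<Sum>k<m. scale (h (e k) x) (e k)) = x" if x: "x \<in> W" for x
  proof (rule ccontr)
    assume neq: "(\<Sum>k<m. scale (h (e k) x) (e k)) \<noteq> x"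
    define s where "s = (\<Sum>k<m. scale (h (e k) x) (e k))"
    \<comment> \<open>The residue of x, orthogonal to all \<open>e k\<close>. It is written with the
      scalar -1 since W is only given as closed under addition and scaling.\<close>
    define y where "y = x + scale (-1) s"
    have sW: "s \<in> W" unfolding s_def by (rule Wsum) (use eW in auto)
    have yW: "y \<in> W" unfolding y_def by (intro Wadd Wscale sW x)
    have y0: "y \<noteq> 0" using neq by (auto simp: y_def s_def)
    have hs: "h (e k) s = h (e k) x" if "k < m" for k
    proof -
      have "h (e k) s = (\<Sum>l<m. h (e l) x * h (e k) (e l))"
        unfolding s_def by (rule hsum) (use eW that in auto)
      also have "\<dots> = (\<Sum>l<m. if l = k then h (e l) x else 0)"
        by (rule sum.cong) (use ee that in auto)
      finally show ?thesis using that by simp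
    qed
    have hy: "h (e k) y = 0" if "k < m" for k
      using that hs x sW eW by (simp add: y_def hadd hscale Wscale del: scale_minus_left)
    have hyy: "h y y = of_real (Re (h y y))"
      using arg_cong[OF herm[OF yW yW], of Im] by (simp add: complex_eq_iff)
    define r where "r = complex_of_real (1 / sqrt (Re (h y y)))"
    have rr: "r * r * h y y = 1"
      using pos[OF yW y0] unfolding r_def
      by (subst hyy, simp flip: of_real_mult add: field_simps)
    have cr: "cnj r = r" by (simp add: r_def)
    define e' where "e' = e(m := scale r y)"
    have 1: "h (e k) (scale r y) = 0" if "k < m" for k
      using that hy yW eW by (simp add: hscale)
    have 2: "h (scale r y) (e k) = 0" if "k < m" for k
      using 1[OF that] herm[of "e k" "scale r y"] eW that yW Wscale by simp
    \<comment> \<open>Conjugate-linearity in the first argument is obtained from linearity in the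
      second and \<open>herm\<close>.\<close>
    have "h (scale r y) (scale r y) = r * cnj (r * h y y)"
      using yW Wscale hscale herm by metis
    also have "\<dots> = r * r * cnj (h y y)" by (simp add: cr)
    also have "\<dots> = 1" using rr by (simp flip: herm[OF yW yW])
    finally have 3: "h (scale r y) (scale r y) = 1" .
    have "P (Suc m) e'"
      unfolding P_def e'_def using eW ee 1 2 3 yW Wscale by (auto simp: less_Suc_eq)
    then show False using max by blast
  qed
  then show ?thesis using that eW ee by blast
qed

subsection \<open>Matrices\<close>

text \<open>Matrices are functions of two indices, kept zero outside their format so that two matrices
  agree iff they are equal as functions.\<close>

definition mmul :: "nat \<Rightarrow> (nat \<Rightarrow> nat \<Rightarrow> 'a) \<Rightarrow> (nat \<Rightarrow> nat \<Rightarrow> 'a) \<Rightarrow> nat \<Rightarrow> nat \<Rightarrow> 'a::semiring_0" where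
  "mmul k X Y = (\<lambda>i j. \<Sum>l<k. X i l * Y l j)"

definition mone :: "nat \<Rightarrow> nat \<Rightarrow> nat \<Rightarrow> 'a::semiring_1" where
  "mone n = (\<lambda>i j. if i = j \<and> i < n then 1 else 0)"

definition msupp :: "nat \<Rightarrow> nat \<Rightarrow> (nat \<Rightarrow> nat \<Rightarrow> 'a::zero) \<Rightarrow> bool" where
  "msupp n m X \<longleftrightarrow> (\<forall>i j. \<not> (i < n \<and> j < m) \<longrightarrow> X i j = 0)"

definition mtrunc :: "nat \<Rightarrow> nat \<Rightarrow> (nat \<Rightarrow> nat \<Rightarrow> 'a::zero) \<Rightarrow> nat \<Rightarrow> nat \<Rightarrow> 'a" where
  "mtrunc n m X = (\<lambda>i j. if i < n \<and> j < m then X i j else 0)"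

definition madj :: "('a \<Rightarrow> 'a) \<Rightarrow> (nat \<Rightarrow> nat \<Rightarrow> 'a) \<Rightarrow> nat \<Rightarrow> nat \<Rightarrow> 'a" where
  "madj st X = (\<lambda>i j. st (X j i))"

definition mmap :: "('a \<Rightarrow> 'b) \<Rightarrow> (nat \<Rightarrow> nat \<Rightarrow> 'a) \<Rightarrow> nat \<Rightarrow> nat \<Rightarrow> 'b" where
  "mmap f X = (\<lambda>i j. f (X i j))"

definition mtr :: "nat \<Rightarrow> (nat \<Rightarrow> nat \<Rightarrow> 'a::comm_monoid_add) \<Rightarrow> 'a" where
  "mtr n X = (\<Sum>i<n. X i i)"

lemma mmul_assoc: "mmul k (mmul l X Y) Z = mmul l X (mmul k Y Z)"
proof (intro ext)
  fix i j
  have "mmul k (mmul l X Y) Z i j = (\<Sum>p<k. \<Sum>q<l. X i q * (Y q p * Z p j))"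
    by (simp add: mmul_def sum_distrib_right mult.assoc)
  also have "\<dots> = (\<Sum>q<l. \<Sum>p<k. X i q * (Y q p * Z p j))" by (rule sum.swap)
  also have "\<dots> = mmul l X (mmul k Y Z) i j" by (simp add: mmul_def sum_distrib_left)
  finally show "mmul k (mmul l X Y) Z i j = mmul l X (mmul k Y Z) i j" .
qed

lemma mmul_mone_left [simp]:
  assumes "msupp n m X" shows "mmul n (mone n) X = X"
proof (intro ext)
  fix i j
  have "mmul n (mone n) X i j = (\<Sum>l<n. if i = l then X l j else 0)"
    unfolding mmul_def mone_def by (intro sum.cong) auto
  then show "mmul n (mone n) X i j = X i j" using assms by (auto simp: msupp_def)
qed

lemma mmul_mone_right [simp]:
  assumes "msupp n m X" shows "mmul m X (mone m) = X"
proof (intro ext)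
  fix i j
  have "mmul m X (mone m) i j = (\<Sum>l<m. if l = j then X i l else 0)"
    unfolding mmul_def mone_def by (intro sum.cong) auto
  then show "mmul m X (mone m) i j = X i j" using assms by (auto simp: msupp_def)
qed

lemma msupp_mone [simp, intro]: "msupp n n (mone n)"
  by (auto simp: msupp_def mone_def)

lemma msupp_mmul [intro]: "msupp n k X \<Longrightarrow> msupp k m Y \<Longrightarrow> msupp n m (mmul k X Y)"
  by (auto simp: msupp_def mmul_def intro!: sum.neutral)

lemma msupp_mtrunc [simp, intro]: "msupp n m (mtrunc n m X)"
  by (auto simp: msupp_def mtrunc_def)

lemma msupp_madj [intro]: "msupp n m X \<Longrightarrow> st 0 = 0 \<Longrightarrow> msupp m n (madj st X)"
  by (auto simp: msupp_def madj_def)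

lemma msupp_mmap [intro]: "msupp n m X \<Longrightarrow> f 0 = 0 \<Longrightarrow> msupp n m (mmap f X)"
  by (auto simp: msupp_def mmap_def)

lemma msupp_eqI:
  assumes "msupp n m X" "msupp n m Y" "\<And>i j. i < n \<Longrightarrow> j < m \<Longrightarrow> X i j = Y i j"
  shows "X = Y"
proof (intro ext)
  fix i j show "X i j = Y i j" using assms by (cases "i < n \<and> j < m") (auto simp: msupp_def)
qed

lemma madj_cnj_cnj [simp]: "madj cnj (madj cnj X) = X"
  by (simp add: madj_def)

lemma madj_cnj_mmul: "madj cnj (mmul k X Y) = mmul k (madj cnj Y) (madj cnj X)"
  by (simp add: madj_def mmul_def mult.commute)

lemma mtr_mmul_commute: "mtr n (mmul m X Y) = mtr m (mmul n Y (X :: nat \<Rightarrow> nat \<Rightarrow> 'a::comm_semiring_0))"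
  unfolding mtr_def mmul_def by (subst sum.swap) (simp add: mult.commute)

lemma mtr_mone [simp]: "mtr n (mone n) = of_nat n"
  by (simp add: mtr_def mone_def)

text \<open>XY and YX have the same trace, which is n on one side and m on the other.\<close>

lemma inverse_matrices_dim_eq:
  fixes X Y :: "nat \<Rightarrow> nat \<Rightarrow> complex"
  assumes "mmul m X Y = mone n" "mmul n Y X = mone m"
  shows "n = m"
  using mtr_mmul_commute[of n m X Y] assms by simp

text \<open>Detects a nonzero T by a nonzero trace of T^H T; this is how \<open>schur_iso\<close>
  knows that its scalar does not vanish.\<close>

lemma mtr_madj_mmul: "mtr n (mmul m (madj cnj T) T) = of_real (\<Sum>j<n. \<Sum>i<m. (cmod (T i j))\<^sup>2)"
  unfolding mtr_def mmul_def madj_def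
  by (simp add: mult.commute[of "cnj _"] flip: complex_norm_square)

text \<open>The characteristic polynomial has degree n > 0, so the fundamental theorem of algebra
  gives it a root.\<close>

lemma eigenvector_exists:
  fixes T :: "nat \<Rightarrow> nat \<Rightarrow> complex"
  assumes "n > 0"
  obtains c v where "v \<in> vecs n" "v \<noteq> (\<lambda>_. 0)" "\<And>i. i < n \<Longrightarrow> (\<Sum>j<n. T i j * v j) = c * v i"
proof -
  define A where "A = mat n n (\<lambda>(i, j). T i j)"
  have A: "A \<in> carrier_mat n n" by (simp add: A_def)
  have "degree (char_poly A) = n" using degree_monic_char_poly[OF A] by simp
  then have "\<not> constant (poly (char_poly A))" using assms by (simp add: constant_degree)
  then obtain c where "poly (char_poly A) c = 0" using fundamental_theorem_of_algebra by blast
  then have "eigenvalue A c" using eigenvalue_root_char_poly[OF A] by simp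
  then obtain w where w: "w \<in> carrier_vec n" "w \<noteq> 0\<^sub>v n" "A *\<^sub>v w = c \<cdot>\<^sub>v w"
    using A by (auto simp: eigenvalue_def eigenvector_def)
  define v where "v = (\<lambda>i. if i < n then w $ i else 0)"
  have "v \<in> vecs n" by (simp add: v_def vecs_def)
  moreover have "v \<noteq> (\<lambda>_. 0)"
    using w(1,2) by (auto simp: v_def fun_eq_iff vec_eq_iff split: if_splits)
  moreover have "(\<Sum>j<n. T i j * v j) = c * v i" if "i < n" for i
  proof -
    have "(\<Sum>j<n. T i j * v j) = (A *\<^sub>v w) $ i"
      using that w(1) by (simp add: A_def v_def scalar_prod_def lessThan_atLeast0)
    also have "\<dots> = c * v i" using that w(1) by (simp add: w(3) v_def)
    finally show ?thesis .
  qed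
  ultimately show ?thesis using that by blast
qed

section \<open>Subspaces of C^n and orthonormal bases for a hermitian form\<close>

lemma sum_fun_apply: "(\<Sum>k\<in>A. f k) i = (\<Sum>k\<in>A. f k i)"
  by (induction A rule: infinite_finite_induct) simp_all

interpretation fun_vs: vector_space "\<lambda>c (v :: nat \<Rightarrow> complex) i. c * v i"
  by unfold_locales (auto simp: fun_eq_iff algebra_simps)

lemma vecs_spanned:
  "finite ((\<lambda>k i. if i = k then 1 else 0) ` {..<n})"
  "vecs n \<subseteq> fun_vs.span ((\<lambda>k i. if i = k then 1 else 0) ` {..<n})"
proof -
  show "vecs n \<subseteq> fun_vs.span ((\<lambda>k i. if i = k then 1 else 0) ` {..<n})"
  proof
    fix v assume v: "v \<in> vecs n"
    have "v = (\<Sum>k<n. (\<lambda>i. v k * (if i = k then 1 else 0)))"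
    proof
      fix i
      have "(\<Sum>k<n. (\<lambda>i. v k * (if i = k then 1 else 0))) i = (\<Sum>k<n. if k = i then v k else 0)"
        unfolding sum_fun_apply by (rule sum.cong) auto
      then show "v i = (\<Sum>k<n. (\<lambda>i. v k * (if i = k then 1 else 0))) i"
        using v by (auto simp: vecs_def not_less)
    qed
    also have "\<dots> \<in> fun_vs.span ((\<lambda>k i. if i = k then 1 else 0) ` {..<n})"
      by (intro fun_vs.span_sum fun_vs.span_scale fun_vs.span_base) auto
    finally show "v \<in> fun_vs.span ((\<lambda>k i. if i = k then 1 else 0) ` {..<n})" .
  qed
qed auto

definition lin_sub :: "nat \<Rightarrow> (nat \<Rightarrow> complex) set \<Rightarrow> bool" where
  "lin_sub n W \<longleftrightarrow> W \<subseteq> vecs n \<and> (\<lambda>_. 0) \<in> W \<and> (\<forall>v\<in>W. \<forall>w\<in>W. (\<lambda>i. v i + w i) \<in> W) \<and>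
     (\<forall>c. \<forall>v\<in>W. (\<lambda>i. c * v i) \<in> W)"

lemma lin_sub_vecs: "lin_sub n (vecs n)"
  by (auto simp: lin_sub_def vecs_def)

text \<open>This is \<open>orthonormal_basis_exists\<close> for the form v^H G w, with the basis
  vectors collected as the columns of E. The two formulas then read E^H G E = 1 and v = E E^H G v
  for v in W.\<close>

lemma vecs_orthonormal_basis:
  fixes W :: "(nat \<Rightarrow> complex) set" and G :: "nat \<Rightarrow> nat \<Rightarrow> complex"
  assumes "lin_sub n W" "\<forall>i<n. \<forall>j<n. G i j = cnj (G j i)"
    "\<forall>v\<in>W. v \<noteq> (\<lambda>_. 0) \<longrightarrow> 0 < Re (\<Sum>i<n. \<Sum>j<n. cnj (v i) * G i j * v j)"
  shows "\<exists>m E. msupp n m E \<and> (\<forall>k<m. (\<lambda>i. E i k) \<in> W) \<and> mmul n (madj cnj E) (mmul n G E) = mone m \<and>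
    (\<forall>v\<in>W. v = (\<lambda>i. \<Sum>k<m. (\<Sum>p<n. \<Sum>q<n. cnj (E p k) * G p q * v q) * E i k))"
proof -
  have W: "W \<subseteq> vecs n" "(\<lambda>_. 0) \<in> W" "\<And>v w. v \<in> W \<Longrightarrow> w \<in> W \<Longrightarrow> (\<lambda>i. v i + w i) \<in> W"
      "\<And>c v. v \<in> W \<Longrightarrow> (\<lambda>i. c * v i) \<in> W"
    using assms(1) by (auto simp: lin_sub_def)
  have G: "G i j = cnj (G j i)" if "i < n" "j < n" for i j using assms(2) that by blast
  define h where "h v w = (\<Sum>i<n. \<Sum>j<n. cnj (v i) * G i j * w j)" for v w
  have z: "(0 :: nat \<Rightarrow> complex) = (\<lambda>_. 0)" by (simp add: fun_eq_iff)
  have p: "v + w = (\<lambda>i. v i + w i)" for v w :: "nat \<Rightarrow> complex" by (simp add: fun_eq_iff)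
  have herm: "h w v = cnj (h v w)" for v w
  proof -
    have "cnj (h v w) = (\<Sum>i<n. \<Sum>j<n. cnj (w j) * G j i * v i)"
      unfolding h_def cnj_sum
    proof (intro sum.cong refl)
      fix i j assume "i \<in> {..<n}" "j \<in> {..<n}"
      then have "G j i = cnj (G i j)" by (intro G) auto
      then show "cnj (cnj (v i) * G i j * w j) = cnj (w j) * G j i * v i" by (simp add: mult_ac)
    qed
    also have "\<dots> = h w v" unfolding h_def by (rule sum.swap)
    finally show ?thesis ..
  qed
  obtain m :: nat and e where e: "\<And>k. k < m \<Longrightarrow> e k \<in> W"
    "\<And>k l. k < m \<Longrightarrow> l < m \<Longrightarrow> h (e k) (e l) = (if k = l then 1 else 0)"
    "\<And>x. x \<in> W \<Longrightarrow> (\<Sum>k<m. (\<lambda>i. h (e k) x * e k i)) = x"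
  proof (rule orthonormal_basis_exists[of "\<lambda>c v i. c * v i" W _ h])
    show "vector_space (\<lambda>c v (i::nat). c * v i :: complex)" by (rule fun_vs.vector_space_axioms)
    show "W \<subseteq> fun_vs.span ((\<lambda>k i. if i = k then 1 else 0) ` {..<n})" using W(1) vecs_spanned by blast
    show "h x (y + z) = h x y + h x z" for x y z
      by (simp add: h_def algebra_simps sum.distrib)
    show "h x (\<lambda>i. c * y i) = c * h x y" for x y c
      by (simp add: h_def sum_distrib_left mult_ac)
    show "0 < Re (h x x)" if "x \<in> W" "x \<noteq> 0" for x using assms(3) that by (simp add: h_def z)
    show "h y x = cnj (h x y)" for x y by (rule herm)
  qed (use W in \<open>auto simp: z p\<close>)
  define E where "E = (\<lambda>i k. if k < m then e k i else 0)"
  have supp: "msupp n m E" using e(1) W(1) by (force simp: msupp_def E_def vecs_def)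
  show ?thesis
  proof (intro exI conjI allI ballI impI)
    show "msupp n m E" by fact
    show "(\<lambda>i. E i k) \<in> W" if "k < m" for k using e(1)[OF that] that by (simp add: E_def)
    show "mmul n (madj cnj E) (mmul n G E) = mone m"
    proof (intro ext)
      fix k l
      show "mmul n (madj cnj E) (mmul n G E) k l = mone m k l"
        by (cases "k < m"; cases "l < m") (use e(2)[of k l] in
          \<open>simp_all add: mmul_def madj_def mone_def E_def h_def sum_distrib_left mult.assoc\<close>)
    qed
    show "v = (\<lambda>i. \<Sum>k<m. (\<Sum>p<n. \<Sum>q<n. cnj (E p k) * G p q * v q) * E i k)" if "v \<in> W" for v
    proof
      fix i
      show "v i = (\<Sum>k<m. (\<Sum>p<n. \<Sum>q<n. cnj (E p k) * G p q * v q) * E i k)"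
        using fun_cong[OF e(3)[OF that], of i] by (simp add: E_def h_def sum_fun_apply cong: sum.cong_simp)
    qed
  qed
qed

section \<open>Algebras and linear functionals\<close>

locale calgebra =
  fixes \<iota> :: "complex \<Rightarrow> 'a::ring_1"
  assumes calg: "calg \<iota>"
begin

lemma iota_add: "\<iota> (c + d) = \<iota> c + \<iota> d"
  and iota_mult: "\<iota> (c * d) = \<iota> c * \<iota> d"
  and iota_1 [simp]: "\<iota> 1 = 1"
  and iota_comm: "\<iota> c * x = x * \<iota> c"
  using calg unfolding calg_def by blast+

lemma iota_0 [simp]: "\<iota> 0 = 0"
  using iota_add[of 0 0] by simp

lemma iota_sum: "\<iota> (sum f F) = (\<Sum>i\<in>F. \<iota> (f i))"
  by (induction F rule: infinite_finite_induct) (auto simp: iota_add)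

lemma iota_left_comm: "x * (\<iota> c * y) = \<iota> c * (x * y)"
  by (metis iota_comm mult.assoc)

sublocale vs: vector_space "sc \<iota>"
  by unfold_locales (auto simp: sc_def iota_add iota_mult algebra_simps)

lemma iota_eq_0_iff [simp]: "\<iota> c = 0 \<longleftrightarrow> c = 0"
  using vs.scale_eq_0_iff[of c 1] by (simp add: sc_def)

lemma clin_add: "clin \<iota> \<phi> \<Longrightarrow> \<phi> (x + y) = \<phi> x + \<phi> y"
  and clin_scale: "clin \<iota> \<phi> \<Longrightarrow> \<phi> (\<iota> c * x) = c * \<phi> x"
  by (auto simp: clin_def)

lemma clin_scale_right: "clin \<iota> \<phi> \<Longrightarrow> \<phi> (x * \<iota> c) = \<phi> x * c"
  by (metis clin_scale iota_comm mult.commute)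

lemma clin_0 [simp]: "clin \<iota> \<phi> \<Longrightarrow> \<phi> 0 = 0"
  using clin_scale[of \<phi> 0 0] by simp

lemma clin_sum: "clin \<iota> \<phi> \<Longrightarrow> \<phi> (sum f F) = (\<Sum>i\<in>F. \<phi> (f i))"
  by (induction F rule: infinite_finite_induct) (auto simp: clin_add)

lemma clin_sum_list: "clin \<iota> \<phi> \<Longrightarrow> \<phi> (sum_list (map f xs)) = sum_list (map (\<lambda>x. \<phi> (f x)) xs)"
  by (induction xs) (auto simp: clin_add)

lemma clin_mult_left: "clin \<iota> \<phi> \<Longrightarrow> clin \<iota> (\<lambda>x. \<phi> (y * x))"
  by (auto simp: clin_def distrib_left iota_left_comm)

lemma clin_mult_right: "clin \<iota> \<phi> \<Longrightarrow> clin \<iota> (\<lambda>x. \<phi> (x * y))"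
  by (auto simp: clin_def distrib_right mult.assoc)

lemma clin_sum_fun: "(\<And>i. i \<in> F \<Longrightarrow> clin \<iota> (f i)) \<Longrightarrow> clin \<iota> (\<lambda>x. \<Sum>i\<in>F. c i * f i x)"
  by (auto simp: clin_def sum.distrib distrib_left sum_distrib_left mult_ac intro!: sum.cong)

lemma clin_eq_on_span:
  assumes "clin \<iota> \<phi>" "clin \<iota> \<psi>" "\<And>x. x \<in> B \<Longrightarrow> \<phi> x = \<psi> x" "x \<in> vs.span B"
  shows "\<phi> x = \<psi> x"
  using assms(4)
  by (induction rule: vs.span_induct_alt) (auto simp: assms(1,2,3) sc_def clin_add[OF assms(1)] clin_add[OF assms(2)]
      clin_scale[OF assms(1)] clin_scale[OF assms(2)])

text \<open>Extend B to a basis of the whole algebra and take coordinates. On the span of B these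
  agree with the coordinates relative to B.\<close>

lemma dual_functionals:
  assumes B: "vs.independent B"
  shows "\<exists>f. (\<forall>b. clin \<iota> (f b)) \<and> (\<forall>b\<in>B. \<forall>c\<in>B. f b c = (if b = c then 1 else 0)) \<and>
    (\<forall>x\<in>vs.span B. finite {b. f b x \<noteq> 0} \<and> (\<Sum>b | f b x \<noteq> 0. \<iota> (f b x) * b) = x)"
proof -
  define E where "E = vs.extend_basis B"
  have E: "B \<subseteq> E" "vs.independent E" "vs.span E = UNIV"
    using vs.extend_basis_superset[OF B] vs.independent_extend_basis[OF B] vs.span_extend_basis[OF B]
    by (auto simp: E_def)
  define f where "f b x = vs.representation E x b" for b x
  have 1: "clin \<iota> (f b)" for b
    unfolding clin_def f_def
    using vs.representation_add[OF E(2)] vs.representation_scale[OF E(2)] E(3) by (simp add: sc_def)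
  have 2: "f b c = (if b = c then 1 else 0)" if "b \<in> B" "c \<in> B" for b c
    using that E(1) vs.representation_basis[OF E(2), of c] by (auto simp: f_def)
  have 3: "finite {b. f b x \<noteq> 0} \<and> (\<Sum>b | f b x \<noteq> 0. \<iota> (f b x) * b) = x"
    if x: "x \<in> vs.span B" for x
  proof -
    have "vs.representation E x = vs.representation B x"
      using vs.representation_extend[OF E(2) x E(1)] .
    then show ?thesis
      using vs.finite_representation[of B x] vs.sum_nonzero_representation_eq[OF B x]
      by (auto simp: f_def sc_def)
  qed
  show ?thesis
    by (rule exI[of _ f]) (intro conjI ballI allI 1 2 3)
qed

text \<open>The standard way to prove an equation here: coproduct and coaction are known only
  through the values of functionals, and this lemma lifts equality of values to equality of
  elements.\<close>

lemma functionals_separate: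
  assumes "\<And>\<phi>. clin \<iota> \<phi> \<Longrightarrow> \<phi> x = \<phi> y"
  shows "x = y"
proof (rule ccontr)
  assume "x \<noteq> y"
  then have "vs.independent {x - y}" by simp
  from dual_functionals[OF this] obtain f where f: "\<forall>b. clin \<iota> (f b)"
    "\<forall>b\<in>{x - y}. \<forall>c\<in>{x - y}. f b c = (if b = c then 1 else 0)" by (elim exE conjE)
  define \<phi> where "\<phi> = f (x - y)"
  have c: "clin \<iota> \<phi>" and 1: "\<phi> (x - y) = 1" using f by (auto simp: \<phi>_def)
  have "\<phi> x = \<phi> ((x - y) + y)" by simp
  also have "\<dots> = 1 + \<phi> y" by (simp only: clin_add[OF c] 1)
  finally show False using assms[OF c] by simp
qed

text \<open>\<open>teq\<close> tests only products of two functionals. Expanding the first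
  components in a basis writes an arbitrary bilinear form, on the two given lists, as a finite sum
  of such products.\<close>

lemma bilinear_form_teq:
  fixes \<beta> :: "'a \<Rightarrow> 'b::ring_1 \<Rightarrow> complex"
  assumes eq: "teq \<iota> \<iota>' xs ys"
    and l: "\<And>b. clin \<iota> (\<lambda>a. \<beta> a b)" and r: "\<And>a. clin \<iota>' (\<beta> a)"
  shows "sum_list (map (\<lambda>(a, b). \<beta> a b) xs) = sum_list (map (\<lambda>(a, b). \<beta> a b) ys)"
proof -
  define B where "B = vs.extend_basis {}"
  have B: "vs.independent B" "vs.span B = UNIV"
    unfolding B_def
    by (rule vs.independent_extend_basis[OF vs.independent_empty] vs.span_extend_basis[OF vs.independent_empty])+
  obtain f where f: "\<forall>b. clin \<iota> (f b)" and
    "\<forall>x\<in>vs.span B. finite {b. f b x \<noteq> 0} \<and> (\<Sum>b | f b x \<noteq> 0. \<iota> (f b x) * b) = x"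
    using dual_functionals[OF B(1)] by (elim exE conjE)
  then have fin: "finite {b. f b x \<noteq> 0}" and expand: "(\<Sum>b | f b x \<noteq> 0. \<iota> (f b x) * b) = x" for x
    unfolding B(2) by blast+
  \<comment> \<open>The finitely many basis vectors that occur in first components of either
    list.\<close>
  define F where "F = (\<Union>x\<in>set xs \<union> set ys. {b. f b (fst x) \<noteq> 0})"
  have F: "finite F" using fin by (auto simp: F_def)
  have \<beta>: "\<beta> a b = (\<Sum>e\<in>F. f e a * \<beta> e b)" if "(a, b) \<in> set xs \<union> set ys" for a b
  proof -
    have sub: "{e. f e a \<noteq> 0} \<subseteq> F" using that by (force simp: F_def)
    have "\<beta> a b = \<beta> (\<Sum>e | f e a \<noteq> 0. \<iota> (f e a) * e) b" by (simp only: expand)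
    also have "\<dots> = (\<Sum>e | f e a \<noteq> 0. f e a * \<beta> e b)"
      by (simp add: clin_sum[OF l] clin_scale[OF l])
    also have "\<dots> = (\<Sum>e\<in>F. f e a * \<beta> e b)"
      using F sub by (intro sum.mono_neutral_left) auto
    finally show ?thesis .
  qed
  have tev: "sum_list (map (\<lambda>(a, b). \<beta> a b) zs) = (\<Sum>e\<in>F. tev (f e) (\<beta> e) zs)"
    if "set zs \<subseteq> set xs \<union> set ys" for zs
    using that by (induction zs) (auto simp: tev_def sum.distrib \<beta>)
  show ?thesis using eq f r by (simp add: tev teq_def)
qed

definition imat :: "(nat \<Rightarrow> nat \<Rightarrow> complex) \<Rightarrow> nat \<Rightarrow> nat \<Rightarrow> 'a" where
  "imat T = (\<lambda>i j. \<iota> (T i j))"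

lemma imat_mmul: "imat (mmul k X Y) = mmul k (imat X) (imat Y)"
  by (simp add: imat_def mmul_def iota_sum iota_mult)

lemma imat_mone [simp]: "imat (mone n) = mone n"
  by (auto simp: imat_def mone_def fun_eq_iff)

lemma msupp_imat [intro]: "msupp n m T \<Longrightarrow> msupp n m (imat T)"
  by (auto simp: imat_def msupp_def)

lemma mmap_mmul_imat_right: "clin \<iota> \<phi> \<Longrightarrow> mmap \<phi> (mmul k X (imat T)) = mmul k (mmap \<phi> X) T"
  by (simp add: mmap_def mmul_def imat_def clin_sum clin_scale_right)

lemma mmap_mmul_imat_left: "clin \<iota> \<phi> \<Longrightarrow> mmap \<phi> (mmul k (imat T) X) = mmul k T (mmap \<phi> X)"
  by (simp add: mmap_def mmul_def imat_def clin_sum clin_scale)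

lemma matrix_eqI: "(\<And>\<phi>. clin \<iota> \<phi> \<Longrightarrow> mmap \<phi> X = mmap \<phi> Y) \<Longrightarrow> X = Y"
  by (intro ext functionals_separate) (auto simp: mmap_def fun_eq_iff)

lemma msupp_mmap_clin [intro]: "msupp n m X \<Longrightarrow> clin \<iota> \<phi> \<Longrightarrow> msupp n m (mmap \<phi> X)"
  by (rule msupp_mmap) auto

end

locale star_algebra =
  fixes \<iota> :: "complex \<Rightarrow> 'a::ring_1" and st :: "'a \<Rightarrow> 'a"
  assumes star: "star_alg \<iota> st"
begin

sublocale calgebra \<iota>
  using star by unfold_locales (simp add: star_alg_def)

lemma st_st [simp]: "st (st x) = x"
  and st_add: "st (x + y) = st x + st y"
  and st_mult: "st (x * y) = st y * st x"
  and st_scale: "st (\<iota> c * x) = \<iota> (cnj c) * st x"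
  using star by (auto simp: star_alg_def)

lemma st_1 [simp]: "st 1 = 1"
  by (metis mult.right_neutral st_mult st_st mult.left_neutral)

lemma st_iota [simp]: "st (\<iota> c) = \<iota> (cnj c)"
  using st_scale[of c 1] by simp

lemma st_0 [simp]: "st 0 = 0"
  using st_iota[of 0] by simp

lemma st_sum: "st (sum f F) = (\<Sum>i\<in>F. st (f i))"
  by (induction F rule: infinite_finite_induct) (auto simp: st_add)

lemma madj_mmul: "madj st (mmul k X Y) = mmul k (madj st Y) (madj st X)"
  by (simp add: madj_def mmul_def st_sum st_mult)

lemma madj_imat: "madj st (imat T) = imat (madj cnj T)"
  by (simp add: madj_def imat_def)

text \<open>Composition with the star makes a functional conjugate-linear; conjugating its values
  restores linearity, so such functionals may again be used to test tensors.\<close>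

lemma clin_star: "clin \<iota> \<phi> \<Longrightarrow> clin \<iota> (\<lambda>x. cnj (\<phi> (st x)))"
  by (auto simp: clin_def st_add st_scale)

end

section \<open>Corepresentations\<close>

locale hopf_star =
  fixes \<iota> :: "complex \<Rightarrow> 'a::ring_1" and st :: "'a \<Rightarrow> 'a"
    and \<Delta> :: "'a \<Rightarrow> ('a \<times> 'a) list" and \<epsilon> :: "'a \<Rightarrow> complex"
  assumes hopf: "hopf_star_alg \<iota> st \<Delta> \<epsilon>"
begin

sublocale star_algebra \<iota> st
  using hopf by unfold_locales (simp add: hopf_star_alg_def)

text \<open>The product of the dual algebra of A. Its values on linear functionals do not depend on
  the list representing the coproduct.\<close>

definition conv :: "('a \<Rightarrow> complex) \<Rightarrow> ('a \<Rightarrow> complex) \<Rightarrow> 'a \<Rightarrow> complex" where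
  "conv \<phi> \<psi> x = tev \<phi> \<psi> (\<Delta> x)"

lemma tev_append: "tev \<phi> \<psi> (xs @ ys) = tev \<phi> \<psi> xs + tev \<phi> \<psi> ys"
  by (simp add: tev_def)

lemma clin_eps: "clin \<iota> \<epsilon>"
  using hopf by (simp add: hopf_star_alg_def)

lemma clin_conv:
  assumes "clin \<iota> \<phi>" "clin \<iota> \<psi>"
  shows "clin \<iota> (conv \<phi> \<psi>)"
proof -
  have "conv \<phi> \<psi> (x + y) = conv \<phi> \<psi> x + conv \<phi> \<psi> y" for x y
    using hopf assms by (simp add: hopf_star_alg_def teq_def conv_def tev_append)
  moreover have "conv \<phi> \<psi> (\<iota> c * x) = c * conv \<phi> \<psi> x" for c x
  proof -
    have "tev \<phi> \<psi> (map (\<lambda>(a, b). (\<iota> c * a, b)) xs) = c * tev \<phi> \<psi> xs" for xs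
      by (induction xs) (auto simp: tev_def clin_scale[OF assms(1)] algebra_simps)
    moreover have "teq \<iota> \<iota> (\<Delta> (\<iota> c * x)) (map (\<lambda>(a, b). (\<iota> c * a, b)) (\<Delta> x))"
      using hopf unfolding hopf_star_alg_def by blast
    ultimately show ?thesis using assms by (simp add: teq_def conv_def)
  qed
  ultimately show ?thesis by (simp add: clin_def)
qed

lemma conv_assoc:
  assumes "clin \<iota> \<phi>" "clin \<iota> \<psi>" "clin \<iota> \<chi>"
  shows "conv (conv \<phi> \<psi>) \<chi> x = conv \<phi> (conv \<psi> \<chi>) x"
  using hopf assms by (simp add: hopf_star_alg_def conv_def tev_def split_def)

text \<open>The slices (phi (x) id) and (id (x) phi) of the coproduct, as elements of A;
  \<open>clin_lslice\<close> and \<open>clin_rslice\<close> express them by convolution.\<close>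

definition lslice :: "('a \<Rightarrow> complex) \<Rightarrow> 'a \<Rightarrow> 'a" where
  "lslice \<phi> x = sum_list (map (\<lambda>(a, b). \<iota> (\<phi> a) * b) (\<Delta> x))"

definition rslice :: "('a \<Rightarrow> complex) \<Rightarrow> 'a \<Rightarrow> 'a" where
  "rslice \<phi> x = sum_list (map (\<lambda>(a, b). \<iota> (\<phi> b) * a) (\<Delta> x))"

lemma clin_lslice: "clin \<iota> \<psi> \<Longrightarrow> \<psi> (lslice \<phi> x) = conv \<phi> \<psi> x"
  by (simp add: lslice_def conv_def tev_def clin_sum_list clin_scale split_def)

lemma clin_rslice: "clin \<iota> \<psi> \<Longrightarrow> \<psi> (rslice \<phi> x) = conv \<psi> \<phi> x"
  by (simp add: rslice_def conv_def tev_def clin_sum_list clin_scale split_def mult.commute)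

lemma lslice_eps [simp]: "lslice \<epsilon> x = x"
  using hopf by (simp add: hopf_star_alg_def lslice_def)

lemma rslice_eps [simp]: "rslice \<epsilon> x = x"
proof -
  have "rslice \<epsilon> x = sum_list (map (\<lambda>(a, b). a * \<iota> (\<epsilon> b)) (\<Delta> x))"
    unfolding rslice_def by (intro arg_cong[of _ _ sum_list] map_cong) (auto intro: iota_comm)
  then show ?thesis using hopf by (simp add: hopf_star_alg_def)
qed

lemma conv_eps_left [simp]: "clin \<iota> \<psi> \<Longrightarrow> conv \<epsilon> \<psi> x = \<psi> x"
  using clin_lslice[of \<psi> \<epsilon> x] by simp

lemma conv_eps_right [simp]: "clin \<iota> \<psi> \<Longrightarrow> conv \<psi> \<epsilon> x = \<psi> x"
  using clin_rslice[of \<psi> \<epsilon> x] by simp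

text \<open>A corepresentation seen from the dual algebra: phi -> \<open>mmap \<phi> u\<close> is
  multiplicative for \<open>conv\<close> and sends the counit to the identity matrix. Entries
  outside the format are zero, so that equations between matrices are equations between
  functions.\<close>

definition crep :: "nat \<Rightarrow> (nat \<Rightarrow> nat \<Rightarrow> 'a) \<Rightarrow> bool" where
  "crep n u \<longleftrightarrow> msupp n n u \<and> mmap \<epsilon> u = mone n \<and>
     (\<forall>\<phi> \<psi>. clin \<iota> \<phi> \<longrightarrow> clin \<iota> \<psi> \<longrightarrow> mmap (conv \<phi> \<psi>) u = mmul n (mmap \<phi> u) (mmap \<psi> u))"

lemma crepD:
  assumes "crep n u"
  shows "msupp n n u" "mmap \<epsilon> u = mone n"
    "clin \<iota> \<phi> \<Longrightarrow> clin \<iota> \<psi> \<Longrightarrow> mmap (conv \<phi> \<psi>) u = mmul n (mmap \<phi> u) (mmap \<psi> u)"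
  using assms by (auto simp: crep_def)

lemma tev_map_upt: "tev \<phi> \<psi> (map (\<lambda>k. (f k, g k)) [0..<n]) = (\<Sum>k<n. \<phi> (f k) * \<psi> (g k))"
  by (simp add: tev_def o_def interv_sum_list_conv_sum_set_nat lessThan_atLeast0)

lemma corep_iff_crep: "corep \<iota> \<Delta> \<epsilon> n u \<longleftrightarrow> crep n (mtrunc n n u)"
proof
  assume u: "corep \<iota> \<Delta> \<epsilon> n u"
  show "crep n (mtrunc n n u)"
    unfolding crep_def
  proof (intro conjI allI impI)
    show "mmap \<epsilon> (mtrunc n n u) = mone n"
      using u clin_0[OF clin_eps] by (auto simp: fun_eq_iff mmap_def mtrunc_def mone_def corep_def)
    fix \<phi> \<psi> assume c: "clin \<iota> \<phi>" "clin \<iota> \<psi>"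
    show "mmap (conv \<phi> \<psi>) (mtrunc n n u) = mmul n (mmap \<phi> (mtrunc n n u)) (mmap \<psi> (mtrunc n n u))"
    proof (rule msupp_eqI[of n n])
      fix i j assume ij: "i < n" "j < n"
      then have "conv \<phi> \<psi> (u i j) = (\<Sum>k<n. \<phi> (u i k) * \<psi> (u k j))"
        using u c unfolding corep_def teq_def conv_def by (metis tev_map_upt)
      then show "mmap (conv \<phi> \<psi>) (mtrunc n n u) i j =
          mmul n (mmap \<phi> (mtrunc n n u)) (mmap \<psi> (mtrunc n n u)) i j"
        using ij by (simp add: mmap_def mmul_def mtrunc_def)
    qed (use c clin_conv in auto)
  qed auto
next
  assume u: "crep n (mtrunc n n u)"
  show "corep \<iota> \<Delta> \<epsilon> n u"
    unfolding corep_def teq_def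
  proof (intro allI impI conjI)
    fix i j assume ij: "i < n" "j < n"
    show "\<epsilon> (u i j) = (if i = j then 1 else 0)"
      using fun_cong[OF fun_cong[OF crepD(2)[OF u], of i], of j] ij by (simp add: mmap_def mtrunc_def mone_def)
    fix \<phi> \<psi> assume c: "clin \<iota> \<phi>" "clin \<iota> \<psi>"
    show "tev \<phi> \<psi> (\<Delta> (u i j)) = tev \<phi> \<psi> (map (\<lambda>k. (u i k, u k j)) [0..<n])"
      using fun_cong[OF fun_cong[OF crepD(3)[OF u c], of i], of j] ij
      by (simp add: tev_map_upt mmap_def mtrunc_def mmul_def conv_def)
  qed
qed

lemma mtrunc_ident: "msupp n m X \<Longrightarrow> mtrunc n m X = X"
  by (auto simp: msupp_def mtrunc_def fun_eq_iff)

text \<open>The comodule on the range of \<open>E\<close>, when that range is invariant and \<open>F\<close> is a left inverse of \<open>E\<close>.\<close>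

lemma crep_compress:
  assumes u: "crep n u" and E: "msupp n m E" and F: "msupp m n F" and FE: "mmul n F E = mone m"
    and inv: "mmul n u (imat E) = mmul m (imat E) w"
    and w: "w = mmul n (imat F) (mmul n u (imat E))"
  shows "crep m w"
proof -
  have \<phi>w: "mmap \<phi> w = mmul n F (mmul n (mmap \<phi> u) E)" if "clin \<iota> \<phi>" for \<phi>
    using that by (simp add: w mmap_mmul_imat_left mmap_mmul_imat_right)
  have \<phi>E: "mmul n (mmap \<phi> u) E = mmul m E (mmap \<phi> w)" if "clin \<iota> \<phi>" for \<phi>
    using arg_cong[OF inv, of "mmap \<phi>"] that by (simp add: mmap_mmul_imat_left mmap_mmul_imat_right)
  show ?thesis
    unfolding crep_def
  proof (intro conjI allI impI)
    show "msupp m m w" unfolding w using E F crepD(1)[OF u] by auto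
    show "mmap \<epsilon> w = mone m"
      using E by (simp add: \<phi>w clin_eps crepD(2)[OF u] FE)
    fix \<phi> \<psi> assume c: "clin \<iota> \<phi>" "clin \<iota> \<psi>"
    have "mmap (conv \<phi> \<psi>) w = mmul n F (mmul n (mmap \<phi> u) (mmul n (mmap \<psi> u) E))"
      using c by (simp add: \<phi>w clin_conv crepD(3)[OF u] mmul_assoc)
    also have "\<dots> = mmul n F (mmul n (mmap \<phi> u) (mmul m E (mmap \<psi> w)))" using c by (simp add: \<phi>E)
    also have "\<dots> = mmul m (mmap \<phi> w) (mmap \<psi> w)" using c by (simp add: \<phi>w mmul_assoc)
    finally show "mmap (conv \<phi> \<psi>) w = mmul m (mmap \<phi> w) (mmap \<psi> w)" .
  qed
qed

text \<open>The inverse is the antipode applied entrywise. The antipode axioms are sums over the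
  list \<open>\<Delta> (u i j)\<close>; \<open>bilinear_form_teq\<close> allows replacing it by the
  list of pairs (u i k, u k j), as phi(S a * b) is bilinear in a and b but not a product of
  functionals.\<close>

lemma antipode_matrix:
  assumes u: "crep n u"
  obtains s where "msupp n n s" "mmul n s u = mone n" "mmul n u s = mone n"
proof -
  obtain S where "\<forall>x y. S (x + y) = S x + S y" "\<forall>c x. S (\<iota> c * x) = \<iota> c * S x"
    "\<forall>x. sum_list (map (\<lambda>(a, b). S a * b) (\<Delta> x)) = \<iota> (\<epsilon> x)"
    "\<forall>x. sum_list (map (\<lambda>(a, b). a * S b) (\<Delta> x)) = \<iota> (\<epsilon> x)"
    using hopf unfolding hopf_star_alg_def by (elim conjE exE)
  then have S: "\<And>x y. S (x + y) = S x + S y" "\<And>c x. S (\<iota> c * x) = \<iota> c * S x"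
    "\<And>x. sum_list (map (\<lambda>(a, b). S a * b) (\<Delta> x)) = \<iota> (\<epsilon> x)"
    "\<And>x. sum_list (map (\<lambda>(a, b). a * S b) (\<Delta> x)) = \<iota> (\<epsilon> x)" by blast+
  have S0: "S 0 = 0" using S(2)[of 0 0] by simp
  have us: "msupp n n u" by (rule crepD(1)[OF u])
  have eps: "\<iota> (\<epsilon> (u i j)) = mone n i j" for i j
    using fun_cong[OF fun_cong[OF crepD(2)[OF u], of i], of j] by (simp add: mmap_def mone_def)
  have teq: "teq \<iota> \<iota> (\<Delta> (u i j)) (map (\<lambda>k. (u i k, u k j)) [0..<n])" for i j
    unfolding teq_def tev_map_upt conv_def[symmetric]
    using crepD(3)[OF u] by (auto simp: mmap_def mmul_def fun_eq_iff)
  have l: "(\<Sum>k<n. S (u i k) * u k j) = mone n i j" for i j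
  proof (rule functionals_separate)
    fix \<phi> assume c: "clin \<iota> \<phi>"
    have "\<phi> (mone n i j) = sum_list (map (\<lambda>(a, b). \<phi> (S a * b)) (\<Delta> (u i j)))"
      using S(3)[of "u i j"] clin_sum_list[OF c, of "\<lambda>(a, b). S a * b" "\<Delta> (u i j)"] by (simp add: eps split_def)
    also have "\<dots> = sum_list (map (\<lambda>(a, b). \<phi> (S a * b)) (map (\<lambda>k. (u i k, u k j)) [0..<n]))"
      using c by (intro bilinear_form_teq[OF teq])
        (auto simp: clin_def S distrib_left distrib_right mult.assoc iota_left_comm)
    also have "\<dots> = \<phi> (\<Sum>k<n. S (u i k) * u k j)"
      by (simp add: o_def clin_sum[OF c] interv_sum_list_conv_sum_set_nat lessThan_atLeast0)
    finally show "\<phi> (\<Sum>k<n. S (u i k) * u k j) = \<phi> (mone n i j)" ..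
  qed
  have r: "(\<Sum>k<n. u i k * S (u k j)) = mone n i j" for i j
  proof (rule functionals_separate)
    fix \<phi> assume c: "clin \<iota> \<phi>"
    have "\<phi> (mone n i j) = sum_list (map (\<lambda>(a, b). \<phi> (a * S b)) (\<Delta> (u i j)))"
      using S(4)[of "u i j"] clin_sum_list[OF c, of "\<lambda>(a, b). a * S b" "\<Delta> (u i j)"] by (simp add: eps split_def)
    also have "\<dots> = sum_list (map (\<lambda>(a, b). \<phi> (a * S b)) (map (\<lambda>k. (u i k, u k j)) [0..<n]))"
      using c by (intro bilinear_form_teq[OF teq])
        (auto simp: clin_def S distrib_left distrib_right mult.assoc iota_left_comm)
    also have "\<dots> = \<phi> (\<Sum>k<n. u i k * S (u k j))"
      by (simp add: o_def clin_sum[OF c] interv_sum_list_conv_sum_set_nat lessThan_atLeast0)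
    finally show "\<phi> (\<Sum>k<n. u i k * S (u k j)) = \<phi> (mone n i j)" ..
  qed
  have "msupp n n (mmap S u)" using us S0 by auto
  moreover have "mmul n (mmap S u) u = mone n" "mmul n u (mmap S u) = mone n"
    using l r by (auto simp: mmul_def mmap_def fun_eq_iff)
  ultimately show ?thesis using that by blast
qed

definition ucrep :: "nat \<Rightarrow> (nat \<Rightarrow> nat \<Rightarrow> 'a) \<Rightarrow> bool" where
  "ucrep n u \<longleftrightarrow> crep n u \<and> mmul n (madj st u) u = mone n \<and> mmul n u (madj st u) = mone n"

lemma ucrepD:
  assumes "ucrep n u"
  shows "crep n u" "mmul n (madj st u) u = mone n" "mmul n u (madj st u) = mone n"
    "msupp n n u" "msupp n n (madj st u)"
  using assms crepD(1) by (auto simp: ucrep_def)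

text \<open>Over the noncommutative algebra A a left inverse of a matrix need not be a right
  inverse. The antipode supplies a right inverse of u, and it must coincide with the left inverse
  \<open>madj st u\<close>.\<close>

lemma ucrepI:
  assumes u: "crep n u" and l: "mmul n (madj st u) u = mone n"
  shows "ucrep n u"
proof -
  obtain s where s: "msupp n n s" "mmul n u s = mone n" using antipode_matrix[OF u] by blast
  have "msupp n n (madj st u)" using crepD(1)[OF u] by auto
  then have "madj st u = mmul n (madj st u) (mmul n u s)" by (simp add: s)
  also have "\<dots> = s" using mmul_assoc[of n n "madj st u" u s] l s(1) by simp
  finally show ?thesis using u l s by (simp add: ucrep_def)
qed

end

section \<open>Matrices acting on column vectors\<close>

definition mv :: "nat \<Rightarrow> (nat \<Rightarrow> nat \<Rightarrow> complex) \<Rightarrow> (nat \<Rightarrow> complex) \<Rightarrow> nat \<Rightarrow> complex" where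
  "mv n X v = (\<lambda>i. \<Sum>j<n. X i j * v j)"

lemma mv_mmul: "mv k (mmul l X Y) v = mv l X (mv k Y v)"
proof
  fix i
  have "mv k (mmul l X Y) v i = (\<Sum>p<k. \<Sum>q<l. X i q * (Y q p * v p))"
    by (simp add: mv_def mmul_def sum_distrib_right mult.assoc)
  also have "\<dots> = (\<Sum>q<l. \<Sum>p<k. X i q * (Y q p * v p))" by (rule sum.swap)
  also have "\<dots> = mv l X (mv k Y v) i" by (simp add: mv_def sum_distrib_left)
  finally show "mv k (mmul l X Y) v i = mv l X (mv k Y v) i" .
qed

lemma mv_mone: "v \<in> vecs n \<Longrightarrow> mv n (mone n) v = v"
proof
  fix i assume v: "v \<in> vecs n"
  have "mv n (mone n) v i = (\<Sum>j<n. if i = j then v j else 0)"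
    unfolding mv_def mone_def by (intro sum.cong) auto
  then show "mv n (mone n) v i = v i" using v by (auto simp: vecs_def)
qed

lemma mv_vecs: "msupp n m X \<Longrightarrow> mv k X v \<in> vecs n"
  by (auto simp: mv_def vecs_def msupp_def)

lemma mv_zero [simp]: "mv k X (\<lambda>_. 0) = (\<lambda>_. 0)"
  by (simp add: mv_def)

lemma mv_add: "mv k X (\<lambda>i. v i + w i) = (\<lambda>i. mv k X v i + mv k X w i)"
  by (simp add: mv_def distrib_left sum.distrib)

lemma mv_scale: "mv k X (\<lambda>i. c * v i) = (\<lambda>i. c * mv k X v i)"
  by (simp add: mv_def sum_distrib_left mult_ac)

lemma mv_column: "k < n \<Longrightarrow> mv n X (\<lambda>i. mone n i k) = (\<lambda>i. X i k)"
proof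
  fix i assume k: "k < n"
  have "mv n X (\<lambda>i. mone n i k) i = (\<Sum>j<n. if j = k then X i j else 0)"
    unfolding mv_def mone_def by (intro sum.cong) auto
  then show "mv n X (\<lambda>i. mone n i k) i = X i k" using k by simp
qed

lemma mv_mmul_column: "mv k X (\<lambda>i. Y i j) = (\<lambda>i. mmul k X Y i j)"
  by (simp add: mv_def mmul_def)

text \<open>An orthonormal basis of all of C^n for the form G gives E^H G E = 1. Expanding the
  standard basis vectors gives E (E^H G) = 1, and comparing traces shows that E is square.\<close>

lemma invertible_congruence:
  fixes G :: "nat \<Rightarrow> nat \<Rightarrow> complex"
  assumes G: "\<forall>i<n. \<forall>j<n. G i j = cnj (G j i)"
    and pos: "\<forall>v\<in>vecs n. v \<noteq> (\<lambda>_. 0) \<longrightarrow> 0 < Re (\<Sum>i<n. \<Sum>j<n. cnj (v i) * G i j * v j)"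
    and supp: "msupp n n G"
  obtains E where "msupp n n E" "mmul n (madj cnj E) (mmul n G E) = mone n"
    "mmul n E (mmul n (madj cnj E) G) = mone n"
proof -
  obtain m E where E: "msupp n m E" "mmul n (madj cnj E) (mmul n G E) = mone m"
    and exp: "\<forall>v\<in>vecs n. v = (\<lambda>i. \<Sum>k<m. (\<Sum>p<n. \<Sum>q<n. cnj (E p k) * G p q * v q) * E i k)"
    using vecs_orthonormal_basis[OF lin_sub_vecs G pos] by (elim exE conjE)
  have 1: "mmul m E (mmul n (madj cnj E) G) = mone n"
  proof (rule msupp_eqI[of n n])
    show "msupp n n (mmul m E (mmul n (madj cnj E) G))" using E(1) supp by auto
    fix i j assume ij: "i < n" "j < n"
    have c: "(\<lambda>i. mone n i j) \<in> vecs n" by (auto simp: vecs_def mone_def)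
    have "mone n i j = (\<Sum>k<m. (\<Sum>p<n. \<Sum>q<n. cnj (E p k) * G p q * mone n q j) * E i k)"
      using fun_cong[OF bspec[OF exp c], of i] .
    also have "\<dots> = (\<Sum>k<m. (\<Sum>p<n. cnj (E p k) * G p j) * E i k)"
    proof (intro sum.cong refl arg_cong2[where f = "(*)"])
      fix k p
      have "(\<Sum>q<n. cnj (E p k) * G p q * mone n q j) = (\<Sum>q<n. if q = j then cnj (E p k) * G p q else 0)"
        by (intro sum.cong) (auto simp: mone_def)
      then show "(\<Sum>q<n. cnj (E p k) * G p q * mone n q j) = cnj (E p k) * G p j" using ij by simp
    qed
    also have "\<dots> = mmul m E (mmul n (madj cnj E) G) i j"
      by (simp add: mmul_def madj_def mult.commute)
    finally show "mmul m E (mmul n (madj cnj E) G) i j = mone n i j" ..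
  qed auto
  have "n = m" using 1 E(2) 
    by (intro inverse_matrices_dim_eq[of m E "mmul n (madj cnj E) G"]) (simp_all add: mmul_assoc)
  then show ?thesis using that E 1 by blast
qed

section \<open>Irreducibility and Schur's lemma\<close>

context hopf_star
begin

lemma corep_irred_mtrunc: "corep_irred \<iota> n (mtrunc n n u) \<longleftrightarrow> corep_irred \<iota> n u"
proof -
  have "(\<lambda>i. if i < n then (\<Sum>j<n. v j * \<phi> (mtrunc n n u i j)) else 0) =
     (\<lambda>i. if i < n then (\<Sum>j<n. v j * \<phi> (u i j)) else 0)"
    for v :: "nat \<Rightarrow> complex" and \<phi>
    by (auto simp: mtrunc_def fun_eq_iff)
  then show ?thesis unfolding corep_irred_def by (simp only:)
qed

lemma corep_irred_iff:
  assumes u: "msupp n n u"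
  shows "corep_irred \<iota> n u \<longleftrightarrow> n > 0 \<and>
    (\<forall>W. lin_sub n W \<longrightarrow> (\<forall>v\<in>W. \<forall>\<phi>. clin \<iota> \<phi> \<longrightarrow> mv n (mmap \<phi> u) v \<in> W) \<longrightarrow>
      W = {\<lambda>_. 0} \<or> W = vecs n)"
proof -
  have "(\<lambda>i. if i < n then (\<Sum>j<n. v j * \<phi> (u i j)) else 0) = mv n (mmap \<phi> u) v" if "clin \<iota> \<phi>" for v \<phi>
    using u that by (auto simp: mv_def mmap_def fun_eq_iff msupp_def mult.commute)
  then show ?thesis unfolding corep_irred_def lin_sub_def by auto
qed

lemma irred_lin_sub:
  assumes "crep n u" "corep_irred \<iota> n u" "lin_sub n W"
    and "\<And>v \<phi>. v \<in> W \<Longrightarrow> clin \<iota> \<phi> \<Longrightarrow> mv n (mmap \<phi> u) v \<in> W"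
  shows "W = {\<lambda>_. 0} \<or> W = vecs n"
  using assms(2) corep_irred_iff[OF crepD(1)[OF assms(1)]] assms(3,4) by auto

text \<open>The preimage under T of a subspace invariant for w is invariant for u, hence trivial;
  invertibility of T carries this back.\<close>

lemma irred_conjugate:
  assumes u: "crep n u" "corep_irred \<iota> n u" and w: "crep n w"
    and T: "msupp n n T" "msupp n n S" "mmul n T S = mone n" "mmul n S T = mone n"
    and wT: "mmul n (imat T) u = mmul n w (imat T)"
  shows "corep_irred \<iota> n w"
  unfolding corep_irred_iff[OF crepD(1)[OF w]]
proof (intro conjI allI impI)
  show "n > 0" using u(2) by (simp add: corep_irred_def)
  fix W assume W: "lin_sub n W" and inv: "\<forall>v\<in>W. \<forall>\<phi>. clin \<iota> \<phi> \<longrightarrow> mv n (mmap \<phi> w) v \<in> W"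
  define W' where "W' = {v \<in> vecs n. mv n T v \<in> W}"
  have TS: "mv n T (mv n S v) = v" if "v \<in> vecs n" for v
    using that by (simp add: T(3) mv_mone flip: mv_mmul)
  have sub: "lin_sub n W'"
    using W by (auto simp: lin_sub_def W'_def vecs_def mv_add mv_scale)
  have "W' = {\<lambda>_. 0} \<or> W' = vecs n"
  proof (rule irred_lin_sub[OF u sub])
    fix v \<phi> assume v: "v \<in> W'" and c: "clin \<iota> \<phi>"
    have "mmul n T (mmap \<phi> u) = mmul n (mmap \<phi> w) T"
      using arg_cong[OF wT, of "mmap \<phi>"] c by (simp add: mmap_mmul_imat_left mmap_mmul_imat_right)
    then have "mv n T (mv n (mmap \<phi> u) v) = mv n (mmap \<phi> w) (mv n T v)" by (metis mv_mmul)
    then show "mv n (mmap \<phi> u) v \<in> W'"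
      using v inv c mv_vecs[OF msupp_mmap_clin[OF crepD(1)[OF u(1)] c]] by (auto simp: W'_def)
  qed
  then show "W = {\<lambda>_. 0} \<or> W = vecs n"
  proof
    assume W'0: "W' = {\<lambda>_. 0}"
    have "v = (\<lambda>_. 0)" if "v \<in> W" for v
    proof -
      have v: "v \<in> vecs n" using W that by (auto simp: lin_sub_def)
      have "mv n S v \<in> W'" using TS[OF v] that mv_vecs[OF T(2)] by (simp add: W'_def)
      then have "mv n S v = (\<lambda>_. 0)" using W'0 by simp
      then show ?thesis using TS[OF v] by simp
    qed
    moreover have "(\<lambda>_. 0) \<in> W" using W by (auto simp: lin_sub_def)
    ultimately show ?thesis by blast
  next
    assume W'1: "W' = vecs n"
    have "v \<in> W" if v: "v \<in> vecs n" for v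
    proof -
      have "mv n S v \<in> W'" using W'1 mv_vecs[OF T(2)] by simp
      then show ?thesis using TS[OF v] by (simp add: W'_def)
    qed
    then show ?thesis using W by (auto simp: lin_sub_def)
  qed
qed

text \<open>The adjoint of T u = w T is u^H T^H = T^H w^H. Multiplying by u on the left and by w on
  the right, unitarity leaves T^H w = u T^H. Both Schur's lemma and the invariance of orthogonal
  complements rest on this.\<close>

lemma adjoint_intertwines:
  assumes u: "ucrep n u" and w: "ucrep m w" and T: "msupp m n T"
    and int: "mmul n (imat T) u = mmul m w (imat T)"
  shows "mmul m (imat (madj cnj T)) w = mmul n u (imat (madj cnj T))"
proof -
  define T' where "T' = imat (madj cnj T)"
  have supp: "msupp n m T'" using T by (auto simp: T'_def)
  have "mmul n (madj st u) T' = mmul m T' (madj st w)"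
    using arg_cong[OF int, of "madj st"] by (simp add: madj_mmul madj_imat T'_def)
  then have *: "mmul m (mmul n (madj st u) T') w = mmul m (mmul m T' (madj st w)) w" by simp
  have "mmul m T' w = mmul n (mone n) (mmul m T' w)"
    using supp ucrepD(4)[OF w] by (subst mmul_mone_left) auto
  also have "\<dots> = mmul n u (mmul m (mmul n (madj st u) T') w)"
    by (simp add: mmul_assoc flip: ucrepD(3)[OF u])
  also have "\<dots> = mmul n u (mmul m T' (mone m))" unfolding * by (simp add: mmul_assoc ucrepD(2)[OF w])
  also have "\<dots> = mmul n u T'" using supp by simp
  finally show ?thesis unfolding T'_def .
qed

text \<open>An eigenspace of T is a nonzero invariant subspace, so it is everything.\<close>

lemma schur_scalar:
  assumes u: "crep n u" "corep_irred \<iota> n u" and T: "msupp n n T"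
    and int: "mmul n (imat T) u = mmul n u (imat T)"
  obtains c where "T = (\<lambda>i j. c * mone n i j)"
proof -
  have "n > 0" using u(2) by (simp add: corep_irred_def)
  then obtain c v where v: "v \<in> vecs n" "v \<noteq> (\<lambda>_. 0)" "\<And>i. i < n \<Longrightarrow> (\<Sum>j<n. T i j * v j) = c * v i"
    by (rule eigenvector_exists[of n T]) (rule that)
  define W where "W = {v \<in> vecs n. mv n T v = (\<lambda>i. c * v i)}"
  have "mv n T v = (\<lambda>i. c * v i)"
  proof
    fix i show "mv n T v i = c * v i"
      using v(1,3) T by (cases "i < n") (auto simp: mv_def vecs_def msupp_def)
  qed
  then have vW: "v \<in> W" using v(1) by (simp add: W_def)
  have sub: "lin_sub n W"
    by (auto simp: lin_sub_def W_def vecs_def mv_add mv_scale distrib_left mult.left_commute)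
  have "W = {\<lambda>_. 0} \<or> W = vecs n"
  proof (rule irred_lin_sub[OF u sub])
    fix v \<phi> assume v: "v \<in> W" and c: "clin \<iota> \<phi>"
    have "mmul n T (mmap \<phi> u) = mmul n (mmap \<phi> u) T"
      using arg_cong[OF int, of "mmap \<phi>"] c by (simp add: mmap_mmul_imat_left mmap_mmul_imat_right)
    then have "mv n T (mv n (mmap \<phi> u) v) = mv n (mmap \<phi> u) (mv n T v)" by (metis mv_mmul)
    also have "\<dots> = (\<lambda>i. c * mv n (mmap \<phi> u) v i)" using v by (simp add: W_def mv_scale)
    finally show "mv n (mmap \<phi> u) v \<in> W"
      using mv_vecs[OF msupp_mmap_clin[OF crepD(1)[OF u(1)] c]] by (auto simp: W_def)
  qed
  then have W: "W = vecs n" using vW v(2) by auto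
  have "T = (\<lambda>i j. c * mone n i j)"
  proof (rule msupp_eqI[OF T])
    show "msupp n n (\<lambda>i j. c * mone n i j)" by (auto simp: msupp_def mone_def)
    fix i j assume "i < n" "j < n"
    have "(\<lambda>i. mone n i j) \<in> W" unfolding W by (auto simp: vecs_def mone_def)
    then have "mv n T (\<lambda>i. mone n i j) i = c * mone n i j" by (simp add: W_def)
    then show "T i j = c * mone n i j" using \<open>j < n\<close> by (simp add: mv_column)
  qed
  then show ?thesis by (rule that)
qed

lemma mmul_scalar_left: "msupp n m X \<Longrightarrow> mmul n (\<lambda>i j. c * mone n i j) X = (\<lambda>i j. c * X i j)"
  for X :: "nat \<Rightarrow> nat \<Rightarrow> complex"
  using arg_cong[OF mmul_mone_left[of n m X], of "\<lambda>Y i j. c * Y i j"]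
  by (simp add: mmul_def sum_distrib_left mult.assoc)

lemma mmul_scalar_right: "msupp n m X \<Longrightarrow> mmul m X (\<lambda>i j. c * mone m i j) = (\<lambda>i j. c * X i j)"
  for X :: "nat \<Rightarrow> nat \<Rightarrow> complex"
  using arg_cong[OF mmul_mone_right[of n m X], of "\<lambda>Y i j. c * Y i j"]
  by (simp add: mmul_def sum_distrib_left mult_ac)

text \<open>T^H T and T T^H are self-intertwiners, hence scalars c and d. The trace of T^H T is a
  sum of squares and nonzero, so c is nonzero; c = d, and then equality of the two traces forces n =
  m. The inverse is T^H / c.\<close>

lemma schur_iso:
  assumes u: "ucrep n u" "corep_irred \<iota> n u" and w: "ucrep m w" "corep_irred \<iota> m w"
    and T: "msupp m n T" "T \<noteq> (\<lambda>i j. 0)"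
    and int: "mmul n (imat T) u = mmul m w (imat T)"
  obtains S where "n = m" "msupp n n S" "mmul n S T = mone n" "mmul n T S = mone n"
proof -
  define T' where "T' = madj cnj T"
  have T': "msupp n m T'" using T(1) by (auto simp: T'_def)
  have int': "mmul m (imat T') w = mmul n u (imat T')"
    unfolding T'_def by (rule adjoint_intertwines[OF u(1) w(1) T(1) int])
  have "mmul n (imat (mmul m T' T)) u = mmul n u (imat (mmul m T' T))"
    by (simp add: imat_mmul mmul_assoc int) (simp add: int' flip: mmul_assoc)
  then obtain c where c: "mmul m T' T = (\<lambda>i j. c * mone n i j)"
    using schur_scalar[OF ucrepD(1)[OF u(1)] u(2), of "mmul m T' T"] T(1) T' by blast
  have "mmul m (imat (mmul n T T')) w = mmul m w (imat (mmul n T T'))"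
    by (simp add: imat_mmul mmul_assoc int') (simp add: int flip: mmul_assoc)
  then obtain d where d: "mmul n T T' = (\<lambda>i j. d * mone m i j)"
    using schur_scalar[OF ucrepD(1)[OF w(1)] w(2), of "mmul n T T'"] T(1) T' by blast
  obtain i0 j0 where ij: "T i0 j0 \<noteq> 0" using T(2) by (auto simp: fun_eq_iff)
  have ij': "i0 < m" "j0 < n" using ij T(1) by (auto simp: msupp_def)
  have "(\<Sum>j<n. \<Sum>i<m. (cmod (T i j))\<^sup>2) \<ge> (\<Sum>i<m. (cmod (T i j0))\<^sup>2)"
    using ij' member_le_sum[of j0 "{..<n}" "\<lambda>j. \<Sum>i<m. (cmod (T i j))\<^sup>2"] by (simp add: sum_nonneg)
  moreover have "(\<Sum>i<m. (cmod (T i j0))\<^sup>2) \<ge> (cmod (T i0 j0))\<^sup>2"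
    using ij' member_le_sum[of i0 "{..<m}" "\<lambda>i. (cmod (T i j0))\<^sup>2"] by auto
  moreover have "(cmod (T i0 j0))\<^sup>2 > 0" using ij by simp
  ultimately have "(\<Sum>j<n. \<Sum>i<m. (cmod (T i j))\<^sup>2) \<noteq> 0" by linarith
  then have "mtr n (mmul m T' T) \<noteq> 0"
    unfolding T'_def mtr_madj_mmul of_real_eq_0_iff .
  moreover have tr: "mtr n (mmul m T' T) = c * of_nat n" "mtr m (mmul n T T') = d * of_nat m"
    unfolding c d mtr_def mone_def by simp_all
  ultimately have c0: "c \<noteq> 0" by auto
  \<comment> \<open>The two bracketings of T T^H T give c T = d T, which is read off at the nonzero
    entry.\<close>
  have "mmul n T (mmul m T' T) = mmul m (mmul n T T') T" by (simp add: mmul_assoc)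
  then have "(\<lambda>i j. c * T i j) = (\<lambda>i j. d * T i j)"
    unfolding c d mmul_scalar_left[OF T(1)] mmul_scalar_right[OF T(1)] .
  from fun_cong[OF fun_cong[OF this], of i0 j0] have cd: "c = d" using ij by simp
  have "c * of_nat n = c * of_nat m" using tr mtr_mmul_commute[of n m T' T] cd by auto
  then have nm: "n = m" using c0 by simp
  define S where "S = (\<lambda>i j. T' i j / c)"
  have scale: "mmul n S X = (\<lambda>i j. mmul n T' X i j / c)" "mmul n X S = (\<lambda>i j. mmul n X T' i j / c)" for X
    by (simp_all add: S_def mmul_def sum_divide_distrib)
  show ?thesis
  proof
    show "n = m" by fact
    show "msupp n n S" using T' nm by (auto simp: S_def msupp_def)
    show "mmul n S T = mone n" unfolding scale using c c0 nm by simp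
    show "mmul n T S = mone n" unfolding scale using d cd c0 nm by simp
  qed
qed

end

section \<open>Passing to unitary corepresentations\<close>

locale unitarizable_hopf = hopf_star +
  assumes unitarizable: "unitarizable \<iota> st \<Delta> \<epsilon>"
begin

text \<open>The invariant form has a Gram matrix G with u^H G u = G. Choose E with E^H G E = 1 and
  put T = E^H G, which is inverse to E. Then w = T u E satisfies w^H w = E^H u^H (T^H T) u E = E^H G
  E = 1, because T^H T = G.\<close>

lemma unitarise:
  assumes u: "crep n u"
  obtains w T S where "ucrep n w" "msupp n n T" "msupp n n S" "mmul n T S = mone n" "mmul n S T = mone n"
    "mmul n (imat T) u = mmul n w (imat T)"
proof -
  have us: "msupp n n u" by (rule crepD(1)[OF u])
  have "corep \<iota> \<Delta> \<epsilon> n u" using u us by (simp add: corep_iff_crep mtrunc_ident)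
  from unitarizable[unfolded unitarizable_def, THEN spec, THEN spec, THEN mp, OF this]
  obtain G0 :: "nat \<Rightarrow> nat \<Rightarrow> complex" where G0: "\<forall>i<n. \<forall>j<n. G0 i j = cnj (G0 j i)"
    "\<forall>v\<in>vecs n. v \<noteq> (\<lambda>_. 0) \<longrightarrow> Im (\<Sum>i<n. \<Sum>j<n. cnj (v i) * G0 i j * v j) = 0
                                 \<and> Re (\<Sum>i<n. \<Sum>j<n. cnj (v i) * G0 i j * v j) > 0"
    "\<forall>i<n. \<forall>j<n. (\<Sum>k<n. \<Sum>l<n. \<iota> (G0 k l) * st (u k i) * u l j) = \<iota> (G0 i j)"
    by (elim exE conjE)
  define G where "G = mtrunc n n G0"
  have Gs: "msupp n n G" by (simp add: G_def)
  have Gherm: "madj cnj G = G"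
  proof (rule msupp_eqI[of n n])
    fix i j assume "i < n" "j < n"
    then have "G0 i j = cnj (G0 j i)" using G0(1) by blast
    then show "madj cnj G i j = G i j" using \<open>i < n\<close> \<open>j < n\<close> by (simp add: madj_def G_def mtrunc_def)
  qed (use Gs in auto)
  have Gpos: "(\<Sum>i<n. \<Sum>j<n. cnj (v i) * G i j * v j) = (\<Sum>i<n. \<Sum>j<n. cnj (v i) * G0 i j * v j)" for v
    by (intro sum.cong refl) (auto simp: G_def mtrunc_def)
  have inv: "mmul n (madj st u) (mmul n (imat G) u) = imat G"
  proof (rule msupp_eqI[of n n])
    fix i j assume ij: "i < n" "j < n"
    have "mmul n (madj st u) (mmul n (imat G) u) i j = (\<Sum>k<n. \<Sum>l<n. \<iota> (G0 k l) * st (u k i) * u l j)"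
      unfolding mmul_def madj_def imat_def sum_distrib_left
      by (intro sum.cong refl) (auto simp: G_def mtrunc_def iota_left_comm mult.assoc)
    then show "mmul n (madj st u) (mmul n (imat G) u) i j = imat G i j"
      using G0(3) ij by (simp add: imat_def G_def mtrunc_def)
  qed (use Gs us in \<open>auto intro!: msupp_mmul msupp_madj msupp_imat\<close>)
  have "G i j = cnj (G j i)" for i j
    using fun_cong[OF fun_cong[OF Gherm, of i], of j] by (simp add: madj_def)
  then have G1: "\<forall>i<n. \<forall>j<n. G i j = cnj (G j i)" by blast
  have G2: "\<forall>v\<in>vecs n. v \<noteq> (\<lambda>_. 0) \<longrightarrow> 0 < Re (\<Sum>i<n. \<Sum>j<n. cnj (v i) * G i j * v j)"
    unfolding Gpos using G0(2) by blast
  obtain E where E: "msupp n n E" "mmul n (madj cnj E) (mmul n G E) = mone n"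
    "mmul n E (mmul n (madj cnj E) G) = mone n"
    using invertible_congruence[OF G1 G2 Gs] by blast
  define T where "T = mmul n (madj cnj E) G"
  have T: "msupp n n T" using E(1) Gs by (auto simp: T_def)
  have TE: "mmul n T E = mone n" "mmul n E T = mone n" using E by (simp_all add: T_def mmul_assoc)
  have TG: "mmul n (madj cnj T) T = G"
  proof -
    have "mmul n (madj cnj T) T = mmul n G (mmul n E (mmul n (madj cnj E) G))"
      by (simp add: T_def madj_cnj_mmul Gherm mmul_assoc)
    then show ?thesis using Gs by (simp add: E(3))
  qed
  define w where "w = mmul n (imat T) (mmul n u (imat E))"
  have int: "mmul n (imat T) u = mmul n w (imat T)"
  proof -
    have "mmul n w (imat T) = mmul n (imat T) (mmul n u (imat (mmul n E T)))"
      by (simp add: w_def mmul_assoc imat_mmul)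
    then show ?thesis using us by (simp add: TE)
  qed
  have "mmul n u (imat E) = mmul n (imat E) w"
  proof -
    have "mmul n (imat E) w = mmul n (imat (mmul n E T)) (mmul n u (imat E))"
      by (simp add: w_def mmul_assoc imat_mmul)
    also have "\<dots> = mmul n u (imat E)"
      unfolding TE imat_mone using us E(1) by (intro mmul_mone_left[of n n] msupp_mmul msupp_imat)
    finally show ?thesis ..
  qed
  then have w: "crep n w" by (rule crep_compress[OF u E(1) T TE(1) _ w_def])
  have "mmul n (madj st w) w = mmul n (imat (madj cnj E)) (mmul n (madj st u) (mmul n (imat (mmul n (madj cnj T) T)) (mmul n u (imat E))))"
    by (simp add: w_def madj_mmul madj_imat imat_mmul mmul_assoc)
  also have "\<dots> = mmul n (imat (madj cnj E)) (mmul n (mmul n (madj st u) (mmul n (imat G) u)) (imat E))"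
    by (simp add: TG mmul_assoc)
  also have "\<dots> = mone n" by (simp add: inv E(2) flip: imat_mmul)
  finally have "ucrep n w" by (rule ucrepI[OF w])
  then show ?thesis using that T E(1) TE int by blast
qed

end

section \<open>Complete reducibility\<close>

lemma mmul_add_right: "mmul k X (Y + Z) = mmul k X Y + mmul k X Z"
  by (simp add: mmul_def fun_eq_iff distrib_left sum.distrib)

lemma mmul_add_left: "mmul k (X + Y) Z = mmul k X Z + mmul k Y Z"
  by (simp add: mmul_def fun_eq_iff distrib_right sum.distrib)

lemma mtr_add: "mtr n (X + Y) = mtr n X + mtr n Y"
  by (simp add: mtr_def sum.distrib)

text \<open>The case G = 1 of \<open>vecs_orthonormal_basis\<close>: E E^H acts as the identity on
  W.\<close>

lemma orthonormal_columns:
  assumes W: "lin_sub n W"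
  obtains m E where "msupp n m E" "\<forall>k<m. (\<lambda>i. E i k) \<in> W" "mmul n (madj cnj E) E = mone m"
    "\<forall>v\<in>W. mv m E (mv n (madj cnj E) v) = v"
proof -
  have form: "(\<Sum>i<n. \<Sum>j<n. cnj (v i) * mone n i j * w j) = (\<Sum>i<n. cnj (v i) * w i)" for v w
  proof (intro sum.cong refl)
    fix i assume i: "i \<in> {..<n}"
    have "(\<Sum>j<n. cnj (v i) * mone n i j * w j) = (\<Sum>j<n. if i = j then cnj (v i) * w j else 0)"
      by (intro sum.cong) (auto simp: mone_def)
    then show "(\<Sum>j<n. cnj (v i) * mone n i j * w j) = cnj (v i) * w i" using i by simp
  qed
  have herm: "\<forall>i<n. \<forall>j<n. mone n i j = cnj (mone n j i)" by (auto simp: mone_def)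
  have pos: "\<forall>v\<in>W. v \<noteq> (\<lambda>_. 0) \<longrightarrow> 0 < Re (\<Sum>i<n. \<Sum>j<n. cnj (v i) * mone n i j * v j)"
  proof (intro ballI impI)
    fix v assume v: "v \<in> W" "v \<noteq> (\<lambda>_. 0)"
    then obtain i where i: "v i \<noteq> 0" by auto
    have "v \<in> vecs n" using v(1) W unfolding lin_sub_def by blast
    then have "i < n" using i by (auto simp: vecs_def simp flip: not_le)
    have "Re (\<Sum>i<n. cnj (v i) * v i) = (\<Sum>i<n. (cmod (v i))\<^sup>2)"
      unfolding cmod_power2 by (simp add: power2_eq_square)
    also have "\<dots> > 0" using i \<open>i < n\<close> by (intro sum_pos2[of _ i]) auto
    finally show "0 < Re (\<Sum>i<n. \<Sum>j<n. cnj (v i) * mone n i j * v j)" by (simp only: form)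
  qed
  obtain m E where E: "msupp n m E" "\<forall>k<m. (\<lambda>i. E i k) \<in> W" "mmul n (madj cnj E) (mmul n (mone n) E) = mone m"
    and exp: "\<forall>v\<in>W. v = (\<lambda>i. \<Sum>k<m. (\<Sum>p<n. \<Sum>q<n. cnj (E p k) * mone n p q * v q) * E i k)"
    using vecs_orthonormal_basis[OF W herm pos] by (elim exE conjE)
  have "mv m E (mv n (madj cnj E) v) = v" if "v \<in> W" for v
  proof -
    have "mv m E (mv n (madj cnj E) v) = (\<lambda>i. \<Sum>k<m. (\<Sum>p<n. cnj (E p k) * v p) * E i k)"
      by (simp add: mv_def madj_def mult.commute)
    also have "\<dots> = v" using bspec[OF exp that] unfolding form by (rule sym)
    finally show ?thesis .
  qed
  moreover have "mmul n (madj cnj E) E = mone m" using E(1,3) by simp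
  ultimately show ?thesis using that E(1,2) by blast
qed

text \<open>The columns of E and E' are orthonormal bases of W and of its orthogonal complement, so
  the two projections add up to the identity; taking traces of that equation gives n = m +
  m'.\<close>

lemma orthogonal_decomposition:
  assumes W: "lin_sub n W"
  obtains m E m' E' where "msupp n m E" "msupp n m' E'" "n = m + m'"
    "mmul n (madj cnj E) E = mone m" "mmul n (madj cnj E') E' = mone m'"
    "mmul n (madj cnj E) E' = (\<lambda>i j. 0)"
    "mmul m E (madj cnj E) + mmul m' E' (madj cnj E') = mone n"
    "\<forall>k<m. (\<lambda>i. E i k) \<in> W" "\<forall>v\<in>W. mv m E (mv n (madj cnj E) v) = v"
proof -
  obtain m E where E: "msupp n m E" "\<forall>k<m. (\<lambda>i. E i k) \<in> W" "mmul n (madj cnj E) E = mone m"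
    "\<forall>v\<in>W. mv m E (mv n (madj cnj E) v) = v" by (rule orthonormal_columns[OF W])
  \<comment> \<open>The orthogonal complement of W, written as the kernel of E^H.\<close>
  define W' where "W' = {v \<in> vecs n. mv n (madj cnj E) v = (\<lambda>_. 0)}"
  have W': "lin_sub n W'" by (auto simp: W'_def lin_sub_def vecs_def mv_add mv_scale)
  obtain m' E' where E': "msupp n m' E'" "\<forall>k<m'. (\<lambda>i. E' i k) \<in> W'" "mmul n (madj cnj E') E' = mone m'"
    "\<forall>v\<in>W'. mv m' E' (mv n (madj cnj E') v) = v" by (rule orthonormal_columns[OF W'])
  have adj: "msupp m n (madj cnj E)" "msupp m' n (madj cnj E')" using E(1) E'(1) by auto
  have EE': "mmul n (madj cnj E) E' = (\<lambda>i j. 0)"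
  proof (rule msupp_eqI[of m m'])
    fix i j assume "i < m" "j < m'"
    then have "(\<lambda>i. E' i j) \<in> W'" using E'(2) by blast
    then have "mv n (madj cnj E) (\<lambda>i. E' i j) i = 0" by (simp add: W'_def)
    then show "mmul n (madj cnj E) E' i j = 0" by (simp add: mv_mmul_column)
  qed (use adj E'(1) in \<open>auto simp: msupp_def mmul_def\<close>)
  have "mmul n (madj cnj E') E = madj cnj (mmul n (madj cnj E) E')" by (simp add: madj_cnj_mmul)
  then have E'E: "mmul n (madj cnj E') E = (\<lambda>i j. 0)" unfolding EE' by (simp add: madj_def)
  have sum1: "mmul m E (madj cnj E) + mmul m' E' (madj cnj E') = mone n"
  proof (rule msupp_eqI[of n n])
    show "msupp n n (mmul m E (madj cnj E) + mmul m' E' (madj cnj E'))"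
      using msupp_mmul[OF E(1) adj(1)] msupp_mmul[OF E'(1) adj(2)] by (auto simp: msupp_def)
    fix i k assume k: "k < n"
    \<comment> \<open>The sum of the projections is tested on standard basis vectors: x is the
      component of v in W, and the remainder y lies in the complement.\<close>
    define v where "v = (\<lambda>i. mone n i k :: complex)"
    have v: "v \<in> vecs n" by (auto simp: v_def vecs_def mone_def)
    define x where "x = mv m E (mv n (madj cnj E) v)"
    have x: "x \<in> vecs n" unfolding x_def by (rule mv_vecs[OF E(1)])
    define y where "y = (\<lambda>i. v i + (-1) * x i)"
    have Ex: "mv n (madj cnj E) x = mv n (madj cnj E) v"
      unfolding x_def mv_mmul[symmetric] mmul_assoc[symmetric] E(3)
      using mv_mone[OF mv_vecs[OF adj(1), of n v]] by (simp add: mv_mmul)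
    have E'x: "mv n (madj cnj E') x = (\<lambda>_. 0)"
      unfolding x_def mv_mmul[symmetric] mmul_assoc[symmetric] E'E by (simp add: mv_def mmul_def)
    have "mv n (madj cnj E) y = (\<lambda>_. 0)" unfolding y_def mv_add mv_scale Ex by simp
    then have "y \<in> W'" using v x by (auto simp: W'_def y_def vecs_def)
    then have "mv m' E' (mv n (madj cnj E') y) = y" using E'(4) by blast
    then have "mv m' E' (mv n (madj cnj E') v) = y" unfolding y_def mv_add mv_scale E'x by simp
    then have "mv m' E' (mv n (madj cnj E') v) i + x i = v i" by (simp add: y_def)
    then show "(mmul m E (madj cnj E) + mmul m' E' (madj cnj E')) i k = mone n i k"
      using k by (simp add: x_def v_def mv_column) (simp add: mv_mmul_column add.commute)
  qed auto
  have "of_nat n = mtr n (mmul m E (madj cnj E) + mmul m' E' (madj cnj E'))" by (simp add: sum1)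
  also have "\<dots> = of_nat (m + m')"
    unfolding mtr_add using mtr_mmul_commute[of n m E] mtr_mmul_commute[of n m' E'] E(3) E'(3) by simp
  finally have "n = m + m'" by (simp only: of_nat_eq_iff)
  then show ?thesis using that E(1) E'(1) E(3) E'(3) EE' sum1 E(2,4) by blast
qed

section \<open>Isomorphism of corepresentations in matrix form\<close>

context hopf_star
begin

lemma imat_add: "imat (X + Y) = imat X + imat Y"
  by (simp add: imat_def iota_add fun_eq_iff)

lemma corep_iso_iff:
  "corep_iso \<iota> n u m w \<longleftrightarrow> n = m \<and> (\<exists>T S. msupp n n T \<and> msupp n n S \<and> mmul n S T = mone n \<and> mmul n T S = mone n \<and>
     mmul n (mtrunc n n w) (imat T) = mmul n (imat T) (mtrunc n n u))"
proof
  assume "corep_iso \<iota> n u m w"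
  then obtain T S :: "nat \<Rightarrow> nat \<Rightarrow> complex" where nm: "n = m" and
    inv: "\<forall>i<n. \<forall>j<n. (\<Sum>l<n. S i l * T l j) = (if i = j then 1 else 0)
                  \<and> (\<Sum>l<n. T i l * S l j) = (if i = j then 1 else 0)" and
    int: "\<forall>i<n. \<forall>j<n. (\<Sum>l<n. w i l * \<iota> (T l j)) = (\<Sum>l<n. \<iota> (T i l) * u l j)"
    unfolding corep_iso_def by blast
  define T' S' where "T' = mtrunc n n T" and "S' = mtrunc n n S"
  have "mmul n S' T' = mone n" "mmul n T' S' = mone n"
    using inv by (auto intro!: msupp_eqI[of n n] msupp_mmul simp: T'_def S'_def)
      (auto simp: mmul_def mtrunc_def mone_def)
  moreover have "mmul n (mtrunc n n w) (imat T') = mmul n (imat T') (mtrunc n n u)"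
    using int by (auto intro!: msupp_eqI[of n n] msupp_mmul msupp_imat simp: T'_def)
      (auto simp: mmul_def mtrunc_def imat_def)
  ultimately show "n = m \<and> (\<exists>T S. msupp n n T \<and> msupp n n S \<and> mmul n S T = mone n \<and> mmul n T S = mone n \<and>
     mmul n (mtrunc n n w) (imat T) = mmul n (imat T) (mtrunc n n u))"
    using nm by (intro conjI exI[of _ T'] exI[of _ S']) (auto simp: T'_def S'_def)
next
  assume "n = m \<and> (\<exists>T S. msupp n n T \<and> msupp n n S \<and> mmul n S T = mone n \<and> mmul n T S = mone n \<and>
     mmul n (mtrunc n n w) (imat T) = mmul n (imat T) (mtrunc n n u))"
  then obtain T S where nm: "n = m" and TS: "mmul n S T = mone n" "mmul n T S = mone n"
    "mmul n (mtrunc n n w) (imat T) = mmul n (imat T) (mtrunc n n u)" by blast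
  have "(\<Sum>l<n. S i l * T l j) = (if i = j then 1 else 0)" "(\<Sum>l<n. T i l * S l j) = (if i = j then 1 else 0)"
    if "i < n" "j < n" for i j
    using fun_cong[OF fun_cong[OF TS(1), of i], of j] fun_cong[OF fun_cong[OF TS(2), of i], of j] that
    by (simp_all add: mmul_def mone_def)
  moreover have "(\<Sum>l<n. w i l * \<iota> (T l j)) = (\<Sum>l<n. \<iota> (T i l) * u l j)" if "i < n" "j < n" for i j
    using fun_cong[OF fun_cong[OF TS(3), of i], of j] that
    by (simp add: mmul_def imat_def mtrunc_def)
  ultimately show "corep_iso \<iota> n u m w" unfolding corep_iso_def using nm by blast
qed

lemma corep_iso_refl: "corep_iso \<iota> n u n u"
  unfolding corep_iso_iff
  by (intro conjI refl exI[of _ "mone n"]) (auto simp: mmul_mone_left[of n n] mmul_mone_right[of n n])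

lemma corep_iso_sym:
  assumes "corep_iso \<iota> n u m w"
  shows "corep_iso \<iota> m w n u"
proof -
  obtain T S where nm: "n = m" and TS: "msupp n n T" "msupp n n S" "mmul n S T = mone n" "mmul n T S = mone n"
    "mmul n (mtrunc n n w) (imat T) = mmul n (imat T) (mtrunc n n u)"
    using assms unfolding corep_iso_iff by blast
  have "mmul n (mtrunc n n u) (imat S) = mmul n (imat (mmul n S T)) (mmul n (mtrunc n n u) (imat S))"
    unfolding TS(3) imat_mone using TS(2) by (intro mmul_mone_left[symmetric, of n n]) auto
  also have "\<dots> = mmul n (imat S) (mmul n (mmul n (imat T) (mtrunc n n u)) (imat S))"
    by (simp add: imat_mmul mmul_assoc)
  also have "\<dots> = mmul n (imat S) (mmul n (mtrunc n n w) (imat (mmul n T S)))"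
    unfolding TS(5)[symmetric] by (simp add: imat_mmul mmul_assoc)
  also have "\<dots> = mmul n (imat S) (mtrunc n n w)" unfolding TS(4) by (simp add: mmul_mone_right[of n n])
  finally show ?thesis unfolding corep_iso_iff using nm TS by blast
qed

lemma corep_iso_trans:
  assumes "corep_iso \<iota> n u m w" "corep_iso \<iota> m w k x"
  shows "corep_iso \<iota> n u k x"
proof -
  obtain T S where nm: "n = m" and TS: "msupp n n T" "msupp n n S" "mmul n S T = mone n" "mmul n T S = mone n"
    "mmul n (mtrunc n n w) (imat T) = mmul n (imat T) (mtrunc n n u)"
    using assms unfolding corep_iso_iff by blast
  obtain T' S' where mk: "m = k" and TS': "msupp n n T'" "msupp n n S'" "mmul n S' T' = mone n" "mmul n T' S' = mone n"
    "mmul n (mtrunc n n x) (imat T') = mmul n (imat T') (mtrunc n n w)"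
    using assms(2) nm unfolding corep_iso_iff by blast
  have "mmul n (mmul n S S') (mmul n T' T) = mmul n S (mmul n (mmul n S' T') T)" by (simp add: mmul_assoc)
  then have 1: "mmul n (mmul n S S') (mmul n T' T) = mone n" unfolding TS'(3) using TS by simp
  have "mmul n (mmul n T' T) (mmul n S S') = mmul n T' (mmul n (mmul n T S) S')" by (simp add: mmul_assoc)
  then have 2: "mmul n (mmul n T' T) (mmul n S S') = mone n" unfolding TS(4) using TS' by simp
  have "mmul n (mtrunc n n x) (imat (mmul n T' T)) = mmul n (mmul n (mtrunc n n x) (imat T')) (imat T)"
    by (simp add: imat_mmul mmul_assoc)
  also have "\<dots> = mmul n (imat T') (mmul n (mtrunc n n w) (imat T))" unfolding TS'(5) by (simp add: mmul_assoc)
  also have "\<dots> = mmul n (imat (mmul n T' T)) (mtrunc n n u)" unfolding TS(5) by (simp add: imat_mmul mmul_assoc)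
  finally show ?thesis unfolding corep_iso_iff using nm mk 1 2 TS(1,2) TS'(1,2)
    by (intro conjI exI[of _ "mmul n T' T"] exI[of _ "mmul n S S'"]) auto
qed

end

section \<open>Unitary representatives and reduction to irreducibles\<close>

context unitarizable_hopf
begin

abbreviation Irr :: "(nat \<times> (nat \<Rightarrow> nat \<Rightarrow> 'a)) set set" where
  "Irr \<equiv> irr_classes \<iota> \<Delta> \<epsilon>"

text \<open>Unitarising any member of the class keeps it irreducible and in the class. Isomorphic
  corepresentations have equal size by definition, so the arbitrary choice inside
  \<open>cdim\<close> does not matter.\<close>

lemma class_representative:
  assumes "L \<in> Irr"
  shows "\<exists>w. ucrep (cdim L) w \<and> corep_irred \<iota> (cdim L) w \<and> L = {(m, x). corep \<iota> \<Delta> \<epsilon> m x \<and> corep_iso \<iota> (cdim L) w m x}"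
proof -
  obtain n u where u: "corep \<iota> \<Delta> \<epsilon> n u" "corep_irred \<iota> n u"
    and L: "L = {(m, x). corep \<iota> \<Delta> \<epsilon> m x \<and> corep_iso \<iota> n u m x}"
    using assms unfolding irr_classes_def by blast
  have "(n, u) \<in> L" using u corep_iso_refl by (simp add: L)
  then have "(SOME p. p \<in> L) \<in> L" by (rule someI)
  moreover have "fst p = n" if "p \<in> L" for p using that unfolding L corep_iso_def by auto
  ultimately have n: "cdim L = n" unfolding cdim_def by blast
  have u': "crep n (mtrunc n n u)" "corep_irred \<iota> n (mtrunc n n u)"
    using u by (simp_all add: corep_iff_crep corep_irred_mtrunc)
  obtain w T S where w: "ucrep n w" and T: "msupp n n T" "msupp n n S" "mmul n T S = mone n" "mmul n S T = mone n"
    "mmul n (imat T) (mtrunc n n u) = mmul n w (imat T)" by (rule unitarise[OF u'(1)])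
  have "corep_irred \<iota> n w" by (rule irred_conjugate[OF u' ucrepD(1)[OF w] T])
  moreover have "corep_iso \<iota> n u n w"
    unfolding corep_iso_iff mtrunc_ident[OF ucrepD(4)[OF w]] using T by metis
  then have "L = {(m, x). corep \<iota> \<Delta> \<epsilon> m x \<and> corep_iso \<iota> n w m x}"
    unfolding L using corep_iso_trans corep_iso_sym by blast
  ultimately show ?thesis unfolding n using w by (intro exI[of _ w] conjI)
qed

text \<open>A fixed unitary representative of each class; its entries will be the a_ij of the
  theorem.\<close>

definition rep :: "(nat \<times> (nat \<Rightarrow> nat \<Rightarrow> 'a)) set \<Rightarrow> nat \<Rightarrow> nat \<Rightarrow> 'a" where
  "rep L = (SOME w. ucrep (cdim L) w \<and> corep_irred \<iota> (cdim L) w \<and>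
     L = {(m, x). corep \<iota> \<Delta> \<epsilon> m x \<and> corep_iso \<iota> (cdim L) w m x})"

lemma rep:
  assumes "L \<in> Irr"
  shows "ucrep (cdim L) (rep L)" "corep_irred \<iota> (cdim L) (rep L)"
    "L = {(m, x). corep \<iota> \<Delta> \<epsilon> m x \<and> corep_iso \<iota> (cdim L) (rep L) m x}"
    "crep (cdim L) (rep L)" "msupp (cdim L) (cdim L) (rep L)" "0 < cdim L"
proof -
  have *: "ucrep (cdim L) (rep L) \<and> corep_irred \<iota> (cdim L) (rep L) \<and>
     L = {(m, x). corep \<iota> \<Delta> \<epsilon> m x \<and> corep_iso \<iota> (cdim L) (rep L) m x}"
    unfolding rep_def by (rule someI_ex[OF class_representative[OF assms]])
  show 1: "ucrep (cdim L) (rep L)" by (rule conjunct1[OF *])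
  show 2: "corep_irred \<iota> (cdim L) (rep L)" by (rule conjunct1[OF conjunct2[OF *]])
  show "L = {(m, x). corep \<iota> \<Delta> \<epsilon> m x \<and> corep_iso \<iota> (cdim L) (rep L) m x}"
    by (rule conjunct2[OF conjunct2[OF *]])
  show "crep (cdim L) (rep L)" "msupp (cdim L) (cdim L) (rep L)" using ucrepD[OF 1] by simp_all
  show "0 < cdim L" using 2 by (simp add: corep_irred_def)
qed

lemma rep_iso_imp_eq:
  assumes "L \<in> Irr" "L' \<in> Irr" "corep_iso \<iota> (cdim L) (rep L) (cdim L') (rep L')"
  shows "L = L'"
proof -
  have "corep_iso \<iota> (cdim L) (rep L) m x \<longleftrightarrow> corep_iso \<iota> (cdim L') (rep L') m x" for m x
    using assms(3) corep_iso_trans corep_iso_sym by blast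
  then show ?thesis using rep(3)[OF assms(1)] rep(3)[OF assms(2)] by simp
qed

lemma rep_of_irred:
  assumes u: "crep n u" "corep_irred \<iota> n u"
  obtains L where "L \<in> Irr" "corep_iso \<iota> (cdim L) (rep L) n u"
proof -
  have c: "corep \<iota> \<Delta> \<epsilon> n u" using u(1) crepD(1)[OF u(1)] by (simp add: corep_iff_crep mtrunc_ident)
  define L where "L = {(m, x). corep \<iota> \<Delta> \<epsilon> m x \<and> corep_iso \<iota> n u m x}"
  have L: "L \<in> Irr" unfolding irr_classes_def L_def using c u(2) by blast
  have "(n, u) \<in> L" using c corep_iso_refl by (simp add: L_def)
  then have "(n, u) \<in> {(m, x). corep \<iota> \<Delta> \<epsilon> m x \<and> corep_iso \<iota> (cdim L) (rep L) m x}"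
    using rep(3)[OF L] by (rule back_subst)
  then show ?thesis using that L by simp
qed

text \<open>Schur's lemma in the entrywise form needed for independence. Between different classes T
  vanishes; within one class T is scalar and its off-diagonal entries vanish. The hypothesis
  \<open>ne\<close> covers both cases.\<close>

lemma rep_intertwiner:
  assumes L: "L \<in> Irr" "L' \<in> Irr" and T: "msupp (cdim L') (cdim L) T"
    and int: "mmul (cdim L) (imat T) (rep L) = mmul (cdim L') (rep L') (imat T)"
    and ne: "(L', p) \<noteq> (L, k)"
  shows "T p k = 0"
proof (rule ccontr)
  assume nz: "T p k \<noteq> 0"
  then have "T \<noteq> (\<lambda>i j. 0)" by auto
  then obtain S where S: "cdim L = cdim L'" "msupp (cdim L) (cdim L) S" "mmul (cdim L) S T = mone (cdim L)"
     "mmul (cdim L) T S = mone (cdim L)"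
    by (rule schur_iso[OF rep(1,2)[OF L(1)] rep(1,2)[OF L(2)] T _ int]) (rule that)
  have "corep_iso \<iota> (cdim L) (rep L) (cdim L') (rep L')"
    unfolding corep_iso_iff using S T int rep(5)[OF L(1)] rep(5)[OF L(2)]
    by (intro conjI exI[of _ T] exI[of _ S]) (simp_all add: mtrunc_ident)
  then have LL: "L = L'" by (rule rep_iso_imp_eq[OF L])
  then obtain c where "T = (\<lambda>i j. c * mone (cdim L) i j)"
    using schur_scalar[OF rep(4,2)[OF L(1)], of T] T int by blast
  then show False using nz ne LL by (auto simp: mone_def split: if_splits)
qed

definition coefs :: "'a set" where
  "coefs = (\<lambda>(L, i, j). rep L i j) ` (SIGMA L:Irr. {..<cdim L} \<times> {..<cdim L})"

lemma rep_in_span_coefs: "L \<in> Irr \<Longrightarrow> rep L i j \<in> vs.span coefs"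
proof (cases "i < cdim L \<and> j < cdim L")
  case True
  assume "L \<in> Irr"
  then have "rep L i j \<in> coefs" unfolding coefs_def using True by (intro image_eqI[of _ _ "(L, i, j)"]) auto
  then show ?thesis by (rule vs.span_base)
next
  case False
  assume "L \<in> Irr"
  then have "rep L i j = 0" using False rep(5) by (auto simp: msupp_def)
  then show ?thesis by (simp add: vs.span_zero)
qed

lemma span_mmul_imat:
  assumes "\<And>i j. w i j \<in> vs.span B"
  shows "mmul k (imat X) w i j \<in> vs.span B" "mmul k w (imat X) i j \<in> vs.span B"
proof -
  have "\<iota> c * w p q \<in> vs.span B" for c p q using vs.span_scale[OF assms] by (simp add: sc_def)
  then show "mmul k (imat X) w i j \<in> vs.span B" "mmul k w (imat X) i j \<in> vs.span B"
    unfolding mmul_def imat_def iota_comm[symmetric] by (auto intro: vs.span_sum)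
qed

text \<open>Complete reducibility by strong induction on the size. After unitarising, an irreducible
  corepresentation is conjugate to some \<open>rep L\<close>; a reducible one is E b E^H + E' c E'^H
  with smaller corepresentations b and c on an invariant subspace and its orthogonal complement.
  Conjugation by scalar matrices stays in the span.\<close>

lemma matrix_coefficients_in_span:
  assumes "crep n u"
  shows "u i j \<in> vs.span coefs"
  using assms
proof (induction n arbitrary: u i j rule: less_induct)
  case (less n)
  obtain w T S where w: "ucrep n w" and T: "msupp n n T" "msupp n n S" "mmul n T S = mone n" "mmul n S T = mone n"
    "mmul n (imat T) u = mmul n w (imat T)" by (rule unitarise[OF less.prems])
  have us: "msupp n n u" by (rule crepD(1)[OF less.prems])
  have ws: "msupp n n w" by (rule ucrepD(4)[OF w])
  have "mmul n (imat S) (mmul n w (imat T)) = mmul n (imat (mmul n S T)) u"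
    unfolding T(5)[symmetric] by (simp add: imat_mmul mmul_assoc)
  also have "\<dots> = u" unfolding T(4) using us by simp
  finally have u: "u = mmul n (imat S) (mmul n w (imat T))" ..
  have "w i j \<in> vs.span coefs" for i j
  proof (cases "corep_irred \<iota> n w")
    case True
    obtain L where L: "L \<in> Irr" "corep_iso \<iota> (cdim L) (rep L) n w"
      by (rule rep_of_irred[OF ucrepD(1)[OF w] True])
    from L(2) obtain X Y where n: "cdim L = n" and X: "msupp n n X" "msupp n n Y" "mmul n X Y = mone n"
      "mmul n w (imat X) = mmul n (imat X) (rep L)"
      using rep(5)[OF L(1)] ws unfolding corep_iso_iff by (auto simp: mtrunc_ident)
    have "w = mmul n w (imat (mmul n X Y))" unfolding X(3) using ws by simp
    also have "\<dots> = mmul n (mmul n w (imat X)) (imat Y)" by (simp add: imat_mmul mmul_assoc)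
    finally have weq: "w = mmul n (mmul n (imat X) (rep L)) (imat Y)" unfolding X(4) .
    show ?thesis by (subst weq) (intro span_mmul_imat rep_in_span_coefs L(1))
  next
    case False
    show ?thesis
    proof (cases "n = 0")
      case True
      then have "w i j = 0" using ws by (simp add: msupp_def)
      then show ?thesis by (simp add: vs.span_zero)
    next
      case n: False
      obtain W where W: "lin_sub n W" "W \<noteq> {\<lambda>_. 0}" "W \<noteq> vecs n"
        and inv: "\<And>v \<phi>. v \<in> W \<Longrightarrow> clin \<iota> \<phi> \<Longrightarrow> mv n (mmap \<phi> w) v \<in> W"
        using False n unfolding corep_irred_iff[OF ws] by blast
      obtain m E m' E' where E: "msupp n m E" "msupp n m' E'" "n = m + m'"
        "mmul n (madj cnj E) E = mone m" "mmul n (madj cnj E') E' = mone m'"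
        "mmul n (madj cnj E) E' = (\<lambda>i j. 0)"
        "mmul m E (madj cnj E) + mmul m' E' (madj cnj E') = mone n"
        "\<forall>k<m. (\<lambda>i. E i k) \<in> W" "\<forall>v\<in>W. mv m E (mv n (madj cnj E) v) = v"
        by (rule orthogonal_decomposition[OF W(1)])
      have adj: "msupp m n (madj cnj E)" "msupp m' n (madj cnj E')" using E(1,2) by auto
      \<comment> \<open>m = 0 would make W zero and m' = 0 would make W the whole space; excluding
        both makes both blocks strictly smaller than n.\<close>
      have "m \<noteq> 0"
      proof
        assume "m = 0"
        then have "v = (\<lambda>_. 0)" if "v \<in> W" for v
          using bspec[OF E(9) that] by (simp add: mv_def fun_eq_iff)
        then show False using W(1,2) by (auto simp: lin_sub_def)
      qed
      moreover have "m' \<noteq> 0"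
      proof
        assume "m' = 0"
        then have one: "mmul m E (madj cnj E) = mone n"
          using E(7) by (simp add: mmul_def fun_eq_iff)
        have "v \<in> W" if v: "v \<in> vecs n" for v
        proof -
          have "v = mv m E (mv n (madj cnj E) v)"
            using mv_mone[OF v] unfolding one[symmetric] mv_mmul by simp
          also have "\<dots> = (\<lambda>i. \<Sum>k<m. (mv n (madj cnj E) v k) * E i k)" by (simp add: mv_def mult.commute)
          also have "(\<lambda>i. \<Sum>k<m. (c k) * E i k) \<in> W" for c
          proof -
            have "r \<le> m \<Longrightarrow> (\<lambda>i. \<Sum>k<r. (c k) * E i k) \<in> W" for r
              using W(1) E(8) by (induction r) (auto simp: lin_sub_def)
            then show ?thesis by blast
          qed
          finally show ?thesis .
        qed
        then show False using W(1,3) by (auto simp: lin_sub_def)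
      qed
      ultimately have lt: "m < n" "m' < n" using E(3) by auto
      define b where "b = mmul n (imat (madj cnj E)) (mmul n w (imat E))"
      define c where "c = mmul n (imat (madj cnj E')) (mmul n w (imat E'))"
      have wE: "mmul n w (imat E) = mmul m (imat E) b"
      proof (rule matrix_eqI)
        fix \<phi> assume \<phi>: "clin \<iota> \<phi>"
        have "mmul n (mmap \<phi> w) E = mmul m E (mmul n (madj cnj E) (mmul n (mmap \<phi> w) E))"
        proof (intro ext)
          fix p k
          show "mmul n (mmap \<phi> w) E p k = mmul m E (mmul n (madj cnj E) (mmul n (mmap \<phi> w) E)) p k"
          proof (cases "k < m")
            case True
            have "mv n (mmap \<phi> w) (\<lambda>i. E i k) \<in> W" by (rule inv[OF _ \<phi>]) (use E(8) True in blast)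
            from fun_cong[OF bspec[OF E(9) this], of p] show ?thesis by (simp add: mv_mmul_column)
          next
            case False
            then have "E q k = 0" for q using E(1) by (auto simp: msupp_def)
            then show ?thesis by (simp add: mmul_def)
          qed
        qed
        then show "mmap \<phi> (mmul n w (imat E)) = mmap \<phi> (mmul m (imat E) b)"
          using \<phi> by (simp add: b_def mmap_mmul_imat_left mmap_mmul_imat_right)
      qed
      have b: "crep m b" by (rule crep_compress[OF ucrepD(1)[OF w] E(1) adj(1) E(4) wE b_def])
      have "mmul m (madj st b) b = mmul n (imat (madj cnj E)) (mmul n (madj st w) (mmul m (imat E) b))"
        by (simp add: b_def madj_mmul madj_imat mmul_assoc)
      also have "\<dots> = mmul n (imat (madj cnj E)) (mmul n (mmul n (madj st w) w) (imat E))"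
        unfolding wE[symmetric] by (simp add: mmul_assoc)
      also have "\<dots> = imat (mmul n (madj cnj E) E)"
        unfolding ucrepD(2)[OF w] by (simp add: imat_mmul mmul_mone_left[OF msupp_imat[OF E(1)]])
      also have "\<dots> = mone m" unfolding E(4) by simp
      finally have ub: "ucrep m b" by (rule ucrepI[OF b])
      \<comment> \<open>E intertwines the unitary b with w, so E^H does too. Then E^H w E' = b E^H
        E' = 0: the off-diagonal block is zero and the complement is invariant.\<close>
      have Ew: "mmul n (imat (madj cnj E)) w = mmul m b (imat (madj cnj E))"
        by (rule adjoint_intertwines[OF ub w E(1) wE[symmetric]])
      have split: "mmul n (imat (mmul m E (madj cnj E) + mmul m' E' (madj cnj E'))) X = X"
        if "msupp n k X" for k X unfolding E(7) using that by simp
      have "mmul n w (imat E') = mmul n (imat (mmul m E (madj cnj E) + mmul m' E' (madj cnj E'))) (mmul n w (imat E'))"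
        using ws E(2) by (intro split[symmetric, of m']) auto
      also have "\<dots> = mmul m (imat E) (mmul n (mmul n (imat (madj cnj E)) w) (imat E')) + mmul m' (imat E') c"
        by (simp add: imat_add mmul_add_left imat_mmul mmul_assoc c_def)
      also have "mmul n (mmul n (imat (madj cnj E)) w) (imat E') = mmul m b (imat (mmul n (madj cnj E) E'))"
        unfolding Ew by (simp add: imat_mmul mmul_assoc)
      also have "\<dots> = (\<lambda>i j. 0)" unfolding E(6) by (simp add: imat_def mmul_def)
      finally have wE': "mmul n w (imat E') = mmul m' (imat E') c"
        by (simp add: mmul_def fun_eq_iff)
      have c: "crep m' c" by (rule crep_compress[OF ucrepD(1)[OF w] E(2) adj(2) E(5) wE' c_def])
      have "w = mmul n w (imat (mmul m E (madj cnj E) + mmul m' E' (madj cnj E')))"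
        unfolding E(7) using ws by simp
      also have "\<dots> = mmul m (mmul n w (imat E)) (imat (madj cnj E)) + mmul m' (mmul n w (imat E')) (imat (madj cnj E'))"
        by (simp add: imat_add mmul_add_right imat_mmul mmul_assoc)
      finally have "w i j = mmul m (mmul m (imat E) b) (imat (madj cnj E)) i j +
          mmul m' (mmul m' (imat E') c) (imat (madj cnj E')) i j"
        unfolding wE wE' by (simp add: fun_eq_iff)
      then show ?thesis
        using less.IH[OF lt(1) b] less.IH[OF lt(2) c] by (auto intro!: vs.span_add span_mmul_imat)
    qed
  qed
  then show ?case by (subst u) (intro span_mmul_imat)
qed

end

section \<open>The matrix coefficients form a basis\<close>

context unitarizable_hopf
begin

text \<open>The finiteness theorem for comodules. The right slices of a form a finite-dimensional
  subcomodule V that contains a. In a basis x of V the coproduct is x_j -> sum_k x_k (x) u_kj with u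
  a corepresentation, and the counit on the first leg gives x_j = sum_k epsilon(x_k) u_kj, a
  combination of matrix coefficients.\<close>

lemma coefs_span: "vs.span coefs = UNIV"
proof -
  have "a \<in> vs.span coefs" for a
  proof -
    \<comment> \<open>V lies in the span of the first components of \<open>\<Delta> a\<close>, is
      closed under slicing by coassociativity, and contains a by the counit axiom.\<close>
    define V where "V = {rslice \<phi> a |\<phi>. clin \<iota> \<phi>}"
    have Vspan: "V \<subseteq> vs.span (fst ` set (\<Delta> a))"
    proof -
      have "set xs \<subseteq> set (\<Delta> a) \<Longrightarrow> sum_list (map (\<lambda>(a, b). \<iota> (\<phi> b) * a) xs) \<in> vs.span (fst ` set (\<Delta> a))" for \<phi> xs
      proof (induction xs)
        case (Cons x xs)
        have "sc \<iota> (\<phi> (snd x)) (fst x) \<in> vs.span (fst ` set (\<Delta> a))"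
          using Cons.prems by (intro vs.span_scale vs.span_base) auto
        then have "\<iota> (\<phi> (snd x)) * fst x \<in> vs.span (fst ` set (\<Delta> a))" by (simp only: sc_def[of \<iota> "\<phi> (snd x)" "fst x"])
        from vs.span_add[OF this Cons.IH] Cons.prems show ?case by (simp add: split_def)
      qed (simp add: vs.span_zero)
      then show ?thesis by (auto simp: V_def rslice_def)
    qed
    have Vinv: "rslice \<psi> x \<in> V" if "x \<in> V" "clin \<iota> \<psi>" for x \<psi>
    proof -
      obtain \<phi> where \<phi>: "clin \<iota> \<phi>" "x = rslice \<phi> a" using \<open>x \<in> V\<close> by (auto simp: V_def)
      have "rslice \<psi> (rslice \<phi> a) = rslice (conv \<psi> \<phi>) a"
      proof (rule functionals_separate)
        fix \<chi> assume "clin \<iota> \<chi>"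
        then show "\<chi> (rslice \<psi> (rslice \<phi> a)) = \<chi> (rslice (conv \<psi> \<phi>) a)"
          using \<phi>(1) \<open>clin \<iota> \<psi>\<close> by (simp add: clin_rslice clin_conv conv_assoc)
      qed
      then show ?thesis using \<phi> \<open>clin \<iota> \<psi>\<close> clin_conv by (auto simp: V_def)
    qed
    have aV: "a \<in> V" using clin_eps unfolding V_def by (intro CollectI exI[of _ \<epsilon>]) simp
    obtain X where X: "X \<subseteq> V" "vs.independent X" "V \<subseteq> vs.span X"
      using vs.maximal_independent_subset by blast
    have finX: "finite X"
      using vs.independent_span_bound[OF _ X(2), of "fst ` set (\<Delta> a)"] X(1) Vspan by blast
    obtain x where x: "bij_betw x {0..<card X} X" using ex_bij_betw_nat_finite[OF finX] by blast
    define m where "m = card X"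
    have ximg: "X = x ` {..<m}" using x by (simp add: bij_betw_def m_def lessThan_atLeast0)
    have xX: "x j \<in> X" if "j < m" for j using x that by (auto simp: bij_betw_def m_def)
    have xinj: "x j = x k \<longleftrightarrow> j = k" if "j < m" "k < m" for j k
      using x that by (auto simp: bij_betw_def m_def inj_on_def)
    obtain f where f: "\<forall>b. clin \<iota> (f b)" "\<forall>b\<in>X. \<forall>c\<in>X. f b c = (if b = c then 1 else 0)"
      using dual_functionals[OF X(2)] by (elim exE conjE)
    define \<xi> where "\<xi> k = f (x k)" for k
    have \<xi>: "clin \<iota> (\<xi> k)" for k using f(1) by (simp add: \<xi>_def)
    have \<xi>x: "\<xi> k (x j) = (if k = j then 1 else 0)" if "k < m" "j < m" for k j
      using that f(2) xX xinj by (simp add: \<xi>_def)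
    have exp: "\<phi> v = (\<Sum>k<m. \<phi> (x k) * \<xi> k v)" if "clin \<iota> \<phi>" "v \<in> V" for \<phi> v
    proof (rule clin_eq_on_span[OF \<open>clin \<iota> \<phi>\<close>, of _ X])
      show "clin \<iota> (\<lambda>v. \<Sum>k<m. \<phi> (x k) * \<xi> k v)" by (rule clin_sum_fun) (rule \<xi>)
      show "v \<in> vs.span X" using X(3) that by blast
      fix y assume "y \<in> X"
      then obtain j where j: "j < m" "y = x j" unfolding ximg by blast
      have "(\<Sum>k<m. \<phi> (x k) * \<xi> k y) = (\<Sum>k<m. if k = j then \<phi> (x k) else 0)"
        using j \<xi>x by (intro sum.cong) auto
      then show "\<phi> y = (\<Sum>k<m. \<phi> (x k) * \<xi> k y)" using j by simp
    qed
    \<comment> \<open>With xi the coordinates dual to x, this matrix is forced by the wish that x_j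
      have coproduct sum_k x_k (x) u_kj; \<open>cx\<close> is that formula under a pair of
      functionals.\<close>
    define u where "u = mtrunc m m (\<lambda>k j. lslice (\<xi> k) (x j))"
    have \<psi>u: "\<psi> (u k j) = conv (\<xi> k) \<psi> (x j)" if "k < m" "j < m" "clin \<iota> \<psi>" for k j \<psi>
      using that by (simp add: u_def mtrunc_def clin_lslice)
    have cx: "conv \<phi> \<psi> (x j) = (\<Sum>k<m. \<phi> (x k) * \<psi> (u k j))" if "clin \<iota> \<phi>" "clin \<iota> \<psi>" "j < m" for \<phi> \<psi> j
    proof -
      have "conv \<phi> \<psi> (x j) = \<phi> (rslice \<psi> (x j))" using that by (simp add: clin_rslice)
      also have "\<dots> = (\<Sum>k<m. \<phi> (x k) * \<xi> k (rslice \<psi> (x j)))"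
        using that X(1) xX by (intro exp Vinv) auto
      also have "\<dots> = (\<Sum>k<m. \<phi> (x k) * \<psi> (u k j))"
        using that \<xi> by (intro sum.cong) (auto simp: clin_rslice \<psi>u)
      finally show ?thesis .
    qed
    have "crep m u"
      unfolding crep_def
    proof (intro conjI allI impI)
      show us: "msupp m m u" by (simp add: u_def)
      show "mmap \<epsilon> u = mone m"
      proof (rule msupp_eqI[of m m])
        show "msupp m m (mmap \<epsilon> u)" using us clin_eps by auto
        fix k j assume "k < m" "j < m"
        then show "mmap \<epsilon> u k j = mone m k j"
          using \<xi> by (simp add: mmap_def \<psi>u clin_eps \<xi>x mone_def)
      qed auto
      fix \<phi> \<psi> assume c: "clin \<iota> \<phi>" "clin \<iota> \<psi>"
      show "mmap (conv \<phi> \<psi>) u = mmul m (mmap \<phi> u) (mmap \<psi> u)"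
      proof (rule msupp_eqI[of m m])
        show "msupp m m (mmap (conv \<phi> \<psi>) u)" using us clin_conv[OF c] by auto
        show "msupp m m (mmul m (mmap \<phi> u) (mmap \<psi> u))" using us c by auto
        fix k j assume kj: "k < m" "j < m"
        have "conv \<phi> \<psi> (u k j) = conv (conv (\<xi> k) \<phi>) \<psi> (x j)"
          using c \<xi> kj by (simp add: \<psi>u clin_conv conv_assoc)
        also have "\<dots> = (\<Sum>l<m. conv (\<xi> k) \<phi> (x l) * \<psi> (u l j))"
          using c \<xi> kj by (intro cx) (auto intro: clin_conv)
        also have "\<dots> = (\<Sum>l<m. \<phi> (u k l) * \<psi> (u l j))"
          using c kj by (intro sum.cong) (auto simp: \<psi>u)
        finally show "mmap (conv \<phi> \<psi>) u k j = mmul m (mmap \<phi> u) (mmap \<psi> u) k j"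
          by (simp add: mmap_def mmul_def)
      qed
    qed
    then have uspan: "u k j \<in> vs.span coefs" for k j by (rule matrix_coefficients_in_span)
    have "x j \<in> vs.span coefs" if j: "j < m" for j
    proof -
      have "x j = (\<Sum>k<m. sc \<iota> (\<epsilon> (x k)) (u k j))"
      proof (rule functionals_separate)
        fix \<psi> assume c: "clin \<iota> \<psi>"
        have "\<psi> (x j) = conv \<epsilon> \<psi> (x j)" using c by simp
        also have "\<dots> = \<psi> (\<Sum>k<m. sc \<iota> (\<epsilon> (x k)) (u k j))"
          using c j cx[OF clin_eps c j] by (simp add: clin_sum clin_scale sc_def)
        finally show "\<psi> (x j) = \<psi> (\<Sum>k<m. sc \<iota> (\<epsilon> (x k)) (u k j))" .
      qed
      also have "\<dots> \<in> vs.span coefs" by (intro vs.span_sum vs.span_scale uspan)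
      finally show ?thesis .
    qed
    then have "X \<subseteq> vs.span coefs" unfolding ximg by blast
    then have "vs.span X \<subseteq> vs.span coefs" by (rule vs.span_minimal) (rule vs.subspace_span)
    then show ?thesis using aV X(3) by blast
  qed
  then show ?thesis by blast
qed

text \<open>For s = (L, i) this embeds the comodule L into A through row i of its representative; v
  holds the coordinates.\<close>

definition rowval :: "(nat \<times> (nat \<Rightarrow> nat \<Rightarrow> 'a)) set \<times> nat \<Rightarrow> (nat \<Rightarrow> complex) \<Rightarrow> 'a" where
  "rowval s v = (\<Sum>j<cdim (fst s). \<iota> (v j) * rep (fst s) (snd s) j)"

text \<open>The action of the dual algebra on the comodule L; by \<open>conv_rowval\<close> it
  corresponds under \<open>rowval\<close> to right slicing in A.\<close>

definition act :: "('a \<Rightarrow> complex) \<Rightarrow> (nat \<times> (nat \<Rightarrow> nat \<Rightarrow> 'a)) set \<times> nat \<Rightarrow> (nat \<Rightarrow> complex) \<Rightarrow> nat \<Rightarrow> complex" where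
  "act \<phi> s v = mv (cdim (fst s)) (mmap \<phi> (rep (fst s))) v"

lemma clin_rowval: "clin \<iota> \<psi> \<Longrightarrow> \<psi> (rowval s v) = (\<Sum>j<cdim (fst s). v j * \<psi> (rep (fst s) (snd s) j))"
  by (simp add: rowval_def clin_sum clin_scale)

lemma rowval_zero [simp]: "rowval s (\<lambda>_. 0) = 0"
  by (simp add: rowval_def)

lemma rowval_add: "rowval s (\<lambda>i. v i + w i) = rowval s v + rowval s w"
  by (simp add: rowval_def iota_add distrib_right sum.distrib)

lemma rowval_scale: "rowval s (\<lambda>i. c * v i) = \<iota> c * rowval s v"
  by (simp add: rowval_def iota_mult sum_distrib_left mult.assoc)

lemma rowval_sum: "rowval s (\<lambda>i. \<Sum>l<(k::nat). c l * f l i) = (\<Sum>l<k. \<iota> (c l) * rowval s (f l))"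
  by (induction k) (simp_all add: rowval_add rowval_scale)

lemma eps_rowval:
  assumes "fst s \<in> Irr" "snd s < cdim (fst s)"
  shows "\<epsilon> (rowval s v) = v (snd s)"
proof -
  have "\<epsilon> (rep (fst s) (snd s) j) = mone (cdim (fst s)) (snd s) j" for j
    using crepD(2)[OF rep(4)[OF assms(1)]] by (auto simp: mmap_def fun_eq_iff)
  then have "\<epsilon> (rowval s v) = (\<Sum>j<cdim (fst s). if j = snd s then v j else 0)"
    unfolding clin_rowval[OF clin_eps] using assms by (intro sum.cong) (auto simp: mone_def)
  then show ?thesis using assms by simp
qed

lemma conv_rowval:
  assumes s: "fst s \<in> Irr" and c: "clin \<iota> \<psi>" "clin \<iota> \<phi>"
  shows "conv \<psi> \<phi> (rowval s v) = \<psi> (rowval s (act \<phi> s v))"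
proof -
  define d where "d = cdim (fst s)"
  define a where "a = rep (fst s)"
  have a: "conv \<psi> \<phi> (a i j) = (\<Sum>k<d. \<psi> (a i k) * \<phi> (a k j))" for i j
    using crepD(3)[OF rep(4)[OF s] c] by (auto simp: mmap_def mmul_def fun_eq_iff a_def d_def)
  have "conv \<psi> \<phi> (rowval s v) = (\<Sum>j<d. \<Sum>k<d. v j * (\<psi> (a (snd s) k) * \<phi> (a k j)))"
    unfolding clin_rowval[OF clin_conv[OF c]] d_def[symmetric] a_def[symmetric] a by (simp add: sum_distrib_left)
  also have "\<dots> = (\<Sum>k<d. \<Sum>j<d. v j * (\<psi> (a (snd s) k) * \<phi> (a k j)))" by (rule sum.swap)
  also have "\<dots> = \<psi> (rowval s (act \<phi> s v))"
    unfolding clin_rowval[OF c(1)] d_def[symmetric] a_def[symmetric]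
    by (simp add: act_def mv_def mmap_def sum_distrib_left sum_distrib_right mult_ac flip: d_def a_def)
  finally show ?thesis .
qed

text \<open>Right slicing a relation between rows gives a relation again, so the relations form a
  module over the dual algebra and irreducibility can be applied to them.\<close>

lemma relation_act:
  assumes S: "\<forall>s\<in>S. fst s \<in> Irr" and c: "clin \<iota> \<phi>" and rel: "(\<Sum>s\<in>S. rowval s (v s)) = 0"
  shows "(\<Sum>s\<in>S. rowval s (act \<phi> s (v s))) = 0"
proof (rule functionals_separate)
  fix \<psi> assume \<psi>: "clin \<iota> \<psi>"
  have "\<psi> (\<Sum>s\<in>S. rowval s (act \<phi> s (v s))) = (\<Sum>s\<in>S. conv \<psi> \<phi> (rowval s (v s)))"
    unfolding clin_sum[OF \<psi>] using S \<psi> c by (intro sum.cong) (auto simp: conv_rowval)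
  also have "\<dots> = conv \<psi> \<phi> (\<Sum>s\<in>S. rowval s (v s))" using \<psi> c by (simp add: clin_sum clin_conv)
  also have "\<dots> = 0" unfolding rel by (rule clin_0[OF clin_conv[OF \<psi> c]])
  finally show "\<psi> (\<Sum>s\<in>S. rowval s (act \<phi> s (v s))) = \<psi> 0" using \<psi> by simp
qed

lemma act_vecs: "fst s \<in> Irr \<Longrightarrow> clin \<iota> \<phi> \<Longrightarrow> act \<phi> s v \<in> vecs (cdim (fst s))"
  unfolding act_def by (rule mv_vecs[OF msupp_mmap_clin[OF rep(5)]])

text \<open>A row of an irreducible corepresentation spans a copy of that comodule in \<open>A\<close>. If a new
  row met the sum of the previous ones, it would be contained in it by irreducibility; the coordinates
  would be intertwiners, and applying the counit would contradict Schur's lemma.\<close>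

lemma rows_independent:
  assumes "finite S" "\<forall>s\<in>S. fst s \<in> Irr \<and> snd s < cdim (fst s)"
    "\<forall>s\<in>S. v s \<in> vecs (cdim (fst s))" "(\<Sum>s\<in>S. rowval s (v s)) = 0"
  shows "\<forall>s\<in>S. v s = (\<lambda>_. 0)"
  using assms
proof (induction S arbitrary: v rule: finite_induct)
  case (insert s0 S)
  define S1 where "S1 = insert s0 S"
  have S1: "\<forall>s\<in>S1. fst s \<in> Irr" "finite S1" using insert.prems(1) insert.hyps(1) by (auto simp: S1_def)
  have s0: "fst s0 \<in> Irr" "snd s0 < cdim (fst s0)" using insert.prems(1) by auto
  define d where "d = cdim (fst s0)"
  \<comment> \<open>All relations between the rows in \<open>S1\<close>, each as a family of
    coordinate vectors. By induction a relation with zero vector at s0 vanishes on S, so a relation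
    is determined by its vector at s0.\<close>
  define R where "R = {v. (\<forall>s\<in>S1. v s \<in> vecs (cdim (fst s))) \<and> (\<Sum>s\<in>S1. rowval s (v s)) = 0}"
  have IH: "\<forall>s\<in>S. v s = (\<lambda>_. 0)" if "v \<in> R" "v s0 = (\<lambda>_. 0)" for v
  proof (rule insert.IH)
    show "(\<Sum>s\<in>S. rowval s (v s)) = 0" using that insert(1,2) by (simp add: R_def S1_def)
  qed (use that insert.prems in \<open>auto simp: R_def S1_def\<close>)
  \<comment> \<open>The vectors occurring at s0 form an invariant subspace. If it is zero the
    induction step is done; otherwise every vector occurs and a contradiction is derived.\<close>
  define W where "W = (\<lambda>v. v s0) ` R"
  have Wsub: "lin_sub d W"
    unfolding lin_sub_def
  proof (intro conjI ballI allI)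
    show "W \<subseteq> vecs d" by (auto simp: W_def R_def S1_def d_def)
    have "(\<lambda>_ _. 0) \<in> R" by (simp add: R_def vecs_def)
    then show "(\<lambda>_. 0) \<in> W" unfolding W_def by (rule rev_image_eqI) simp
    fix v w assume "v \<in> W" "w \<in> W"
    then obtain v' w' where vw: "v' \<in> R" "w' \<in> R" "v = v' s0" "w = w' s0" by (auto simp: W_def)
    have "(\<lambda>s i. v' s i + w' s i) \<in> R" using vw by (auto simp: R_def vecs_def rowval_add sum.distrib)
    then show "(\<lambda>i. v i + w i) \<in> W" unfolding W_def by (rule rev_image_eqI) (simp add: vw)
  next
    fix c v assume "v \<in> W"
    then obtain v' where v: "v' \<in> R" "v = v' s0" by (auto simp: W_def)
    have "(\<lambda>s i. c * v' s i) \<in> R" using v by (auto simp: R_def vecs_def rowval_scale simp flip: sum_distrib_left)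
    then show "(\<lambda>i. c * v i) \<in> W" unfolding W_def by (rule rev_image_eqI) (simp add: v)
  qed
  have Ract: "(\<lambda>s. act \<phi> s (v s)) \<in> R" if "v \<in> R" "clin \<iota> \<phi>" for v \<phi>
    using that S1 relation_act[OF S1(1) that(2)] by (auto simp: R_def intro: act_vecs)
  have "W = {\<lambda>_. 0} \<or> W = vecs d"
    unfolding d_def
  proof (rule irred_lin_sub[OF rep(4,2)[OF s0(1)] Wsub[unfolded d_def]])
    fix w \<phi> assume "w \<in> W" "clin \<iota> \<phi>"
    then obtain v where "v \<in> R" "w = v s0" by (auto simp: W_def)
    then show "mv (cdim (fst s0)) (mmap \<phi> (rep (fst s0))) w \<in> W"
      unfolding W_def using Ract[OF _ \<open>clin \<iota> \<phi>\<close>] by (intro rev_image_eqI) (auto simp: act_def)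
  qed
  moreover have "W \<noteq> vecs d"
  proof
    assume W: "W = vecs d"
    have "\<exists>v\<in>R. v s0 = (\<lambda>i. mone d i k)" for k
    proof -
      have "(\<lambda>i. mone d i k) \<in> W" unfolding W by (auto simp: vecs_def mone_def)
      then show ?thesis by (auto simp: W_def)
    qed
    \<comment> \<open>\<open>g k\<close> is a relation whose vector at s0 is the k-th standard basis
      vector.\<close>
    then obtain g where g: "\<And>k. g k \<in> R" "\<And>k. g k s0 = (\<lambda>i. mone d i k)" by metis
    have zero: "g k s p = 0" if s: "s \<in> S" and k: "k < d" and ne: "(fst s, p) \<noteq> (fst s0, k)" for s p k
    proof -
      define e where "e = cdim (fst s)"
      define T where "T = (\<lambda>p k. if k < d then g k s p else 0)"
      have sI: "fst s \<in> Irr" using insert.prems s by auto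
      have gs: "g k s \<in> vecs e" for k using g(1)[of k] s by (auto simp: R_def S1_def e_def)
      have T: "msupp e d T" using gs by (auto simp: T_def msupp_def vecs_def)
      have int: "mmul d (imat T) (rep (fst s0)) = mmul e (rep (fst s)) (imat T)"
      proof (rule matrix_eqI)
        fix \<phi> assume \<phi>: "clin \<iota> \<phi>"
        have "mmul d T (mmap \<phi> (rep (fst s0))) = mmul e (mmap \<phi> (rep (fst s))) T"
        proof (rule msupp_eqI[of e d])
          show "msupp e d (mmul d T (mmap \<phi> (rep (fst s0))))"
            using T rep(5)[OF s0(1)] \<phi> by (auto simp: d_def)
          show "msupp e d (mmul e (mmap \<phi> (rep (fst s))) T)"
            using T rep(5)[OF sI] \<phi> by (auto simp: e_def)
          fix q j assume q: "q < e" and j: "j < d"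
          define c where "c l = - \<phi> (rep (fst s0) l j)" for l
          \<comment> \<open>Acting by phi on \<open>g j\<close> and combining the \<open>g l\<close>
            with the coefficients phi(a_lj) give relations with the same vector at s0. Their
            difference r therefore vanishes on S, and this is the intertwining property of
            T.\<close>
          define r where "r = (\<lambda>s i. act \<phi> s (g j s) i + (\<Sum>l<d. c l * g l s i))"
          have "(\<Sum>s\<in>S1. rowval s (r s)) =
              (\<Sum>s\<in>S1. rowval s (act \<phi> s (g j s))) + (\<Sum>l<d. \<iota> (c l) * (\<Sum>s\<in>S1. rowval s (g l s)))"
            unfolding r_def rowval_add rowval_sum sum.distrib sum_distrib_left by (subst (2) sum.swap) (rule refl)
          also have "\<dots> = 0" using g(1) Ract[OF g(1) \<phi>] by (simp add: R_def)
          finally have "r \<in> R"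
            using g(1) Ract[OF g(1) \<phi>, of j] by (auto simp: R_def r_def vecs_def)
          moreover have "r s0 = (\<lambda>_. 0)"
          proof
            fix i
            have "(\<Sum>l<d. c l * g l s0 i) = (\<Sum>l<d. if l = i then c l else 0)"
              using g(2) by (intro sum.cong) (auto simp: mone_def)
            also have "\<dots> = - \<phi> (rep (fst s0) i j)"
              using rep(5)[OF s0(1)] \<phi> by (auto simp: c_def d_def msupp_def)
            finally show "r s0 i = 0"
              using j by (simp add: r_def act_def g(2) mv_column mmap_def flip: d_def)
          qed
          ultimately have "r s = (\<lambda>_. 0)" using IH s by blast
          then have "r s q = 0" by simp
          then have "act \<phi> s (g j s) q = (\<Sum>l<d. \<phi> (rep (fst s0) l j) * g l s q)"
            by (simp add: r_def c_def sum_negf)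
          then show "mmul d T (mmap \<phi> (rep (fst s0))) q j = mmul e (mmap \<phi> (rep (fst s))) T q j"
            using j by (simp add: mmul_def mmap_def T_def act_def mv_def mult.commute flip: e_def)
        qed
        then show "mmap \<phi> (mmul d (imat T) (rep (fst s0))) = mmap \<phi> (mmul e (rep (fst s)) (imat T))"
          using \<phi> by (simp add: mmap_mmul_imat_left mmap_mmul_imat_right)
      qed
      have "T p k = 0"
        by (rule rep_intertwiner[OF s0(1) sI T[unfolded d_def e_def] int[unfolded d_def e_def] ne])
      then show ?thesis using k by (simp add: T_def)
    qed
    \<comment> \<open>The counit of a row element is its coordinate at the row index. Row s0
      contributes 1 and the other rows contribute 0 by Schur's lemma, since none of them equals
      s0.\<close>
    have "0 = \<epsilon> (\<Sum>s\<in>S1. rowval s (g (snd s0) s))" using g(1) clin_0[OF clin_eps] by (simp add: R_def)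
    also have "\<dots> = (\<Sum>s\<in>S1. g (snd s0) s (snd s))"
      unfolding clin_sum[OF clin_eps] using insert.prems by (intro sum.cong) (auto simp: S1_def eps_rowval)
    also have "\<dots> = 1 + (\<Sum>s\<in>S. g (snd s0) s (snd s))"
      using insert.hyps s0 by (simp add: S1_def g(2) mone_def d_def)
    also have "(\<Sum>s\<in>S. g (snd s0) s (snd s)) = 0"
      using insert(2) s0 by (intro sum.neutral ballI zero) (auto simp: d_def prod_eq_iff)
    finally show False by simp
  qed
  ultimately have W0: "W = {\<lambda>_. 0}" by blast
  have v: "v \<in> R" using insert.prems by (simp add: R_def S1_def)
  then have "v s0 = (\<lambda>_. 0)" using W0 by (auto simp: W_def)
  then show ?case using IH[OF v] by simp
qed simp

text \<open>Collecting the terms of the relation that belong to the same row (L, i) turns it into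
  one for \<open>rows_independent\<close>.\<close>

lemma coefs_relation:
  assumes F: "finite F" "F \<subseteq> (SIGMA L:Irr. {..<cdim L} \<times> {..<cdim L})"
    and rel: "(\<Sum>x\<in>F. sc \<iota> (c x) (case x of (L, i, j) \<Rightarrow> rep L i j)) = 0"
  shows "\<forall>x\<in>F. c x = 0"
proof -
  define S where "S = (\<lambda>(L, i, j). (L, i)) ` F"
  define v where "v s j = (if (fst s, snd s, j) \<in> F then c (fst s, snd s, j) else 0)" for s j
  have S: "finite S" "\<forall>s\<in>S. fst s \<in> Irr \<and> snd s < cdim (fst s)" using F by (auto simp: S_def)
  have v: "\<forall>s\<in>S. v s \<in> vecs (cdim (fst s))" using F(2) by (auto simp: v_def vecs_def)
  have "(\<Sum>x\<in>F. sc \<iota> (c x) (case x of (L, i, j) \<Rightarrow> rep L i j)) =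
      (\<Sum>s\<in>S. \<Sum>x\<in>{x\<in>F. (case x of (L, i, j) \<Rightarrow> (L, i)) = s}. sc \<iota> (c x) (case x of (L, i, j) \<Rightarrow> rep L i j))"
    unfolding S_def by (rule sum.image_gen[OF F(1)])
  also have "\<dots> = (\<Sum>s\<in>S. rowval s (v s))"
  proof (intro sum.cong refl)
    fix s assume "s \<in> S"
    define J where "J = {j. (fst s, snd s, j) \<in> F}"
    have J: "J \<subseteq> {..<cdim (fst s)}" using F(2) by (auto simp: J_def)
    have "{x\<in>F. (case x of (L, i, j) \<Rightarrow> (L, i)) = s} = (\<lambda>j. (fst s, snd s, j)) ` J"
      by (auto simp: J_def image_iff)
    then have "(\<Sum>x\<in>{x\<in>F. (case x of (L, i, j) \<Rightarrow> (L, i)) = s}. sc \<iota> (c x) (case x of (L, i, j) \<Rightarrow> rep L i j)) =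
        (\<Sum>j\<in>J. sc \<iota> (c (fst s, snd s, j)) (rep (fst s) (snd s) j))"
      by (simp add: sum.reindex inj_on_def)
    also have "\<dots> = rowval s (v s)"
      unfolding rowval_def using J by (intro sum.mono_neutral_cong_left) (auto simp: J_def v_def sc_def)
    finally show "(\<Sum>x\<in>{x\<in>F. (case x of (L, i, j) \<Rightarrow> (L, i)) = s}. sc \<iota> (c x) (case x of (L, i, j) \<Rightarrow> rep L i j)) = rowval s (v s)" .
  qed
  finally have "(\<Sum>s\<in>S. rowval s (v s)) = 0" using rel by simp
  from rows_independent[OF S v this] have v0: "\<forall>s\<in>S. v s = (\<lambda>_. 0)" .
  show ?thesis
  proof
    fix x assume x: "x \<in> F"
    obtain L i j where Lij: "x = (L, i, j)" by (cases x)
    have "(L, i) \<in> S" using x by (force simp: S_def Lij)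
    then have "v (L, i) j = 0" using v0 by simp
    then show "c x = 0" using x by (simp add: v_def Lij)
  qed
qed

lemma coefs_inj: "inj_on (\<lambda>(L, i, j). rep L i j) (SIGMA L:Irr. {..<cdim L} \<times> {..<cdim L})"
  and coefs_independent: "vs.independent coefs"
  unfolding coefs_def by (intro vs.independent_familyI; rule coefs_relation; assumption)+

lemma coordinate_functionals:
  "\<exists>X. (\<forall>L i j. clin \<iota> (X L i j)) \<and>
    (\<forall>L\<in>Irr. \<forall>L'\<in>Irr. \<forall>i<cdim L. \<forall>j<cdim L. \<forall>k<cdim L'. \<forall>l<cdim L'.
      X L i j (rep L' k l) = (if L = L' \<and> i = k \<and> j = l then 1 else 0))"
proof -
  obtain f where f: "\<forall>b. clin \<iota> (f b)" "\<forall>b\<in>coefs. \<forall>c\<in>coefs. f b c = (if b = c then 1 else 0)"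
    using dual_functionals[OF coefs_independent] by (elim exE conjE)
  have mem: "rep L i j \<in> coefs" if "L \<in> Irr" "i < cdim L" "j < cdim L" for L i j
    unfolding coefs_def using that by (intro image_eqI[of _ _ "(L, i, j)"]) auto
  have eq: "rep L i j = rep L' k l \<longleftrightarrow> L = L' \<and> i = k \<and> j = l"
    if "L \<in> Irr" "i < cdim L" "j < cdim L" "L' \<in> Irr" "k < cdim L'" "l < cdim L'" for L i j L' k l
    using inj_onD[OF coefs_inj, of "(L, i, j)" "(L', k, l)"] that by auto
  show ?thesis
    by (rule exI[of _ "\<lambda>L i j. f (rep L i j)"]) (use f mem eq in auto)
qed

end

section \<open>Galois extensions\<close>

locale galois_extension = unitarizable_hopf \<iota> st \<Delta> \<epsilon>
  for \<iota> :: "complex \<Rightarrow> 'a::ring_1" and st \<Delta> \<epsilon> +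
  fixes \<iota>Z :: "complex \<Rightarrow> 'z::ring_1" and stZ :: "'z \<Rightarrow> 'z"
    and \<alpha> :: "'z \<Rightarrow> ('a \<times> 'z) list" and \<mu> :: "'z \<Rightarrow> complex"
  assumes galois: "star_galois \<iota> st \<Delta> \<epsilon> \<iota>Z stZ \<alpha>"
    and haar: "pos_haar \<iota> \<iota>Z stZ \<alpha> \<mu>"
begin

sublocale Z: star_algebra \<iota>Z stZ
  using galois by unfold_locales (simp add: star_galois_def)

text \<open>The slice (phi (x) id) of the coaction. It is an element of Z, so statements about the
  coaction become equations in Z instead of equivalences of lists.\<close>

definition sl :: "('a \<Rightarrow> complex) \<Rightarrow> 'z \<Rightarrow> 'z" where
  "sl \<phi> z = sum_list (map (\<lambda>(a, w). \<iota>Z (\<phi> a) * w) (\<alpha> z))"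

lemma clin_sl: "clin \<iota>Z \<psi> \<Longrightarrow> \<psi> (sl \<phi> z) = tev \<phi> \<psi> (\<alpha> z)"
  by (simp add: sl_def tev_def Z.clin_sum_list Z.clin_scale split_def)

lemma clin_tev_coaction:
  assumes c: "clin \<iota> \<phi>" "clin \<iota>Z \<psi>"
  shows "clin \<iota>Z (\<lambda>z. tev \<phi> \<psi> (\<alpha> z))"
proof -
  have "teq \<iota> \<iota>Z (\<alpha> (x + y)) (\<alpha> x @ \<alpha> y)" for x y
    using galois unfolding star_galois_def by blast
  then have "tev \<phi> \<psi> (\<alpha> (x + y)) = tev \<phi> \<psi> (\<alpha> x) + tev \<phi> \<psi> (\<alpha> y)" for x y
    using c by (simp add: teq_def tev_append)
  moreover have "tev \<phi> \<psi> (\<alpha> (\<iota>Z r * x)) = r * tev \<phi> \<psi> (\<alpha> x)" for r x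
  proof -
    have "tev \<phi> \<psi> (map (\<lambda>(a, b). (\<iota> r * a, b)) xs) = r * tev \<phi> \<psi> xs" for xs
      by (induction xs) (auto simp: tev_def clin_scale[OF c(1)] algebra_simps)
    moreover have "teq \<iota> \<iota>Z (\<alpha> (\<iota>Z r * x)) (map (\<lambda>(a, z). (\<iota> r * a, z)) (\<alpha> x))"
      using galois unfolding star_galois_def by blast
    ultimately show ?thesis using c by (simp add: teq_def)
  qed
  ultimately show ?thesis by (simp add: clin_def)
qed

lemma sl_add: "clin \<iota> \<phi> \<Longrightarrow> sl \<phi> (x + y) = sl \<phi> x + sl \<phi> y"
  by (rule Z.functionals_separate) (simp add: clin_sl Z.clin_add Z.clin_add[OF clin_tev_coaction])

lemma sl_scale: "clin \<iota> \<phi> \<Longrightarrow> sl \<phi> (\<iota>Z c * x) = \<iota>Z c * sl \<phi> x"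
  by (rule Z.functionals_separate) (simp add: clin_sl Z.clin_scale Z.clin_scale[OF clin_tev_coaction])

lemma sl_0 [simp]: "clin \<iota> \<phi> \<Longrightarrow> sl \<phi> 0 = 0"
  using sl_scale[of \<phi> 0 0] by simp

lemma sl_sum: "clin \<iota> \<phi> \<Longrightarrow> sl \<phi> (sum f F) = (\<Sum>i\<in>F. sl \<phi> (f i))"
  by (induction F rule: infinite_finite_induct) (auto simp: sl_add)

lemma sl_sum_fun: "sl (\<lambda>a. \<Sum>i\<in>F. c i * f i a) z = (\<Sum>i\<in>F. \<iota>Z (c i) * sl (f i) z)"
proof (rule Z.functionals_separate)
  fix \<psi> assume \<psi>: "clin \<iota>Z \<psi>"
  have "tev (\<lambda>a. \<Sum>i\<in>F. c i * f i a) \<psi> xs = (\<Sum>i\<in>F. c i * tev (f i) \<psi> xs)" for xs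
    by (induction xs) (auto simp: tev_def sum.distrib sum_distrib_right distrib_left mult.assoc)
  then show "\<psi> (sl (\<lambda>a. \<Sum>i\<in>F. c i * f i a) z) = \<psi> (\<Sum>i\<in>F. \<iota>Z (c i) * sl (f i) z)"
    using \<psi> by (simp add: clin_sl Z.clin_sum Z.clin_scale)
qed

lemma sl_eps [simp]: "sl \<epsilon> z = z"
  using galois unfolding star_galois_def sl_def by blast

text \<open>Coassociativity of the coaction, seen from the dual algebra.\<close>

lemma sl_sl:
  assumes c: "clin \<iota> \<phi>" "clin \<iota> \<psi>"
  shows "sl \<psi> (sl \<phi> z) = sl (conv \<phi> \<psi>) z"
proof (rule Z.functionals_separate)
  fix \<chi> assume \<chi>: "clin \<iota>Z \<chi>"
  have "\<chi> (sl \<psi> (sl \<phi> z)) = tev \<phi> (\<lambda>z. tev \<psi> \<chi> (\<alpha> z)) (\<alpha> z)"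
    using clin_sl[OF clin_tev_coaction[OF c(2) \<chi>], of \<phi> z] clin_sl[OF \<chi>, of \<psi> "sl \<phi> z"] by simp
  also have "\<dots> = tev (conv \<phi> \<psi>) \<chi> (\<alpha> z)"
  proof -
    have "\<forall>x \<phi> \<psi> \<chi>. clin \<iota> \<phi> \<and> clin \<iota> \<psi> \<and> clin \<iota>Z \<chi> \<longrightarrow>
        sum_list (map (\<lambda>(a, z). tev \<phi> \<psi> (\<Delta> a) * \<chi> z) (\<alpha> x))
      = sum_list (map (\<lambda>(a, z). \<phi> a * tev \<psi> \<chi> (\<alpha> z)) (\<alpha> x))"
      using galois unfolding star_galois_def by (elim conjE)
    then show ?thesis using c \<chi> by (simp add: tev_def[of _ _ "\<alpha> z"] conv_def)
  qed
  finally show "\<chi> (sl \<psi> (sl \<phi> z)) = \<chi> (sl (conv \<phi> \<psi>) z)" using \<chi> by (simp add: clin_sl)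
qed

subsection \<open>Coactions given by explicit tensors\<close>

text \<open>Says that the coaction of z is the tensor sum_{k<n} a_k (x) w_k, tested on
  slices.\<close>

definition co :: "nat \<Rightarrow> 'z \<Rightarrow> (nat \<Rightarrow> 'a) \<Rightarrow> (nat \<Rightarrow> 'z) \<Rightarrow> bool" where
  "co n z a w \<longleftrightarrow> (\<forall>\<phi>. clin \<iota> \<phi> \<longrightarrow> sl \<phi> z = (\<Sum>k<n. \<iota>Z (\<phi> (a k)) * w k))"

lemma co_tev: "co n z a w \<Longrightarrow> clin \<iota> \<phi> \<Longrightarrow> clin \<iota>Z \<psi> \<Longrightarrow> tev \<phi> \<psi> (\<alpha> z) = (\<Sum>k<n. \<phi> (a k) * \<psi> (w k))"
  by (simp add: co_def Z.clin_sum Z.clin_scale flip: clin_sl)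

lemma coI:
  assumes "\<And>\<phi> \<psi>. clin \<iota> \<phi> \<Longrightarrow> clin \<iota>Z \<psi> \<Longrightarrow> tev \<phi> \<psi> (\<alpha> z) = (\<Sum>k<n. \<phi> (a k) * \<psi> (w k))"
  shows "co n z a w"
  unfolding co_def
proof (intro allI impI Z.functionals_separate)
  fix \<phi> \<psi> assume "clin \<iota> \<phi>" "clin \<iota>Z \<psi>"
  then show "\<psi> (sl \<phi> z) = \<psi> (\<Sum>k<n. \<iota>Z (\<phi> (a k)) * w k)"
    using assms by (simp add: clin_sl Z.clin_sum Z.clin_scale)
qed

lemma co_teq: "co n z a w \<Longrightarrow> teq \<iota> \<iota>Z (\<alpha> z) (map (\<lambda>k. (a k, w k)) [0..<n])"
  unfolding teq_def by (simp add: co_tev tev_map_upt)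

lemma co_star:
  assumes "co n z a w"
  shows "co n (stZ z) (\<lambda>k. st (a k)) (\<lambda>k. stZ (w k))"
proof (rule coI)
  fix \<phi> \<psi> assume c: "clin \<iota> \<phi>" "clin \<iota>Z \<psi>"
  have "teq \<iota> \<iota>Z (\<alpha> (stZ z)) (map (\<lambda>(a, z). (st a, stZ z)) (\<alpha> z))"
    using galois unfolding star_galois_def by blast
  then have "tev \<phi> \<psi> (\<alpha> (stZ z)) = tev \<phi> \<psi> (map (\<lambda>(a, z). (st a, stZ z)) (\<alpha> z))"
    using c by (simp add: teq_def)
  also have "\<dots> = cnj (tev (\<lambda>a. cnj (\<phi> (st a))) (\<lambda>w. cnj (\<psi> (stZ w))) (\<alpha> z))"
  proof -
    have "tev \<phi> \<psi> (map (\<lambda>(a, z). (st a, stZ z)) xs) = cnj (tev (\<lambda>a. cnj (\<phi> (st a))) (\<lambda>w. cnj (\<psi> (stZ w))) xs)" for xs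
      by (induction xs) (auto simp: tev_def)
    then show ?thesis .
  qed
  also have "\<dots> = (\<Sum>k<n. \<phi> (st (a k)) * \<psi> (stZ (w k)))"
    by (simp add: co_tev[OF assms clin_star[OF c(1)] Z.clin_star[OF c(2)]])
  finally show "tev \<phi> \<psi> (\<alpha> (stZ z)) = (\<Sum>k<n. \<phi> (st (a k)) * \<psi> (stZ (w k)))" .
qed

lemma sum_list_sum_swap: "sum_list (map (\<lambda>x. \<Sum>l<(m::nat). f x l) xs) = (\<Sum>l<m. sum_list (map (\<lambda>x. f x l) xs))"
  for f :: "_ \<Rightarrow> nat \<Rightarrow> complex"
  by (induction xs) (auto simp: sum.distrib)

text \<open>For fixed a and z, both phi(a * _) and chi(z * _) are linear, so the product of two
  coactions can be evaluated one factor at a time with the expansions of q and then of p.\<close>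

lemma sl_mult:
  assumes p: "co n p a x" and q: "co m q b y" and c: "clin \<iota> \<phi>"
  shows "sl \<phi> (p * q) = (\<Sum>l<m. \<Sum>k<n. \<iota>Z (\<phi> (a k * b l)) * (x k * y l))"
proof (rule Z.functionals_separate)
  fix \<chi> assume \<chi>: "clin \<iota>Z \<chi>"
  have "teq \<iota> \<iota>Z (\<alpha> (p * q)) (concat (map (\<lambda>(a, z). map (\<lambda>(b, w). (a * b, z * w)) (\<alpha> q)) (\<alpha> p)))"
    using galois unfolding star_galois_def by blast
  then have "tev \<phi> \<chi> (\<alpha> (p * q)) = tev \<phi> \<chi> (concat (map (\<lambda>(a, z). map (\<lambda>(b, w). (a * b, z * w)) (\<alpha> q)) (\<alpha> p)))"
    using c \<chi> by (simp add: teq_def)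
  also have "\<dots> = sum_list (map (\<lambda>(a, z). tev (\<lambda>b. \<phi> (a * b)) (\<lambda>w. \<chi> (z * w)) (\<alpha> q)) (\<alpha> p))"
  proof -
    have *: "tev \<phi> \<chi> (map (\<lambda>(b, w). (a * b, z * w)) ys) = tev (\<lambda>b. \<phi> (a * b)) (\<lambda>w. \<chi> (z * w)) ys" for a z ys
      by (simp add: tev_def o_def split_def)
    have "tev \<phi> \<chi> (concat (map (\<lambda>(a, z). map (\<lambda>(b, w). (a * b, z * w)) (\<alpha> q)) xs)) =
       sum_list (map (\<lambda>(a, z). tev (\<lambda>b. \<phi> (a * b)) (\<lambda>w. \<chi> (z * w)) (\<alpha> q)) xs)" for xs
    proof (induction xs)
      case Nil show ?case by (simp add: tev_def)
    next
      case (Cons x xs) then show ?case by (cases x) (simp add: tev_append *)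
    qed
    then show ?thesis .
  qed
  also have "\<dots> = sum_list (map (\<lambda>z. \<Sum>l<m. \<phi> (fst z * b l) * \<chi> (snd z * y l)) (\<alpha> p))"
    using co_tev[OF q clin_mult_left[OF c] Z.clin_mult_left[OF \<chi>]] by (simp add: split_def)
  also have "\<dots> = (\<Sum>l<m. tev (\<lambda>a. \<phi> (a * b l)) (\<lambda>z. \<chi> (z * y l)) (\<alpha> p))"
    unfolding sum_list_sum_swap by (simp add: tev_def split_def)
  also have "\<dots> = (\<Sum>l<m. \<Sum>k<n. \<phi> (a k * b l) * \<chi> (x k * y l))"
    using co_tev[OF p clin_mult_right[OF c] Z.clin_mult_right[OF \<chi>]] by simp
  finally show "\<chi> (sl \<phi> (p * q)) = \<chi> (\<Sum>l<m. \<Sum>k<n. \<iota>Z (\<phi> (a k * b l)) * (x k * y l))"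
    using \<chi> by (simp add: clin_sl Z.clin_sum Z.clin_scale)
qed

subsection \<open>The Galois map\<close>

lemma tev_galois_map:
  assumes "clin \<iota>Z \<psi>"
  shows "tev \<phi> \<psi> (galois_map \<alpha> xs) = sum_list (map (\<lambda>(x, y). \<psi> (sl \<phi> x * y)) xs)"
proof (induction xs)
  case (Cons p xs)
  obtain x y where p: "p = (x, y)" by (cases p)
  have "tev \<phi> \<psi> (map (\<lambda>(a, z). (a, z * y)) zs) = tev \<phi> (\<lambda>z. \<psi> (z * y)) zs" for zs
    by (simp add: tev_def o_def split_def)
  then have "tev \<phi> \<psi> (galois_map \<alpha> (p # xs)) = tev \<phi> (\<lambda>z. \<psi> (z * y)) (\<alpha> x) + tev \<phi> \<psi> (galois_map \<alpha> xs)"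
    by (simp add: galois_map_def tev_append p)
  then show ?case using Cons by (simp add: p clin_sl[OF Z.clin_mult_right[OF assms]])
qed (simp add: galois_map_def tev_def)

lemma galois_injective:
  assumes "\<And>\<phi> \<psi>. clin \<iota> \<phi> \<Longrightarrow> clin \<iota>Z \<psi> \<Longrightarrow>
      sum_list (map (\<lambda>(x, y). \<psi> (sl \<phi> x * y)) xs) = sum_list (map (\<lambda>(x, y). \<psi> (sl \<phi> x * y)) ys)"
    and c: "clin \<iota>Z \<psi>" "clin \<iota>Z \<chi>"
  shows "tev \<psi> \<chi> xs = tev \<psi> \<chi> ys"
proof -
  have "\<forall>xs ys. teq \<iota> \<iota>Z (galois_map \<alpha> xs) (galois_map \<alpha> ys) \<longrightarrow> teq \<iota>Z \<iota>Z xs ys"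
    using galois unfolding star_galois_def by (elim conjE)
  moreover have "teq \<iota> \<iota>Z (galois_map \<alpha> xs) (galois_map \<alpha> ys)"
    unfolding teq_def using assms(1) by (simp add: tev_galois_map)
  ultimately have "teq \<iota>Z \<iota>Z xs ys" by blast
  then show ?thesis using c by (simp add: teq_def)
qed

text \<open>A preimage of a (x) 1 under the Galois map, sliced by phi.\<close>

lemma galois_surjective:
  "\<exists>ts. \<forall>\<phi>. clin \<iota> \<phi> \<longrightarrow> sum_list (map (\<lambda>(x, y). sl \<phi> x * y) ts) = \<iota>Z (\<phi> a)"
proof -
  have "\<forall>ts. \<exists>xs. teq \<iota> \<iota>Z (galois_map \<alpha> xs) ts"
    using galois unfolding star_galois_def by (elim conjE)
  then obtain ts where ts: "teq \<iota> \<iota>Z (galois_map \<alpha> ts) [(a, 1)]" by blast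
  have "sum_list (map (\<lambda>(x, y). sl \<phi> x * y) ts) = \<iota>Z (\<phi> a)" if c: "clin \<iota> \<phi>" for \<phi>
  proof (rule Z.functionals_separate)
    fix \<psi> assume \<psi>: "clin \<iota>Z \<psi>"
    have "\<psi> (sum_list (map (\<lambda>(x, y). sl \<phi> x * y) ts)) = tev \<phi> \<psi> (galois_map \<alpha> ts)"
      by (simp add: tev_galois_map[OF \<psi>] Z.clin_sum_list[OF \<psi>] split_def)
    also have "\<dots> = \<phi> a * \<psi> 1" using ts c \<psi> by (simp add: teq_def tev_def)
    also have "\<dots> = \<psi> (\<iota>Z (\<phi> a))" using Z.clin_scale[OF \<psi>, of "\<phi> a" 1] by simp
    finally show "\<psi> (sum_list (map (\<lambda>(x, y). sl \<phi> x * y) ts)) = \<psi> (\<iota>Z (\<phi> a))" .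
  qed
  then show ?thesis by blast
qed

section \<open>Coinvariant elements are scalars\<close>

lemma clin_mu: "clin \<iota>Z \<mu>" and mu_1 [simp]: "\<mu> 1 = 1"
  and mu_pos: "Im (\<mu> (stZ z * z)) = 0" "0 \<le> Re (\<mu> (stZ z * z))"
  using haar by (auto simp: pos_haar_def)

lemma sl_1: "clin \<iota> \<phi> \<Longrightarrow> sl \<phi> 1 = \<iota>Z (\<phi> 1)"
proof (rule Z.functionals_separate)
  fix \<psi> assume c: "clin \<iota> \<phi>" "clin \<iota>Z \<psi>"
  have "teq \<iota> \<iota>Z (\<alpha> 1) [(1, 1)]" using galois unfolding star_galois_def by blast
  then show "\<psi> (sl \<phi> 1) = \<psi> (\<iota>Z (\<phi> 1))"
    using c Z.clin_scale[OF c(2), of "\<phi> 1" 1] by (simp add: clin_sl teq_def tev_def)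
qed

text \<open>If z has coaction 1 (x) z, then z (x) 1 and 1 (x) z have the same image 1 (x) z under
  the Galois map. Hence they are equal, and mu on the second factor gives z = mu(z) 1.\<close>

lemma coinvariant_scalar:
  assumes "\<And>\<phi>. clin \<iota> \<phi> \<Longrightarrow> sl \<phi> z = \<iota>Z (\<phi> 1) * z"
  shows "z = \<iota>Z (\<mu> z)"
proof (rule Z.functionals_separate)
  fix \<chi> assume \<chi>: "clin \<iota>Z \<chi>"
  have "tev \<chi> \<mu> [(z, 1)] = tev \<chi> \<mu> [(1, z)]"
    using assms by (intro galois_injective \<chi> clin_mu) (simp add: sl_1)
  then show "\<chi> z = \<chi> (\<iota>Z (\<mu> z))"
    using Z.clin_scale[OF \<chi>, of "\<mu> z" 1] by (simp add: tev_def mult.commute)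
qed

subsection \<open>The Haar measure as a positive functional\<close>

lemma mu_expand:
  "\<mu> (stZ (w + \<iota>Z s * z) * (w + \<iota>Z s * z)) =
    \<mu> (stZ w * w) + s * \<mu> (stZ w * z) + cnj s * \<mu> (stZ z * w) + cnj s * s * \<mu> (stZ z * z)"
proof -
  have "stZ (w + \<iota>Z s * z) * (w + \<iota>Z s * z) =
    stZ w * w + \<iota>Z s * (stZ w * z) + \<iota>Z (cnj s) * (stZ z * w) + \<iota>Z (cnj s * s) * (stZ z * z)"
    by (simp add: Z.st_add Z.st_scale distrib_left distrib_right mult.assoc add.assoc
        Z.iota_left_comm[of "stZ w" s] Z.iota_left_comm[of "stZ z" s] Z.iota_mult)
  then show ?thesis by (simp add: Z.clin_add[OF clin_mu] Z.clin_scale[OF clin_mu])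
qed

text \<open>Polarisation: mu is real on w + s z, multiplied by its star from the left; s = 1 and s =
  i give the imaginary and the real part of the claim.\<close>

lemma mu_herm: "\<mu> (stZ w * z) = cnj (\<mu> (stZ z * w))"
proof -
  have *: "Im (s * \<mu> (stZ w * z) + cnj s * \<mu> (stZ z * w)) = 0" if "cmod s = 1" for s
  proof -
    have s: "cnj s * s = 1" using that by (simp add: mult.commute flip: complex_norm_square)
    have "Im (\<mu> (stZ (w + \<iota>Z s * z) * (w + \<iota>Z s * z))) = 0" by (rule mu_pos)
    then show ?thesis unfolding mu_expand s using mu_pos(1)[of w] mu_pos(1)[of z] by simp
  qed
  show ?thesis using *[of 1] *[of \<i>] by (simp add: complex_eq_iff)
qed

text \<open>The degenerate case of Cauchy-Schwarz: if b = mu(z^* w) were nonzero, moving from the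
  null vector w a short way along -b z would make the form negative.\<close>

lemma mu_null:
  assumes "\<mu> (stZ w * w) = 0"
  shows "\<mu> (stZ z * w) = 0"
proof (rule ccontr)
  define b where "b = \<mu> (stZ z * w)"
  define c where "c = Re (\<mu> (stZ z * z))"
  \<comment> \<open>The value at w - r b z is r |b|^2 (r c - 2), so r > 0 with r c < 2 is required.
    The summand 1 in the denominator allows c = 0.\<close>
  define r where "r = 1 / (c + 1)"
  assume "\<mu> (stZ z * w) \<noteq> 0"
  then have bpos: "0 < (cmod b)\<^sup>2" by (simp add: b_def)
  have c: "0 \<le> c" "\<mu> (stZ z * z) = of_real c"
    using mu_pos[of z] by (simp_all add: c_def complex_eq_iff)
  have r: "0 < r" "r * c \<le> 1" using c by (simp_all add: r_def field_simps)
  define s where "s = - of_real r * b"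
  have bb: "b * cnj b = of_real ((cmod b)\<^sup>2)" by (rule complex_norm_square[symmetric])
  have "\<mu> (stZ (w + \<iota>Z s * z) * (w + \<iota>Z s * z)) = s * cnj b + cnj s * b + cnj s * s * of_real c"
    unfolding mu_expand assms mu_herm[of w z] c(2) by (simp add: b_def)
  also have "\<dots> = - 2 * of_real r * (b * cnj b) + of_real (r * r * c) * (b * cnj b)"
    by (simp add: s_def algebra_simps)
  also have "\<dots> = of_real (- 2 * r * (cmod b)\<^sup>2 + r * r * c * (cmod b)\<^sup>2)" unfolding bb by simp
  finally have "0 \<le> - 2 * r * (cmod b)\<^sup>2 + r * r * c * (cmod b)\<^sup>2"
    using mu_pos(2)[of "w + \<iota>Z s * z"] by (simp only: Re_complex_of_real)
  also have "\<dots> = (r * (cmod b)\<^sup>2) * (r * c - 2)" by (simp add: algebra_simps)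
  finally have "0 \<le> (r * (cmod b)\<^sup>2) * (r * c - 2)" .
  moreover have "0 < r * (cmod b)\<^sup>2" using r(1) bpos by simp
  ultimately have "0 \<le> r * c - 2" by (simp add: zero_le_mult_iff)
  then show False using r(2) by simp
qed

end

section \<open>Isotypic components\<close>

context galois_extension
begin

text \<open>\<open>x \<in> X L\<close> encodes a comodule map to \<open>Z\<close>, sending the \<open>i\<close>-th basis vector of \<open>L\<close> to \<open>x i\<close>;
  the dimension of \<open>X L\<close> is the multiplicity of \<open>L\<close> in \<open>Z\<close>.\<close>

definition X :: "(nat \<times> (nat \<Rightarrow> nat \<Rightarrow> 'a)) set \<Rightarrow> (nat \<Rightarrow> 'z) set" where
  "X L = {x. (\<forall>i<cdim L. co (cdim L) (x i) (rep L i) x) \<and> (\<forall>i\<ge>cdim L. x i = 0)}"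

lemma X_sl: "x \<in> X L \<Longrightarrow> i < cdim L \<Longrightarrow> clin \<iota> \<phi> \<Longrightarrow> sl \<phi> (x i) = (\<Sum>k<cdim L. \<iota>Z (\<phi> (rep L i k)) * x k)"
  by (simp add: X_def co_def)

definition coord :: "(nat \<times> (nat \<Rightarrow> nat \<Rightarrow> 'a)) set \<Rightarrow> nat \<Rightarrow> nat \<Rightarrow> 'a \<Rightarrow> complex" where
  "coord = (SOME X. (\<forall>L i j. clin \<iota> (X L i j)) \<and>
    (\<forall>L\<in>Irr. \<forall>L'\<in>Irr. \<forall>i<cdim L. \<forall>j<cdim L. \<forall>k<cdim L'. \<forall>l<cdim L'.
      X L i j (rep L' k l) = (if L = L' \<and> i = k \<and> j = l then 1 else 0)))"

lemma coord_spec: "(\<forall>L i j. clin \<iota> (coord L i j)) \<and>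
    (\<forall>L\<in>Irr. \<forall>L'\<in>Irr. \<forall>i<cdim L. \<forall>j<cdim L. \<forall>k<cdim L'. \<forall>l<cdim L'.
      coord L i j (rep L' k l) = (if L = L' \<and> i = k \<and> j = l then 1 else 0))"
  unfolding coord_def by (rule someI_ex[OF coordinate_functionals])

lemma clin_coord: "clin \<iota> (coord L i j)"
  using coord_spec by blast

lemma coord_rep: "L \<in> Irr \<Longrightarrow> L' \<in> Irr \<Longrightarrow> i < cdim L \<Longrightarrow> j < cdim L \<Longrightarrow> k < cdim L' \<Longrightarrow> l < cdim L' \<Longrightarrow>
    coord L i j (rep L' k l) = (if L = L' \<and> i = k \<and> j = l then 1 else 0)"
  using conjunct2[OF coord_spec] by blast

text \<open>Both sides agree on the basis \<open>coefs\<close>. For fixed i the functionals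
  \<open>coord L i j\<close> thus transform under convolution from the right by the matrix of L,
  which makes slices by them equivariant tuples.\<close>

lemma conv_coord:
  assumes L: "L \<in> Irr" "i < cdim L" "j < cdim L" and \<psi>: "clin \<iota> \<psi>"
  shows "conv (coord L i j) \<psi> = (\<lambda>a. \<Sum>k<cdim L. \<psi> (rep L j k) * coord L i k a)"
proof
  fix a
  show "conv (coord L i j) \<psi> a = (\<Sum>k<cdim L. \<psi> (rep L j k) * coord L i k a)"
  proof (rule clin_eq_on_span[of _ _ coefs])
    show "clin \<iota> (conv (coord L i j) \<psi>)" by (rule clin_conv[OF clin_coord \<psi>])
    show "clin \<iota> (\<lambda>a. \<Sum>k<cdim L. \<psi> (rep L j k) * coord L i k a)" by (rule clin_sum_fun) (rule clin_coord)
    show "a \<in> vs.span coefs" by (simp add: coefs_span)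
    fix x assume "x \<in> coefs"
    then obtain L' p q where x: "x = rep L' p q" and L': "L' \<in> Irr" "p < cdim L'" "q < cdim L'"
      by (auto simp: coefs_def)
    have "conv (coord L i j) \<psi> x = (\<Sum>r<cdim L'. coord L i j (rep L' p r) * \<psi> (rep L' r q))"
      using crepD(3)[OF rep(4)[OF L'(1)] clin_coord \<psi>, of L i j] unfolding x by (auto simp: mmap_def mmul_def fun_eq_iff)
    also have "\<dots> = (\<Sum>r<cdim L'. if r = j then (if L = L' \<and> i = p then \<psi> (rep L j q) else 0) else 0)"
      using L L' by (intro sum.cong) (auto simp: coord_rep)
    also have "\<dots> = (if L = L' \<and> i = p then \<psi> (rep L j q) else 0)" using L by auto
    also have "\<dots> = (\<Sum>k<cdim L. if k = q then (if L = L' \<and> i = p then \<psi> (rep L j k) else 0) else 0)"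
      using L' by auto
    also have "\<dots> = (\<Sum>k<cdim L. \<psi> (rep L j k) * coord L i k x)"
      using L L' unfolding x by (intro sum.cong) (auto simp: coord_rep)
    finally show "conv (coord L i j) \<psi> x = (\<Sum>k<cdim L. \<psi> (rep L j k) * coord L i k x)" .
  qed
qed

text \<open>Every z yields elements of X L, one for each row index i; these supply both the isotypic
  projections and the partition of unity.\<close>

lemma slices_in_X:
  assumes "L \<in> Irr" "i < cdim L"
  shows "(\<lambda>j. if j < cdim L then sl (coord L i j) z else 0) \<in> X L"
  unfolding X_def
proof (intro CollectI conjI allI impI)
  fix j assume j: "j < cdim L"
  show "co (cdim L) (if j < cdim L then sl (coord L i j) z else 0) (rep L j) (\<lambda>j. if j < cdim L then sl (coord L i j) z else 0)"
    unfolding co_def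
  proof (intro allI impI)
    fix \<psi> assume \<psi>: "clin \<iota> \<psi>"
    have "sl \<psi> (sl (coord L i j) z) = sl (\<lambda>a. \<Sum>k<cdim L. \<psi> (rep L j k) * coord L i k a) z"
      unfolding sl_sl[OF clin_coord \<psi>] conv_coord[OF assms j \<psi>] ..
    also have "\<dots> = (\<Sum>k<cdim L. \<iota>Z (\<psi> (rep L j k)) * sl (coord L i k) z)" by (rule sl_sum_fun)
    finally show "sl \<psi> (if j < cdim L then sl (coord L i j) z else 0) =
        (\<Sum>k<cdim L. \<iota>Z (\<psi> (rep L j k)) * (if k < cdim L then sl (coord L i k) z else 0))"
      using j by simp
  qed
qed simp

text \<open>Take a preimage sum x (x) y of a_0k (x) 1 under the Galois map and slice the first
  factors by \<open>coord L 0 j\<close>. The tuples lie in X L, and duality of \<open>coord\<close>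
  leaves delta_jk. Row 0 exists because an irreducible comodule is nonzero.\<close>

lemma partition_of_unity:
  assumes L: "L \<in> Irr"
  shows "\<exists>(N :: nat \<Rightarrow> nat) xr yr. \<forall>k<cdim L. (\<forall>r<N k. xr k r \<in> X L) \<and>
      (\<forall>j<cdim L. (\<Sum>r<N k. xr k r j * yr k r) = (if j = k then 1 else 0))"
proof -
  have "\<exists>(N :: nat) xr yr. (\<forall>r<N. xr r \<in> X L) \<and> (\<forall>j<cdim L. (\<Sum>r<N. xr r j * yr r) = (if j = k then 1 else 0))"
    if k: "k < cdim L" for k
  proof -
    obtain ts where ts: "\<forall>\<phi>. clin \<iota> \<phi> \<longrightarrow> sum_list (map (\<lambda>(x, y). sl \<phi> x * y) ts) = \<iota>Z (\<phi> (rep L 0 k))"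
      using galois_surjective[of "rep L 0 k"] by (elim exE)
    define xr where "xr r = (\<lambda>j. if j < cdim L then sl (coord L 0 j) (fst (ts ! r)) else 0)" for r
    define yr where "yr r = snd (ts ! r)" for r
    have "xr r \<in> X L" for r unfolding xr_def by (rule slices_in_X[OF L rep(6)[OF L]])
    moreover have "(\<Sum>r<length ts. xr r j * yr r) = (if j = k then 1 else 0)" if j: "j < cdim L" for j
    proof -
      have "(\<Sum>r<length ts. xr r j * yr r) = sum_list (map (\<lambda>(x, y). sl (coord L 0 j) x * y) ts)"
        using j by (simp add: sum_list_sum_nth xr_def yr_def split_def lessThan_atLeast0)
      also have "\<dots> = \<iota>Z (coord L 0 j (rep L 0 k))" by (rule ts[rule_format, OF clin_coord])
      also have "\<dots> = (if j = k then 1 else 0)" using L j k rep(6)[OF L] by (simp add: coord_rep)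
      finally show ?thesis .
    qed
    ultimately show ?thesis by blast
  qed
  then show ?thesis by metis
qed

lemma tev_concat_upt:
  "sum_list (map f (concat (map (\<lambda>k. map (g k) [0..<N k]) [0..<d]))) = (\<Sum>k<d. \<Sum>r<N k. f (g k r))"
  for f :: "_ \<Rightarrow> complex"
  by (induction d) (auto simp: interv_sum_list_conv_sum_set_nat lessThan_atLeast0 o_def)

text \<open>The Galois map sends both x_i (x) 1 and sum_{k,r} x^{k,r}_i (x) y^{k,r} x_k to sum_k
  a_ik (x) x_k: the first by equivariance of x, the second by equivariance of x^{k,r} and the
  partition of unity. Injectivity identifies them, and mu on the second factor gives the formula.
  The finitely many x^{k,r} therefore span X L.\<close>

lemma X_reproducing:
  fixes N :: "nat \<Rightarrow> nat"
  assumes L: "L \<in> Irr" and xr: "\<And>k r. k < cdim L \<Longrightarrow> r < N k \<Longrightarrow> xr k r \<in> X L"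
    and one: "\<And>k j. k < cdim L \<Longrightarrow> j < cdim L \<Longrightarrow> (\<Sum>r<N k. xr k r j * yr k r) = (if j = k then 1 else 0)"
    and x: "x \<in> X L" and i: "i < cdim L"
  shows "x i = (\<Sum>k<cdim L. \<Sum>r<N k. \<iota>Z (\<mu> (yr k r * x k)) * xr k r i)"
proof (rule Z.functionals_separate)
  fix \<chi> assume \<chi>: "clin \<iota>Z \<chi>"
  define d where "d = cdim L"
  define zs where "zs = concat (map (\<lambda>k. map (\<lambda>r. (xr k r i, yr k r * x k)) [0..<N k]) [0..<d])"
  have "tev \<chi> \<mu> [(x i, 1)] = tev \<chi> \<mu> zs"
  proof (rule galois_injective[OF _ \<chi> clin_mu])
    fix \<phi> \<psi> assume c: "clin \<iota> \<phi>" "clin \<iota>Z \<psi>"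
    have "sum_list (map (\<lambda>(x, y). \<psi> (sl \<phi> x * y)) zs) = (\<Sum>k<d. \<Sum>r<N k. \<psi> (sl \<phi> (xr k r i) * (yr k r * x k)))"
      unfolding zs_def tev_concat_upt by simp
    also have "\<dots> = (\<Sum>k<d. \<phi> (rep L i k) * \<psi> (x k))"
    proof (intro sum.cong refl)
      fix k assume k: "k \<in> {..<d}"
      have "(\<Sum>r<N k. \<psi> (sl \<phi> (xr k r i) * (yr k r * x k))) =
          (\<Sum>r<N k. \<Sum>l<d. \<phi> (rep L i l) * \<psi> (xr k r l * (yr k r * x k)))"
      proof (intro sum.cong refl)
        fix r assume "r \<in> {..<N k}"
        then have "sl \<phi> (xr k r i) = (\<Sum>l<d. \<iota>Z (\<phi> (rep L i l)) * xr k r l)"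
          using k xr i c unfolding d_def by (intro X_sl) auto
        then show "\<psi> (sl \<phi> (xr k r i) * (yr k r * x k)) = (\<Sum>l<d. \<phi> (rep L i l) * \<psi> (xr k r l * (yr k r * x k)))"
          using c by (simp add: sum_distrib_right Z.clin_sum Z.clin_scale mult.assoc)
      qed
      also have "\<dots> = (\<Sum>l<d. \<Sum>r<N k. \<phi> (rep L i l) * \<psi> (xr k r l * (yr k r * x k)))" by (rule sum.swap)
      also have "\<dots> = (\<Sum>l<d. \<phi> (rep L i l) * \<psi> ((\<Sum>r<N k. xr k r l * yr k r) * x k))"
        using c by (simp add: sum_distrib_right sum_distrib_left Z.clin_sum mult.assoc)
      also have "\<dots> = (\<Sum>l<d. if l = k then \<phi> (rep L i l) * \<psi> (x k) else 0)"
        using k c one by (intro sum.cong) (auto simp: d_def)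
      also have "\<dots> = \<phi> (rep L i k) * \<psi> (x k)" using k by simp
      finally show "(\<Sum>r<N k. \<psi> (sl \<phi> (xr k r i) * (yr k r * x k))) = \<phi> (rep L i k) * \<psi> (x k)" .
    qed
    also have "\<dots> = \<psi> (sl \<phi> (x i))"
      using X_sl[OF x i c(1)] c by (simp add: Z.clin_sum Z.clin_scale d_def)
    finally show "sum_list (map (\<lambda>(x, y). \<psi> (sl \<phi> x * y)) [(x i, 1)]) = sum_list (map (\<lambda>(x, y). \<psi> (sl \<phi> x * y)) zs)"
      by simp
  qed
  also have "tev \<chi> \<mu> zs = (\<Sum>k<d. \<Sum>r<N k. \<chi> (xr k r i) * \<mu> (yr k r * x k))"
    unfolding tev_def zs_def tev_concat_upt by simp
  finally show "\<chi> (x i) = \<chi> (\<Sum>k<cdim L. \<Sum>r<N k. \<iota>Z (\<mu> (yr k r * x k)) * xr k r i)"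
    using \<chi> by (simp add: tev_def d_def Z.clin_sum Z.clin_scale mult.commute)
qed

section \<open>The hermitian form on the multiplicity space\<close>

definition ip :: "nat \<Rightarrow> (nat \<Rightarrow> 'z) \<Rightarrow> (nat \<Rightarrow> 'z) \<Rightarrow> complex" where
  "ip d x y = \<mu> (\<Sum>i<d. stZ (x i) * y i)"

text \<open>The coaction of sum_i x_i^* y_i involves sum_i a_ik^* a_il, which is delta_kl by
  unitarity, so the element is coinvariant and hence a scalar; mu only reads off its value.\<close>

lemma ip_scalar:
  assumes L: "L \<in> Irr" and x: "x \<in> X L" and y: "y \<in> X L"
  shows "(\<Sum>i<cdim L. stZ (x i) * y i) = \<iota>Z (ip (cdim L) x y)"
  unfolding ip_def
proof (rule coinvariant_scalar)
  fix \<phi> assume c: "clin \<iota> \<phi>"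
  define d where "d = cdim L"
  define a where "a = rep L"
  have un: "(\<Sum>i<d. st (a i k) * a i l) = (if k = l then 1 else 0)" if "k < d" "l < d" for k l
    using fun_cong[OF fun_cong[OF ucrepD(2)[OF rep(1)[OF L]], of k], of l] that
    by (auto simp: mmul_def madj_def mone_def d_def a_def)
  have "sl \<phi> (\<Sum>i<d. stZ (x i) * y i) = (\<Sum>i<d. \<Sum>l<d. \<Sum>k<d. \<iota>Z (\<phi> (st (a i k) * a i l)) * (stZ (x k) * y l))"
    unfolding sl_sum[OF c]
  proof (intro sum.cong refl)
    fix i assume "i \<in> {..<d}"
    then have "co d (stZ (x i)) (\<lambda>k. st (a i k)) (\<lambda>k. stZ (x k))" "co d (y i) (a i) y"
      using x y by (auto simp: X_def d_def a_def intro: co_star)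
    from sl_mult[OF this c] show "sl \<phi> (stZ (x i) * y i) = (\<Sum>l<d. \<Sum>k<d. \<iota>Z (\<phi> (st (a i k) * a i l)) * (stZ (x k) * y l))" .
  qed
  also have "\<dots> = (\<Sum>l<d. \<Sum>i<d. \<Sum>k<d. \<iota>Z (\<phi> (st (a i k) * a i l)) * (stZ (x k) * y l))" by (rule sum.swap)
  also have "\<dots> = (\<Sum>l<d. \<Sum>k<d. \<Sum>i<d. \<iota>Z (\<phi> (st (a i k) * a i l)) * (stZ (x k) * y l))"
    by (intro sum.cong refl sum.swap)
  also have "\<dots> = (\<Sum>l<d. \<Sum>k<d. if k = l then \<iota>Z (\<phi> 1) * (stZ (x k) * y l) else 0)"
  proof (intro sum.cong refl)
    fix l k assume lk: "l \<in> {..<d}" "k \<in> {..<d}"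
    have "(\<Sum>i<d. \<iota>Z (\<phi> (st (a i k) * a i l)) * (stZ (x k) * y l)) = \<iota>Z (\<phi> (\<Sum>i<d. st (a i k) * a i l)) * (stZ (x k) * y l)"
      by (simp add: clin_sum[OF c] Z.iota_sum sum_distrib_right)
    then show "(\<Sum>i<d. \<iota>Z (\<phi> (st (a i k) * a i l)) * (stZ (x k) * y l)) =
        (if k = l then \<iota>Z (\<phi> 1) * (stZ (x k) * y l) else 0)"
      using un[of k l] lk c by simp
  qed
  also have "\<dots> = \<iota>Z (\<phi> 1) * (\<Sum>i<d. stZ (x i) * y i)" by (simp add: sum_distrib_left)
  finally show "sl \<phi> (\<Sum>i<cdim L. stZ (x i) * y i) = \<iota>Z (\<phi> 1) * (\<Sum>i<cdim L. stZ (x i) * y i)"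
    by (simp add: d_def)
qed

lemma fun_vector_space: "vector_space (\<lambda>c (x :: nat \<Rightarrow> 'z) i. \<iota>Z c * x i)"
  by unfold_locales (auto simp: fun_eq_iff Z.iota_add Z.iota_mult algebra_simps)

lemma X_add: "x \<in> X L \<Longrightarrow> y \<in> X L \<Longrightarrow> x + y \<in> X L"
  by (auto simp: X_def co_def sl_add distrib_left sum.distrib)

lemma X_scale: "x \<in> X L \<Longrightarrow> (\<lambda>i. \<iota>Z c * x i) \<in> X L"
  by (auto simp: X_def co_def sl_scale sum_distrib_left Z.iota_left_comm[of "\<iota>Z _" c])

lemma X_zero: "0 \<in> X L"
  by (auto simp: X_def co_def)

text \<open>Positive definiteness: if \<open>ip x x = 0\<close>, then Cauchy-Schwarz kills all the coefficients in the
  reproducing formula for \<open>x\<close>.\<close>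

lemma X_orthonormal_basis:
  assumes L: "L \<in> Irr"
  shows "\<exists>(p :: nat) zz. 0 < p \<and> (\<forall>j<p. (\<lambda>i. zz i j) \<in> X L) \<and>
    (\<forall>j<p. \<forall>k<p. (\<Sum>i<cdim L. stZ (zz i j) * zz i k) = (if j = k then 1 else 0)) \<and>
    (\<forall>i<cdim L. \<forall>k<cdim L. (\<Sum>j<p. zz i j * stZ (zz k j)) = (if i = k then 1 else 0)) \<and>
    (\<forall>x\<in>X L. \<forall>i. \<exists>c. x i = (\<Sum>j<p. \<iota>Z (c j) * zz i j))"
proof -
  define d where "d = cdim L"
  obtain N :: "nat \<Rightarrow> nat" and xr yr where *: "\<forall>k<d. (\<forall>r<N k. xr k r \<in> X L) \<and>
      (\<forall>j<d. (\<Sum>r<N k. xr k r j * yr k r) = (if j = k then 1 else 0))"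
    unfolding d_def using partition_of_unity[OF L] by (elim exE)
  have xr: "xr k r \<in> X L" if "k < d" "r < N k" for k r using * that by blast
  have one: "(\<Sum>r<N k. xr k r j * yr k r) = (if j = k then 1 else 0)" if "k < d" "j < d" for k j
    using * that by blast
  have repr: "x i = (\<Sum>k<d. \<Sum>r<N k. \<iota>Z (\<mu> (yr k r * x k)) * xr k r i)" if "x \<in> X L" "i < d" for x i
    using X_reproducing[OF L xr[unfolded d_def] one[unfolded d_def] that(1) that(2)[unfolded d_def]]
    unfolding d_def .
  interpret F: vector_space "\<lambda>c (x :: nat \<Rightarrow> 'z) i. \<iota>Z c * x i" by (rule fun_vector_space)
  define B where "B = (\<Union>k<d. xr k ` {..<N k})"
  have B: "finite B" by (simp add: B_def)
  have XB: "X L \<subseteq> F.span B"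
  proof
    fix x assume x: "x \<in> X L"
    have "x = (\<Sum>k<d. \<Sum>r<N k. (\<lambda>i. \<iota>Z (\<mu> (yr k r * x k)) * xr k r i))"
    proof
      fix i
      show "x i = (\<Sum>k<d. \<Sum>r<N k. (\<lambda>i. \<iota>Z (\<mu> (yr k r * x k)) * xr k r i)) i"
      proof (cases "i < d")
        case True
        then show ?thesis using repr[OF x True] by (simp add: sum_fun_apply)
      next
        case False
        then have "x i = 0" using x by (simp add: X_def d_def)
        moreover have "xr k r i = 0" if "k < d" "r < N k" for k r
          using xr[OF that] False by (simp add: X_def d_def)
        ultimately show ?thesis by (simp add: sum_fun_apply)
      qed
    qed
    also have "\<dots> \<in> F.span B"
      by (intro F.span_sum F.span_scale F.span_base) (auto simp: B_def)
    finally show "x \<in> F.span B" .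
  qed
  have herm: "ip d y x = cnj (ip d x y)" for x y
    unfolding ip_def Z.clin_sum[OF clin_mu] cnj_sum by (intro sum.cong refl mu_herm)
  have pos: "0 < Re (ip d x x)" if x: "x \<in> X L" "x \<noteq> 0" for x
  proof (rule ccontr)
    assume "\<not> 0 < Re (ip d x x)"
    moreover have re: "Re (ip d x x) = (\<Sum>i<d. Re (\<mu> (stZ (x i) * x i)))"
      by (simp add: ip_def Z.clin_sum[OF clin_mu])
    moreover have "0 \<le> (\<Sum>i<d. Re (\<mu> (stZ (x i) * x i)))" by (intro sum_nonneg mu_pos)
    ultimately have "(\<Sum>i<d. Re (\<mu> (stZ (x i) * x i))) = 0" by linarith
    then have "\<forall>i\<in>{..<d}. Re (\<mu> (stZ (x i) * x i)) = 0"
      using mu_pos(2) by (subst (asm) sum_nonneg_eq_0_iff) auto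
    then have "\<mu> (stZ (x k) * x k) = 0" if "k < d" for k
      using that mu_pos(1)[of "x k"] by (simp add: complex_eq_iff)
    then have "\<mu> (y * x k) = 0" if "k < d" for y k
      using mu_null[of "x k" "stZ y"] that by simp
    then have "x i = 0" if "i < d" for i using repr[OF x(1) that] by simp
    moreover have "x i = 0" if "\<not> i < d" for i using x(1) that by (simp add: X_def d_def)
    ultimately show False using x(2) by (auto simp: fun_eq_iff)
  qed
  obtain p :: nat and e where e: "\<And>k. k < p \<Longrightarrow> e k \<in> X L"
    and ee: "\<And>k l. k < p \<Longrightarrow> l < p \<Longrightarrow> ip d (e k) (e l) = (if k = l then 1 else 0)"
    and exp: "\<And>x. x \<in> X L \<Longrightarrow> (\<Sum>k<p. (\<lambda>i. \<iota>Z (ip d (e k) x) * e k i)) = x"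
  proof (rule orthonormal_basis_exists[of "\<lambda>c (x :: nat \<Rightarrow> 'z) i. \<iota>Z c * x i" "X L" B "ip d"])
    show "ip d x (y + z) = ip d x y + ip d x z" for x y z
      by (simp add: ip_def distrib_left sum.distrib Z.clin_add[OF clin_mu])
    show "ip d x (\<lambda>i. \<iota>Z c * y i) = c * ip d x y" for x y c
      by (simp add: ip_def Z.clin_sum[OF clin_mu] Z.iota_left_comm[of "stZ _" c] Z.clin_scale[OF clin_mu] sum_distrib_left)
    show "ip d y x = cnj (ip d x y)" for x y by (rule herm)
  qed (use fun_vector_space X_zero X_add X_scale B XB pos in blast)+
  define zz where "zz i j = e j i" for i j
  have zX: "(\<lambda>i. zz i j) \<in> X L" if "j < p" for j using e[OF that] by (simp add: zz_def)
  have u1: "(\<Sum>i<d. stZ (zz i j) * zz i k) = (if j = k then 1 else 0)" if "j < p" "k < p" for j k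
    using ip_scalar[OF L e[OF that(1)] e[OF that(2)]] ee[OF that] by (simp add: zz_def d_def)
  have exp': "x i = (\<Sum>j<p. \<iota>Z (ip d (e j) x) * zz i j)" if "x \<in> X L" for x i
    using fun_cong[OF exp[OF that], of i] by (simp add: sum_fun_apply zz_def)
  \<comment> \<open>The inner sum over l of z_lj^* x_l is the scalar product of column j with x, so
    the matrix z z^H reproduces x from its orthonormal expansion.\<close>
  have Q: "(\<Sum>l<d. (\<Sum>j<p. zz i j * stZ (zz l j)) * x l) = x i" if x: "x \<in> X L" for x i
  proof -
    have "(\<Sum>l<d. (\<Sum>j<p. zz i j * stZ (zz l j)) * x l) = (\<Sum>j<p. \<Sum>l<d. zz i j * (stZ (zz l j) * x l))"
      unfolding sum_distrib_right mult.assoc by (rule sum.swap)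
    also have "\<dots> = (\<Sum>j<p. zz i j * \<iota>Z (ip d (e j) x))"
      using ip_scalar[OF L e x] by (simp add: zz_def d_def flip: sum_distrib_left)
    also have "\<dots> = x i" unfolding exp'[OF x, of i] by (intro sum.cong refl Z.iota_comm[symmetric])
    finally show ?thesis .
  qed
  \<comment> \<open>Write q for row i of z z^H. Inserting the partition of unity, q_k = sum_r (sum_l
    q_l x^{k,r}_l) y^{k,r} = sum_r x^{k,r}_i y^{k,r} = delta_ik.\<close>
  have u2: "(\<Sum>j<p. zz i j * stZ (zz k j)) = (if i = k then 1 else 0)" if ik: "i < d" "k < d" for i k
  proof -
    define q where "q l = (\<Sum>j<p. zz i j * stZ (zz l j))" for l
    have "q k = (\<Sum>l<d. if l = k then q l else 0)" using ik by simp
    also have "\<dots> = (\<Sum>l<d. q l * (\<Sum>r<N k. xr k r l * yr k r))"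
      using ik one by (intro sum.cong) auto
    also have "\<dots> = (\<Sum>r<N k. \<Sum>l<d. q l * xr k r l * yr k r)"
      unfolding sum_distrib_left mult.assoc by (rule sum.swap)
    also have "\<dots> = (\<Sum>r<N k. xr k r i * yr k r)"
      using Q[OF xr[OF ik(2)]] by (intro sum.cong) (auto simp: q_def simp flip: sum_distrib_right)
    also have "\<dots> = (if i = k then 1 else 0)" using one ik by simp
    finally show ?thesis by (simp add: q_def)
  qed
  \<comment> \<open>For p = 0 the second unitarity relation at i = k = 0 would read 0 = 1.\<close>
  have "p > 0"
  proof (rule ccontr)
    assume "\<not> p > 0"
    then show False using u2[of 0 0] rep(6)[OF L] by (simp add: d_def)
  qed
  show ?thesis
    unfolding d_def[symmetric]
  proof (rule exI[of _ p], rule exI[of _ zz], intro conjI allI impI ballI)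
    show "\<exists>c. x i = (\<Sum>j<p. \<iota>Z (c j) * zz i j)" if "x \<in> X L" for x i by (rule exI) (rule exp'[OF that])
  qed (fact \<open>p > 0\<close> | rule zX u1 u2; assumption)+
qed

end

section \<open>Decomposition of Z into isotypic components\<close>

context galois_extension
begin

definition mult_basis :: "((nat \<times> (nat \<Rightarrow> nat \<Rightarrow> 'a)) set \<Rightarrow> nat) \<Rightarrow> ((nat \<times> (nat \<Rightarrow> nat \<Rightarrow> 'a)) set \<Rightarrow> nat \<Rightarrow> nat \<Rightarrow> 'z) \<Rightarrow> bool" where
  "mult_basis p zz \<longleftrightarrow> (\<forall>L\<in>Irr. 0 < p L \<and> (\<forall>j<p L. (\<lambda>i. zz L i j) \<in> X L) \<and>
    (\<forall>j<p L. \<forall>k<p L. (\<Sum>i<cdim L. stZ (zz L i j) * zz L i k) = (if j = k then 1 else 0)) \<and>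
    (\<forall>i<cdim L. \<forall>k<cdim L. (\<Sum>j<p L. zz L i j * stZ (zz L k j)) = (if i = k then 1 else 0)) \<and>
    (\<forall>x\<in>X L. \<forall>i. \<exists>c. x i = (\<Sum>j<p L. \<iota>Z (c j) * zz L i j)))"

lemma mult_basis_exists: "\<exists>p zz. mult_basis p zz"
proof -
  define Q where "Q L p zz \<longleftrightarrow> 0 < p \<and> (\<forall>j<p. (\<lambda>i. zz i j) \<in> X L) \<and>
    (\<forall>j<p. \<forall>k<p. (\<Sum>i<cdim L. stZ (zz i j) * zz i k) = (if j = k then 1 else 0)) \<and>
    (\<forall>i<cdim L. \<forall>k<cdim L. (\<Sum>j<p. zz i j * stZ (zz k j)) = (if i = k then 1 else 0)) \<and>
    (\<forall>x\<in>X L. \<forall>i. \<exists>c. x i = (\<Sum>j<p. \<iota>Z (c j) * zz i j))" for L and p :: nat and zz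
  have "\<forall>L\<in>Irr. \<exists>p zz. Q L p zz" unfolding Q_def by (intro ballI X_orthonormal_basis)
  then obtain p zz where "\<forall>L\<in>Irr. Q L (p L) (zz L)" by metis
  then have "mult_basis p zz" unfolding mult_basis_def Q_def .
  then show ?thesis by blast
qed

text \<open>The counit restricted to the coefficients of L and zero on those of other classes.
  Slicing by it is the projection of Z onto the L-component. The factor 1 fits the linear
  combinations of \<open>clin_sum_fun\<close> and \<open>sl_sum_fun\<close>.\<close>

definition chi :: "(nat \<times> (nat \<Rightarrow> nat \<Rightarrow> 'a)) set \<Rightarrow> 'a \<Rightarrow> complex" where
  "chi L = (\<lambda>a. \<Sum>i<cdim L. 1 * coord L i i a)"

lemma clin_chi: "clin \<iota> (chi L)"
  unfolding chi_def by (rule clin_sum_fun) (rule clin_coord)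

lemma chi_rep:
  assumes "L \<in> Irr" "L' \<in> Irr" "i < cdim L'" "j < cdim L'"
  shows "chi L (rep L' i j) = (if L = L' \<and> i = j then 1 else 0)"
proof -
  have "chi L (rep L' i j) = (\<Sum>k<cdim L. if k = i then (if L = L' \<and> i = j then 1 else 0) else 0)"
    unfolding chi_def using assms by (intro sum.cong) (auto simp: coord_rep)
  then show ?thesis using assms by auto
qed

lemma sl_chi: "sl (chi L) z = (\<Sum>i<cdim L. sl (coord L i i) z)"
  unfolding chi_def sl_sum_fun by simp

text \<open>On basis elements both sides are 1 on diagonal entries and 0 elsewhere. The claim is
  made for all larger finite sets so that several elements can share one set of classes.\<close>

lemma eps_eq_sum_chi:
  "\<exists>F. finite F \<and> F \<subseteq> Irr \<and> (\<forall>F'. finite F' \<and> F \<subseteq> F' \<and> F' \<subseteq> Irr \<longrightarrow> \<epsilon> a = (\<Sum>L\<in>F'. chi L a))"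
proof -
  have "a \<in> vs.span coefs" by (simp add: coefs_span)
  then show ?thesis
  proof (induction rule: vs.span_induct_alt)
    case base
    show ?case using clin_0[OF clin_eps] clin_0[OF clin_chi] by (intro exI[of _ "{}"]) simp
  next
    case (step c x y)
    then obtain F where F: "finite F" "F \<subseteq> Irr" "\<forall>F'. finite F' \<and> F \<subseteq> F' \<and> F' \<subseteq> Irr \<longrightarrow> \<epsilon> y = (\<Sum>L\<in>F'. chi L y)"
      by blast
    obtain L i j where x: "x = rep L i j" and L: "L \<in> Irr" "i < cdim L" "j < cdim L"
      using step(1) by (auto simp: coefs_def)
    have "\<epsilon> (sc \<iota> c x + y) = (\<Sum>L\<in>F'. chi L (sc \<iota> c x + y))"
      if F': "finite F'" "insert L F \<subseteq> F'" "F' \<subseteq> Irr" for F'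
    proof -
      have "\<epsilon> x = mone (cdim L) i j"
        using crepD(2)[OF rep(4)[OF L(1)]] by (auto simp: x mmap_def fun_eq_iff)
      also have "\<dots> = (\<Sum>L'\<in>F'. if L' = L then (if i = j then 1 else 0) else 0)"
        using F' L by (auto simp: mone_def)
      also have "\<dots> = (\<Sum>L'\<in>F'. chi L' x)"
        unfolding x using F'(3) L by (intro sum.cong refl) (simp add: chi_rep subset_iff)
      finally have "\<epsilon> x = (\<Sum>L'\<in>F'. chi L' x)" .
      moreover have "\<epsilon> y = (\<Sum>L'\<in>F'. chi L' y)" using F(3) F' by simp
      ultimately show ?thesis
        by (simp add: sc_def clin_add[OF clin_eps] clin_scale[OF clin_eps] clin_add[OF clin_chi] clin_scale[OF clin_chi]
            sum.distrib sum_distrib_left)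
    qed
    then show ?case using F(1,2) L(1) by (intro exI[of _ "insert L F"]) auto
  qed
qed

text \<open>Finitely many classes serve all first components of \<open>\<alpha> z\<close> at once.
  Replacing the counit by the sum of \<open>chi L\<close> in the counit axiom splits z into its
  projections.\<close>

lemma sum_isotypic_projections: "\<exists>F. finite F \<and> F \<subseteq> Irr \<and> z = (\<Sum>L\<in>F. sl (chi L) z)"
proof -
  obtain G where G: "\<forall>a. finite (G a) \<and> G a \<subseteq> Irr \<and>
      (\<forall>F'. finite F' \<and> G a \<subseteq> F' \<and> F' \<subseteq> Irr \<longrightarrow> \<epsilon> a = (\<Sum>L\<in>F'. chi L a))"
    using eps_eq_sum_chi by metis
  define F where "F = (\<Union>a\<in>fst ` set (\<alpha> z). G a)"
  have F: "finite F" "F \<subseteq> Irr" using G by (auto simp: F_def)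
  have eq: "\<epsilon> a = (\<Sum>L\<in>F. 1 * chi L a)" if "a \<in> fst ` set (\<alpha> z)" for a
  proof -
    have "G a \<subseteq> F" using that by (auto simp: F_def)
    then show ?thesis using G F by simp
  qed
  have "z = sl \<epsilon> z" by simp
  also have "\<dots> = sl (\<lambda>a. \<Sum>L\<in>F. 1 * chi L a) z"
    unfolding sl_def by (intro arg_cong[of _ _ sum_list] map_cong) (use eq in force)+
  also have "\<dots> = (\<Sum>L\<in>F. sl (chi L) z)" unfolding sl_sum_fun by simp
  finally show ?thesis using F by blast
qed

section \<open>Bases, directness and stability of the components\<close>

context
  fixes p zz assumes basis: "mult_basis p zz"
begin

definition ZL :: "(nat \<times> (nat \<Rightarrow> nat \<Rightarrow> 'a)) set \<Rightarrow> 'z set" where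
  "ZL L = Z.vs.span ((\<lambda>(i, j). zz L i j) ` ({..<cdim L} \<times> {..<p L}))"

lemma basisD:
  assumes "L \<in> Irr"
  shows "0 < p L" "\<forall>j<p L. (\<lambda>i. zz L i j) \<in> X L"
    "\<forall>j<p L. \<forall>k<p L. (\<Sum>i<cdim L. stZ (zz L i j) * zz L i k) = (if j = k then 1 else 0)"
    "\<forall>i<cdim L. \<forall>k<cdim L. (\<Sum>j<p L. zz L i j * stZ (zz L k j)) = (if i = k then 1 else 0)"
    "\<forall>x\<in>X L. \<forall>i. \<exists>c. x i = (\<Sum>j<p L. \<iota>Z (c j) * zz L i j)"
  using bspec[OF basis[unfolded mult_basis_def] assms] by - (elim conjE, assumption)+

lemma sl_zz:
  assumes "L \<in> Irr" "i < cdim L" "j < p L" "clin \<iota> \<phi>"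
  shows "sl \<phi> (zz L i j) = (\<Sum>k<cdim L. \<iota>Z (\<phi> (rep L i k)) * zz L k j)"
  using X_sl[of "\<lambda>i. zz L i j" L i \<phi>] basisD(2)[OF assms(1)] assms by simp

lemma zz_in_ZL: "i < cdim L \<Longrightarrow> j < p L \<Longrightarrow> zz L i j \<in> ZL L"
  unfolding ZL_def by (intro Z.vs.span_base image_eqI[of _ _ "(i, j)"]) auto

lemma ZL_scale_sum: "(\<And>k. k < (n::nat) \<Longrightarrow> y k \<in> ZL L) \<Longrightarrow> (\<Sum>k<n. \<iota>Z (c k) * y k) \<in> ZL L"
proof -
  assume y: "\<And>k. k < n \<Longrightarrow> y k \<in> ZL L"
  have "(\<Sum>k<n. sc \<iota>Z (c k) (y k)) \<in> ZL L"
    unfolding ZL_def by (intro Z.vs.span_sum Z.vs.span_scale) (use y in \<open>auto simp: ZL_def\<close>)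
  then show ?thesis by (simp add: sc_def)
qed

lemma X_in_ZL:
  assumes "L \<in> Irr" "x \<in> X L" "i < cdim L"
  shows "x i \<in> ZL L"
proof -
  obtain c where "x i = (\<Sum>j<p L. \<iota>Z (c j) * zz L i j)" using basisD(5)[OF assms(1)] assms(2) by blast
  then show ?thesis using ZL_scale_sum[of "p L" "\<lambda>j. zz L i j" L c] zz_in_ZL[OF assms(3)] by simp
qed

lemma sl_chi_in_ZL:
  assumes "L \<in> Irr"
  shows "sl (chi L) z \<in> ZL L"
proof -
  have "sl (coord L i i) z \<in> ZL L" if "i < cdim L" for i
    using X_in_ZL[OF assms slices_in_X[OF assms that] that, of z] that by simp
  then show ?thesis unfolding sl_chi ZL_def by (intro Z.vs.span_sum) auto
qed

lemma ZL_spans: "Z.vs.span (\<Union>L\<in>Irr. ZL L) = UNIV"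
proof -
  have "z \<in> Z.vs.span (\<Union>L\<in>Irr. ZL L)" for z
  proof -
    obtain F where F: "finite F" "F \<subseteq> Irr" "z = (\<Sum>L\<in>F. sl (chi L) z)"
      using sum_isotypic_projections[of z] by (elim exE conjE)
    have "(\<Sum>L\<in>F. sl (chi L) z) \<in> Z.vs.span (\<Union>L\<in>Irr. ZL L)"
      using F(2) sl_chi_in_ZL by (intro Z.vs.span_sum Z.vs.span_base) blast
    then show ?thesis using F(3) by simp
  qed
  then show ?thesis by blast
qed

text \<open>Slicing z_ij by \<open>chi L\<close> leaves only the diagonal coefficient of its own
  class. Applied to a vanishing sum of components, one such projection isolates a single summand,
  which gives directness.\<close>

lemma sl_chi_on_ZL:
  assumes L: "L \<in> Irr" "L' \<in> Irr" and z: "z \<in> ZL L'"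
  shows "sl (chi L) z = (if L = L' then z else 0)"
  using z unfolding ZL_def
proof (induction rule: Z.vs.span_induct_alt)
  case base
  show ?case using sl_0[OF clin_chi] by simp
next
  case (step c x y)
  then obtain i j where x: "x = zz L' i j" and ij: "i < cdim L'" "j < p L'" by auto
  have "sl (chi L) x = (\<Sum>k<cdim L'. if k = i then (if L = L' then zz L' k j else 0) else 0)"
    unfolding x sl_zz[OF L(2) ij clin_chi] using L ij by (intro sum.cong) (auto simp: chi_rep)
  also have "\<dots> = (if L = L' then x else 0)" using ij by (simp add: x)
  finally have "sl (chi L) x = (if L = L' then x else 0)" .
  then show ?case using step(2) by (simp add: sc_def sl_add[OF clin_chi] sl_scale[OF clin_chi])
qed

lemma ZL_direct:
  assumes F: "finite F" "F \<subseteq> Irr" "\<forall>L\<in>F. f L \<in> ZL L" "(\<Sum>L\<in>F. f L) = 0"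
  shows "\<forall>L\<in>F. f L = 0"
proof
  fix L assume L: "L \<in> F"
  have "0 = sl (chi L) (\<Sum>L\<in>F. f L)" unfolding F(4) using sl_0[OF clin_chi] by simp
  also have "\<dots> = (\<Sum>L'\<in>F. if L = L' then f L' else 0)"
    unfolding sl_sum[OF clin_chi] using F L by (intro sum.cong sl_chi_on_ZL) auto
  also have "\<dots> = f L" using F(1) L by simp
  finally show "f L = 0" ..
qed

lemma ZL_subcomodule:
  assumes L: "L \<in> Irr" and \<phi>: "clin \<iota> \<phi>" and z: "z \<in> ZL L"
  shows "sl \<phi> z \<in> ZL L"
  using z unfolding ZL_def[of L]
proof (induction rule: Z.vs.span_induct_alt)
  case base
  show ?case using sl_0[OF \<phi>] Z.vs.span_zero by simp
next
  case (step c x y)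
  then obtain i j where x: "x = zz L i j" and ij: "i < cdim L" "j < p L" by auto
  have "sl \<phi> x \<in> ZL L" unfolding x sl_zz[OF L ij \<phi>] by (intro ZL_scale_sum zz_in_ZL ij(2))
  then have "sc \<iota>Z c (sl \<phi> x) + sl \<phi> y \<in> ZL L"
    using step(2) unfolding ZL_def by (intro Z.vs.span_add Z.vs.span_scale)
  then have "sl \<phi> (sc \<iota>Z c x + y) \<in> ZL L" by (simp add: sc_def sl_add[OF \<phi>] sl_scale[OF \<phi>])
  then show ?case unfolding ZL_def .
qed

text \<open>Slicing by \<open>coord L i k\<close> keeps the terms of row i and moves them to row k,
  so the coefficients of row i annihilate every row of z. Multiplying by z_kj^* and summing over k,
  orthonormality of the columns isolates the coefficient at (i, j).\<close>

lemma zz_relation: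
  assumes L: "L \<in> Irr" and F: "finite F" "F \<subseteq> {..<cdim L} \<times> {..<p L}"
    and rel: "(\<Sum>x\<in>F. sc \<iota>Z (c x) (case x of (i, j) \<Rightarrow> zz L i j)) = 0"
  shows "\<forall>x\<in>F. c x = 0"
proof
  fix x assume xF: "x \<in> F"
  obtain i j where x: "x = (i, j)" by (cases x)
  have ij: "i < cdim L" "j < p L" using xF F(2) x by auto
  \<comment> \<open>The coefficients of row i, extended by zero to the other rows so that the sums
    still run over F.\<close>
  define c' where "c' y = (if fst y = i then c y else 0)" for y
  have row: "(\<Sum>y\<in>F. \<iota>Z (c' y) * zz L k (snd y)) = 0" if k: "k < cdim L" for k
  proof -
    have "0 = sl (coord L i k) (\<Sum>y\<in>F. sc \<iota>Z (c y) (case y of (i, j) \<Rightarrow> zz L i j))"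
      unfolding rel using sl_0[OF clin_coord] by simp
    also have "\<dots> = (\<Sum>y\<in>F. \<iota>Z (c y) * sl (coord L i k) (zz L (fst y) (snd y)))"
      by (simp add: sl_sum[OF clin_coord] sc_def sl_scale[OF clin_coord] split_def)
    also have "\<dots> = (\<Sum>y\<in>F. \<iota>Z (c' y) * zz L k (snd y))"
    proof (intro sum.cong refl)
      fix y assume "y \<in> F"
      then have y: "fst y < cdim L" "snd y < p L" using F(2) by auto
      have "sl (coord L i k) (zz L (fst y) (snd y)) =
          (\<Sum>l<cdim L. if l = k then (if fst y = i then zz L l (snd y) else 0) else 0)"
        unfolding sl_zz[OF L y clin_coord] using L ij k y by (intro sum.cong) (auto simp: coord_rep)
      also have "\<dots> = (if fst y = i then zz L k (snd y) else 0)" using k by simp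
      finally show "\<iota>Z (c y) * sl (coord L i k) (zz L (fst y) (snd y)) = \<iota>Z (c' y) * zz L k (snd y)"
        by (simp add: c'_def)
    qed
    finally show ?thesis ..
  qed
  have "0 = (\<Sum>k<cdim L. stZ (zz L k j) * (\<Sum>y\<in>F. \<iota>Z (c' y) * zz L k (snd y)))" using row by simp
  also have "\<dots> = (\<Sum>y\<in>F. \<Sum>k<cdim L. \<iota>Z (c' y) * (stZ (zz L k j) * zz L k (snd y)))"
    unfolding sum_distrib_left Z.iota_left_comm[of "stZ _"] by (rule sum.swap)
  also have "\<dots> = (\<Sum>y\<in>F. if y = (i, j) then \<iota>Z (c y) else 0)"
  proof (intro sum.cong refl)
    fix y assume "y \<in> F"
    then have y: "snd y < p L" using F(2) by auto
    have "(\<Sum>k<cdim L. \<iota>Z (c' y) * (stZ (zz L k j) * zz L k (snd y))) = \<iota>Z (c' y) * (if j = snd y then 1 else 0)"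
      using basisD(3)[OF L] ij(2) y by (simp flip: sum_distrib_left)
    also have "\<dots> = (if y = (i, j) then \<iota>Z (c y) else 0)" by (auto simp: c'_def prod_eq_iff)
    finally show "(\<Sum>k<cdim L. \<iota>Z (c' y) * (stZ (zz L k j) * zz L k (snd y))) = (if y = (i, j) then \<iota>Z (c y) else 0)" .
  qed
  also have "\<dots> = \<iota>Z (c x)" using F(1) xF x by simp
  finally show "c x = 0" by simp
qed

lemma zz_independent:
  assumes "L \<in> Irr"
  shows "inj_on (\<lambda>(i, j). zz L i j) ({..<cdim L} \<times> {..<p L})"
    and "Z.vs.independent ((\<lambda>(i, j). zz L i j) ` ({..<cdim L} \<times> {..<p L}))"
  by (rule Z.vs.independent_familyI; rule zz_relation[OF assms]; assumption)+

end

end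

theorem theorem5p1p1:
  fixes \<iota> :: "complex \<Rightarrow> 'a::ring_1" and st :: "'a \<Rightarrow> 'a"
    and \<Delta> :: "'a \<Rightarrow> ('a \<times> 'a) list" and \<epsilon> :: "'a \<Rightarrow> complex"
    and \<iota>Z :: "complex \<Rightarrow> 'z::ring_1" and stZ :: "'z \<Rightarrow> 'z"
    and \<alpha> :: "'z \<Rightarrow> ('a \<times> 'z) list" and \<mu> :: "'z \<Rightarrow> complex"
  assumes "hopf_star_alg \<iota> st \<Delta> \<epsilon>"
    and "unitarizable \<iota> st \<Delta> \<epsilon>"
    and "star_galois \<iota> st \<Delta> \<epsilon> \<iota>Z stZ \<alpha>"
    and "pos_haar \<iota> \<iota>Z stZ \<alpha> \<mu>"
  shows "\<exists>(ZL :: (nat \<times> (nat \<Rightarrow> nat \<Rightarrow> 'a)) set \<Rightarrow> 'z set) (p :: (nat \<times> (nat \<Rightarrow> nat \<Rightarrow> 'a)) set \<Rightarrow> nat) zz aa.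
    \<comment> \<open>Z is the direct sum of the Z(lambda)\<close>
    module.span (sc \<iota>Z) (\<Union>L\<in>irr_classes \<iota> \<Delta> \<epsilon>. ZL L) = UNIV \<and>
    (\<forall>F f. finite F \<and> F \<subseteq> irr_classes \<iota> \<Delta> \<epsilon> \<and> (\<forall>L\<in>F. f L \<in> ZL L) \<and> (\<Sum>L\<in>F. f L) = 0
        \<longrightarrow> (\<forall>L\<in>F. f L = 0)) \<and>
    (\<forall>L\<in>irr_classes \<iota> \<Delta> \<epsilon>.
       0 < p L \<and>
       \<comment> \<open>basis (z_ij) of Z(lambda), hence dim Z(lambda) = n_lambda p_lambda\<close>
       inj_on (\<lambda>(i, j). zz L i j) ({..<cdim L} \<times> {..<p L}) \<and>
       \<not> module.dependent (sc \<iota>Z) ((\<lambda>(i, j). zz L i j) ` ({..<cdim L} \<times> {..<p L})) \<and>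
       module.span (sc \<iota>Z) ((\<lambda>(i, j). zz L i j) ` ({..<cdim L} \<times> {..<p L})) = ZL L \<and>
       \<comment> \<open>Z(lambda) is a sub-comodule\<close>
       (\<forall>z\<in>ZL L. \<forall>\<phi>. clin \<iota> \<phi> \<longrightarrow> sum_list (map (\<lambda>(a, w). \<iota>Z (\<phi> a) * w) (\<alpha> z)) \<in> ZL L) \<and>
       (\<forall>j<p L. \<forall>k<p L. (\<Sum>i<cdim L. stZ (zz L i j) * zz L i k) = (if j = k then 1 else 0)) \<and>
       (\<forall>i<cdim L. \<forall>k<cdim L. (\<Sum>j<p L. zz L i j * stZ (zz L k j)) = (if i = k then 1 else 0)) \<and>
       \<comment> \<open>unitarity of (a_ij)\<close>
       (\<forall>i<cdim L. \<forall>j<cdim L. (\<Sum>k<cdim L. st (aa L k i) * aa L k j) = (if i = j then 1 else 0)) \<and>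
       (\<forall>i<cdim L. \<forall>j<cdim L. (\<Sum>k<cdim L. aa L i k * st (aa L j k)) = (if i = j then 1 else 0)) \<and>
       \<comment> \<open>coaction formula\<close>
       (\<forall>i<cdim L. \<forall>j<p L.
          teq \<iota> \<iota>Z (\<alpha> (zz L i j)) (map (\<lambda>k. (aa L i k, zz L k j)) [0..<cdim L]))) \<and>
    \<comment> \<open>(a_ij^lambda) is a basis of A\<close>
    inj_on (\<lambda>(L, i, j). aa L i j) (SIGMA L:irr_classes \<iota> \<Delta> \<epsilon>. {..<cdim L} \<times> {..<cdim L}) \<and>
    \<not> module.dependent (sc \<iota>) ((\<lambda>(L, i, j). aa L i j) ` (SIGMA L:irr_classes \<iota> \<Delta> \<epsilon>. {..<cdim L} \<times> {..<cdim L})) \<and>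
    module.span (sc \<iota>) ((\<lambda>(L, i, j). aa L i j) ` (SIGMA L:irr_classes \<iota> \<Delta> \<epsilon>. {..<cdim L} \<times> {..<cdim L})) = UNIV"
proof -
  interpret galois_extension \<iota> st \<Delta> \<epsilon> \<iota>Z stZ \<alpha> \<mu>
    using assms by unfold_locales
  obtain p zz where basis: "mult_basis p zz" using mult_basis_exists by (elim exE)
  note D = basisD[OF basis]
  have co: "teq \<iota> \<iota>Z (\<alpha> (zz L i j)) (map (\<lambda>k. (rep L i k, zz L k j)) [0..<cdim L])"
    if "L \<in> Irr" "i < cdim L" "j < p L" for L i j
    using D(2)[OF that(1)] that by (intro co_teq) (auto simp: X_def)
  have unitary: "(\<Sum>k<cdim L. st (rep L k i) * rep L k j) = (if i = j then 1 else 0)"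
    "(\<Sum>k<cdim L. rep L i k * st (rep L j k)) = (if i = j then 1 else 0)"
    if "L \<in> Irr" "i < cdim L" "j < cdim L" for L i j
    using fun_cong[OF fun_cong[OF ucrepD(2)[OF rep(1)[OF that(1)]], of i], of j]
      fun_cong[OF fun_cong[OF ucrepD(3)[OF rep(1)[OF that(1)]], of i], of j] that(2,3)
    by (simp_all add: mmul_def madj_def mone_def)
  show ?thesis
  proof (rule exI[of _ "ZL p zz"], rule exI[of _ p], rule exI[of _ zz], rule exI[of _ rep],
      intro conjI ballI allI impI)
    show "module.span (sc \<iota>Z) (\<Union>L\<in>Irr. ZL p zz L) = UNIV" by (rule ZL_spans[OF basis])
  next
    fix F f L
    assume "finite F \<and> F \<subseteq> Irr \<and> (\<forall>L\<in>F. f L \<in> ZL p zz L) \<and> (\<Sum>L\<in>F. f L) = 0" "L \<in> F"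
    then show "f L = 0" using ZL_direct[OF basis, of F f] by blast
  next
    fix L z \<phi> assume "L \<in> Irr" "z \<in> ZL p zz L" "clin \<iota> \<phi>"
    then show "sum_list (map (\<lambda>(a, w). \<iota>Z (\<phi> a) * w) (\<alpha> z)) \<in> ZL p zz L"
      using ZL_subcomodule[OF basis] by (simp add: sl_def)
  next
    fix L assume L: "L \<in> Irr"
    show "0 < p L" by (rule D(1)[OF L])
    show "inj_on (\<lambda>(i, j). zz L i j) ({..<cdim L} \<times> {..<p L})" by (rule zz_independent(1)[OF basis L])
    show "\<not> module.dependent (sc \<iota>Z) ((\<lambda>(i, j). zz L i j) ` ({..<cdim L} \<times> {..<p L}))"
      by (rule zz_independent(2)[OF basis L])
    show "module.span (sc \<iota>Z) ((\<lambda>(i, j). zz L i j) ` ({..<cdim L} \<times> {..<p L})) = ZL p zz L"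
      by (rule ZL_def[OF basis, symmetric])
    fix j k assume "j < p L" "k < p L"
    then show "(\<Sum>i<cdim L. stZ (zz L i j) * zz L i k) = (if j = k then 1 else 0)" using D(3)[OF L] by blast
  next
    fix L i k assume "L \<in> Irr" "i < cdim L" "k < cdim L"
    then show "(\<Sum>j<p L. zz L i j * stZ (zz L k j)) = (if i = k then 1 else 0)" using D(4) by blast
  next
    show "inj_on (\<lambda>(L, i, j). rep L i j) (SIGMA L:Irr. {..<cdim L} \<times> {..<cdim L})" by (rule coefs_inj)
    show "\<not> module.dependent (sc \<iota>) ((\<lambda>(L, i, j). rep L i j) ` (SIGMA L:Irr. {..<cdim L} \<times> {..<cdim L}))"
      using coefs_independent unfolding coefs_def .
    show "module.span (sc \<iota>) ((\<lambda>(L, i, j). rep L i j) ` (SIGMA L:Irr. {..<cdim L} \<times> {..<cdim L})) = UNIV"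
      using coefs_span unfolding coefs_def .
  qed (rule unitary co; assumption)+
qed

end
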